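(* Let $((\mathbf A_i,\mathbf B_i))_{i\ge1}$ be an iid sequence with generic element $(\mathbf A,\mathbf B)$, where $\mathbf A$ is a random $d\times d$ matrix and $\mathbf B$ an $\mathbb R^d$-valued random vector, possibly dependent on each other. Assume that there is $\alpha>0$ such that the following hold: (C1) $(\mathbf A,\mathbf B)$ is regularly varying with index $\alpha$ and some non-null Radon limit measure $\mu^{(\mathbf A,\mathbf B)}$, i.e. $\dfrac{\mathbb P(t^{-1}(\mathbf A,\mathbf B)\in\cdot)}{\mathbb P(\|(\mathbf A,\mathbf B)\|>t)}\stackrel{v}{\to}\mu^{(\mathbf A,\mathbf B)}(\cdot)$ as $t\to\infty$; (C2) $X=\|(\mathbf A_1,\mathbf B_1)\|$ and $Y=\|(\mathbf A_2,\mathbf B_2)\|$ satisfy $\displaystyle\lim_{M\to\infty}\limsup_{x\to\infty}\frac{\mathbb P(XY>x,\ M<X\le x/M)}{\mathbb P(X>x)}=0$; (C3) $\mathbb E[\|\mathbf A\|^\alpha]<1$ and $\mu^{(\mathbf A,\mathbf B)}(\{(\mathbf a,\mathbf b):\|\mathbf a\|>1\})>0$. Let $\mathbf R$ have the law of $\sum_{k=0}^\infty\mathbf\Pi_k\mathbf B_{k+1}$, where $\mathbf\Pi_k=\mathbf A_1\cdots\mathbf A_k$ and $\mathbf\Pi_0=\mathrm{Id}_d$. Then, as $t\to\infty$, $$\frac{\mathbb P(t^{-1}\mathbf R\in\cdot)}{\mathbb P(\|(\mathbf A,\mathbf B)\|>t)}\stackrel{v}{\to}\nu(\cdot)=\sum_{n=0}^\infty\mathbb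 E\big[\mu^{(\mathbf A,\mathbf B)}(\{(\mathbf a,\mathbf b):\mathbf\Pi_n(\mathbf a\mathbf R_0+\mathbf b)\in\cdot\})\big],$$ where $\mathbf R_0$ is a copy of $\mathbf R$ independent of $(\mathbf\Pi_n)_{n\ge0}$. In particular, if the measure $\nu$ on $\mathbb R^d\setminus\{\mathbf 0\}$ is non-null, then $\mathbf R\in\mathrm{RV}(\alpha,\mu^{\mathbf R})$ with $\mu^{\mathbf R}(\cdot)=\nu(\cdot)/\nu(\{\mathbf r:\|\mathbf r\|>1\})$.
   Context: $\mathbb R^d$ carries the Euclidean norm, $d\times d$ matrices ($\mathbb M_{d\times d}$) carry the operator norm with respect to the Euclidean norm, and $\mathbb M_{d\times d}\times\mathbb R^d$ carries the norm $\|(\mathbf a,\mathbf b)\|=\|\mathbf a\|+\|\mathbf b\|$. For measures on a finite-dimensional normed space $E$ with the origin removed, $\stackrel{v}{\to}$ (vague convergence) means convergence of integrals of all non-negative continuous functions with compact support in $E\setminus\{\mathbf 0\}$. A random element $\mathbf X$ of $E$ is regularly varying with index $\alpha>0$ and limit measure $\mu^{\mathbf X}$, written $\mathbf X\in\mathrm{RV}(\alpha,\mu^{\mathbf X})$, if $\mu^{\mathbf X}$ is a non-null Radon measure on $E\setminus\{\mathbf 0\}$ such that $\mathbb P(t^{-1}\mathbf X\in\cdot)/\mathbb P(\|\mathbf X\|>t)\stackrel{v}{\to}\mu^{\mathbf X}(\cdot)$ as $t\to\infty$, and $\mu^{\mathbf X}(tA)=t^{-\alpha}\mu^{\mathbf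 X}(A)$ for all $t>0$ and Borel $A$. The law of $\mathbf R$ satisfies the fixed point equation $\mathbf R\stackrel{d}{=}\mathbf A\mathbf R+\mathbf B$ with $\mathbf R$ independent of $(\mathbf A,\mathbf B)$ on the right-hand side. *)

theory Defs
  imports "HOL-Probability.Probability"
begin

abbreviation borel_punctured :: "'a::real_normed_vector measure" where
  "borel_punctured \<equiv> restrict_space borel (- {0})"

text \<open>
  Measures on \<open>E \<setminus> {0}\<close> are represented by measures on the restricted Borel space
  \<^const>\<open>borel_punctured\<close>. Since \<open>E\<close> is finite-dimensional, a Borel measure there is Radon
  iff it is finite on compact sets.
\<close>

definition radon_punctured :: "'a::euclidean_space measure \<Rightarrow> bool" where
  "radon_punctured \<mu> \<longleftrightarrow>
     sets \<mu> = sets borel_punctured \<and>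
     (\<forall>K. compact K \<and> 0 \<notin> K \<longrightarrow> emeasure \<mu> K < \<infinity>)"

text \<open>
  The test functions live on \<open>E \<setminus> {0}\<close>: the value of \<open>f\<close> at the origin is irrelevant,
  and the compact set \<open>K\<close> stays away from the origin.
\<close>

definition punctured_test_function :: "('a::euclidean_space \<Rightarrow> real) \<Rightarrow> bool" where
  "punctured_test_function f \<longleftrightarrow>
     continuous_on (- {0}) f \<and> (\<forall>x\<in>- {0}. 0 \<le> f x) \<and>
     (\<exists>K. compact K \<and> 0 \<notin> K \<and> (\<forall>x\<in>- {0} - K. f x = 0))"

definition vague_limit :: "(real \<Rightarrow> 'a::euclidean_space measure) \<Rightarrow> 'a measure \<Rightarrow> bool" where
  "vague_limit m \<mu> \<longleftrightarrow>
     (\<forall>f. punctured_test_function f \<longrightarrow>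
        ((\<lambda>t. \<integral>\<^sup>+x. ennreal (f x) \<partial>m t) \<longlongrightarrow> (\<integral>\<^sup>+x. ennreal (f x) \<partial>\<mu>)) at_top)"

text \<open>
  \<open>scaled_law M X Z t\<close> is the measure \<open>P(X / t \<in> \<cdot>) / P(Z > t)\<close> on \<open>E \<setminus> {0}\<close>.
\<close>

definition scaled_law ::
  "'w measure \<Rightarrow> ('w \<Rightarrow> 'a::euclidean_space) \<Rightarrow> ('w \<Rightarrow> real) \<Rightarrow> real \<Rightarrow> 'a measure" where
  "scaled_law M X Z t =
     scale_measure (ennreal (1 / measure M {\<omega> \<in> space M. Z \<omega> > t}))
       (restrict_space (distr M borel (\<lambda>\<omega>. X \<omega> /\<^sub>R t)) (- {0}))"

text \<open>
  The norm \<open>N\<close> on \<open>E\<close> is a parameter because the norms that the type classes put on matrices and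
  on products are the Frobenius and Euclidean ones, not the operator norm and the sum norm.
  All of these induce the same topology and Borel sets.
\<close>

definition regularly_varying ::
  "('a::euclidean_space \<Rightarrow> real) \<Rightarrow> 'w measure \<Rightarrow> ('w \<Rightarrow> 'a) \<Rightarrow> real \<Rightarrow> 'a measure \<Rightarrow> bool" where
  "regularly_varying N M X \<alpha> \<mu> \<longleftrightarrow>
     \<alpha> > 0 \<and> X \<in> borel_measurable M \<and>
     radon_punctured \<mu> \<and> emeasure \<mu> (- {0}) \<noteq> 0 \<and>
     vague_limit (scaled_law M X (\<lambda>\<omega>. N (X \<omega>))) \<mu> \<and>
     (\<forall>t>0. \<forall>S\<in>sets \<mu>. emeasure \<mu> ((\<lambda>x. t *\<^sub>R x) ` S) = ennreal (t powr - \<alpha>) * emeasure \<mu> S)"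

definition op_norm :: "real^'d^'d \<Rightarrow> real" where
  "op_norm a = onorm (\<lambda>x. a *v x)"

definition pair_norm :: "(real^'d^'d) \<times> (real^'d) \<Rightarrow> real" where
  "pair_norm p = op_norm (fst p) + norm (snd p)"

primrec matrix_prod :: "(nat \<Rightarrow> real^'d^'d) \<Rightarrow> nat \<Rightarrow> real^'d^'d" where
  "matrix_prod a 0 = mat 1"
| "matrix_prod a (Suc k) = matrix_prod a k ** a (Suc k)"

text \<open>
  Independence of random variables with possibly different codomains
  (\<^const>\<open>prob_space.indep_var\<close> forces both into the same type).
\<close>

definition independent_rvs ::
  "'w measure \<Rightarrow> 'a measure \<Rightarrow> ('w \<Rightarrow> 'a) \<Rightarrow> 'b measure \<Rightarrow> ('w \<Rightarrow> 'b) \<Rightarrow> bool" where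
  "independent_rvs M S X T Y \<longleftrightarrow>
     X \<in> M \<rightarrow>\<^sub>M S \<and> Y \<in> M \<rightarrow>\<^sub>M T \<and>
     (\<forall>U\<in>sets S. \<forall>V\<in>sets T.
        measure M {\<omega> \<in> space M. X \<omega> \<in> U \<and> Y \<omega> \<in> V} =
        measure M {\<omega> \<in> space M. X \<omega> \<in> U} * measure M {\<omega> \<in> space M. Y \<omega> \<in> V})"

end

theory Submission
  imports Defs
begin

text \<open>
  Write \<open>N\<close> for the norm of the pair \<open>(A, B)\<close> and \<open>F t\<close>
  for the probability of \<open>N > t\<close>. The law \<open>L\<close> of the series satisfies
  \<open>R = A R' + B\<close> in law with \<open>R'\<close> an independent copy of
  \<open>R\<close>. The proof compares \<open>\<nu>\<^sub>t(f) = E f(R / t) / F t\<close>, for a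
  test function \<open>f\<close> that vanishes near the origin, with the same quantity after one
  application of this equation, and splits according to the size of \<open>N\<close>.

  If \<open>N \<le> K\<close>, then \<open>B / t\<close> is negligible and this part is
  \<open>\<nu>\<^sub>t(Q f)\<close> up to \<open>o(1)\<close>, where \<open>Q f(r)\<close> is
  the expectation of \<open>f(A r)\<close> on \<open>N \<le> K\<close>
  (\<open>bounded_shock_limit\<close>). If \<open>N\<close> is of order \<open>t\<close>, then
  \<open>R'\<close> keeps its own scale, the regular variation of \<open>(A, B)\<close> applies
  for each value of \<open>R'\<close>, and the limit is the expectation of \<open>\<mu>(f(a R' +
  b))\<close> (\<open>shock_limit\<close>). The range between \<open>K\<close> and a small
  multiple of \<open>t\<close> is what hypothesis \<open>C2\<close> declares negligible
  (\<open>middle_shock\<close>). Thus \<open>\<nu>\<^sub>t(f)\<close> equals the summand with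
  index 0 of the limit plus \<open>\<nu>\<^sub>t(Q f)\<close>, up to small errors, and since
  \<open>Q f\<close> is again a test function the step can be iterated: the truncation of
  \<open>Q\<close> is removed by monotone convergence, and the summands with indices \<open>1,
  2, ...\<close> appear one after the other.

  Two facts make the iteration close up. First, the probability of \<open>|R| > t\<close> is at
  most \<open>C F t\<close> (\<open>L_tail\<close>). It is shown for the partial sums by
  induction with one constant: the three-way split above shows that an affine step turns a bound
  with constant \<open>C\<close> into one with constant \<open>c + \<theta> C\<close>, where
  \<open>\<theta> < 1\<close> because \<open>E |A|\<^sup>\<alpha> < 1\<close>
  (\<open>tail_step\<close>); the series then converges almost surely as a by-product. Second,
  the remainder after \<open>n\<close> steps is of order \<open>(E
  |A|\<^sup>\<alpha>)\<^sup>n\<close>. For this, test functions are dominated by functions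
  \<open>c P(Z |r| > 1)\<close> with a bounded random scale \<open>Z\<close>; on such functions
  \<open>\<nu>\<^sub>t\<close> is asymptotically at most \<open>C c E Z\<^sup>\<alpha>\<close>,
  and \<open>Q\<close> multiplies \<open>Z\<close> by an independent factor that is at most
  \<open>|A|\<close> (\<open>dominated_upper\<close>, \<open>dominated_trunc_op\<close>).

  The operator \<open>Q\<close> does not preserve compact supports, so all this takes place in
  the class \<open>tail_test\<close> of bounded uniformly continuous functions that vanish near
  the origin. Vague convergence of the law of \<open>(A, B)\<close> extends to bounded
  continuous functions that vanish near the origin because no mass escapes to infinity:
  \<open>F\<close> is itself regularly varying and \<open>\<mu>\<close> gives mass one to
  \<open>N > 1\<close> (\<open>mass_eq_1\<close>, \<open>F_rv\<close>,
  \<open>tail_test_limit\<close>). The larger class also yields the convergence of \<open>P(|R|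
  > t) / F t\<close>, and with it the regular variation of \<open>R\<close>
  (\<open>regularly_varying_of_tail_limit\<close>).
\<close>

section \<open>Measures and test functions away from the origin\<close>

text \<open>
  Extending a measure by zero mass at the origin lets limit measures be used on the full Borel
  space, where the measurability of maps needs no restriction.
\<close>

definition extend0 :: "'a::euclidean_space measure \<Rightarrow> 'a measure" where
  "extend0 \<mu> = distr \<mu> borel (\<lambda>x. x)"

lemma space_punctured:
  assumes "sets \<mu> = sets (borel_punctured :: 'a::euclidean_space measure)"
  shows "space \<mu> = - {0}"
  using sets_eq_imp_space_eq[OF assms] by (simp add: space_restrict_space)

lemma measurable_ident_punctured:
  assumes "sets \<mu> = sets (borel_punctured :: 'a::euclidean_space measure)"
  shows "(\<lambda>x. x) \<in> measurable \<mu> borel"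
  using measurable_restrict_space1[OF measurable_ident, of borel "- {0::'a}"] assms
  by (simp add: id_def cong: measurable_cong_sets)

lemma sets_extend0 [simp, measurable_cong]: "sets (extend0 \<mu>) = sets borel"
  by (simp add: extend0_def)

lemma space_extend0 [simp]: "space (extend0 \<mu>) = UNIV"
  by (simp add: extend0_def)

lemma emeasure_extend0:
  assumes "sets \<mu> = sets (borel_punctured :: 'a::euclidean_space measure)"
    and "S \<in> sets borel"
  shows "emeasure (extend0 \<mu>) S = emeasure \<mu> (S - {0})"
proof -
  have "S \<inter> - {0} = S - {0}" by auto
  then show ?thesis
    unfolding extend0_def
    by (subst emeasure_distr) (auto simp: measurable_ident_punctured assms space_punctured[OF assms(1)])
qed

lemma nn_integral_extend0:
  assumes "sets \<mu> = sets (borel_punctured :: 'a::euclidean_space measure)"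
    and "f \<in> borel_measurable borel"
  shows "(\<integral>\<^sup>+x. f x \<partial>extend0 \<mu>) = (\<integral>\<^sup>+x. f x \<partial>\<mu>)"
  unfolding extend0_def
  by (subst nn_integral_distr) (auto simp: measurable_ident_punctured assms)

lemma AE_extend0_neq_0:
  assumes "sets \<mu> = sets (borel_punctured :: 'a::euclidean_space measure)"
  shows "AE x in extend0 \<mu>. x \<noteq> 0"
  by (rule AE_I[of _ _ "{0}"]) (auto simp: emeasure_extend0 assms)

lemma sets_puncturedI:
  "S \<in> sets borel \<Longrightarrow> 0 \<notin> S \<Longrightarrow> S \<in> sets (borel_punctured :: 'a::euclidean_space measure)"
  by (auto simp: sets_restrict_space intro!: image_eqI[of _ _ S])

lemma sets_puncturedD:
  "S \<in> sets (borel_punctured :: 'a::euclidean_space measure) \<Longrightarrow> S \<in> sets borel \<and> 0 \<notin> S"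
  by (auto simp: sets_restrict_space)

text \<open>
  This class replaces the continuous functions with compact support in the punctured space.
  Unbounded supports are allowed because averaging over a random matrix, which may be singular,
  destroys boundedness of the support; uniform continuity, unlike mere continuity, gives control
  over a perturbation of size \<open>1 / t\<close> simultaneously at all points.
\<close>

definition tail_test :: "('a::euclidean_space \<Rightarrow> real) \<Rightarrow> bool" where
  "tail_test f \<longleftrightarrow> (\<forall>x. 0 \<le> f x) \<and> (\<exists>c. \<forall>x. f x \<le> c) \<and>
     uniformly_continuous_on UNIV f \<and> (\<exists>\<delta>>0. \<forall>x. norm x < \<delta> \<longrightarrow> f x = 0)"

text \<open>
  The function vanishes on the open complement of its compact support, and this set contains the
  origin; so the value prescribed there fits continuously.
\<close>

lemma continuous_punctured_test:
  fixes f :: "'a::euclidean_space \<Rightarrow> real"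
  assumes "punctured_test_function f"
  shows "continuous_on UNIV (\<lambda>x. if x = 0 then 0 else f x)"
proof -
  obtain K where K: "compact K" "0 \<notin> K" "\<forall>x\<in>- {0} - K. f x = 0" and f: "continuous_on (- {0}) f"
    using assms by (auto simp: punctured_test_function_def)
  have "continuous_on (- {0} \<union> - K) (\<lambda>x. if x = 0 then 0 else f x)"
  proof (rule continuous_on_open_Un)
    show "open (- {0::'a})" by auto
    show "open (- K)" using K compact_imp_closed by (auto simp: open_Compl)
    show "continuous_on (- {0}) (\<lambda>x. if x = 0 then 0 else f x)"
      using f by (rule continuous_on_eq) auto
    show "continuous_on (- K) (\<lambda>x. if x = 0 then 0 else f x)"
      by (rule continuous_on_eq[of _ "\<lambda>_. 0"]) (use K in auto)
  qed
  moreover have "- {0} \<union> - K = UNIV" using K by auto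
  ultimately show ?thesis by simp
qed

lemma tail_test_punctured_test:
  fixes f :: "'a::euclidean_space \<Rightarrow> real"
  assumes "punctured_test_function f"
  shows "tail_test (\<lambda>x. if x = 0 then 0 else f x)" (is "tail_test ?g")
proof -
  obtain K where K: "compact K" "0 \<notin> K" "\<forall>x\<in>- {0} - K. f x = 0" and nn: "\<forall>x\<in>- {0}. 0 \<le> f x"
    using assms by (auto simp: punctured_test_function_def)
  note cont = continuous_punctured_test[OF assms]
  have out: "?g x = 0" if "x \<notin> K" for x using that K by auto
  obtain b where "\<forall>x\<in>K. norm x \<le> b"
    using compact_imp_bounded[OF K(1)] by (auto simp: bounded_iff)
  then have b: "K \<subseteq> cball 0 b" by auto
  obtain \<delta> where \<delta>: "\<delta> > 0" "\<forall>x\<in>K. \<delta> \<le> dist 0 x"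
    using separate_point_closed[OF compact_imp_closed[OF K(1)] K(2)] by auto
  have "bounded (?g ` K)"
    using compact_continuous_image[OF continuous_on_subset[OF cont] K(1)] compact_imp_bounded by blast
  then obtain c where "\<forall>y\<in>?g ` K. norm y \<le> c" unfolding bounded_iff by blast
  then have c: "norm (?g x) \<le> c" if "x \<in> K" for x using that by blast
  have "?g x \<le> max c 0" for x
  proof (cases "x \<in> K")
    case True then show ?thesis using c[OF True] by auto
  next
    case False then show ?thesis using out[OF False] by auto
  qed
  moreover have "uniformly_continuous_on UNIV ?g"
    unfolding uniformly_continuous_on_def
  proof (intro allI impI)
    fix e :: real assume e: "e > 0"
    have "uniformly_continuous_on (cball 0 (b + 1)) ?g"
      by (rule compact_uniformly_continuous) (use continuous_on_subset[OF cont] in auto)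
    then obtain d where d: "d > 0"
      "\<And>x y. x \<in> cball 0 (b+1) \<Longrightarrow> y \<in> cball 0 (b+1) \<Longrightarrow> dist y x < d \<Longrightarrow> dist (?g y) (?g x) < e"
      using e unfolding uniformly_continuous_on_def by meson
    have "dist (?g y) (?g x) < e" if dist: "dist y x < min d 1" for x y
    proof (cases "x \<in> K \<or> y \<in> K")
      case True
      then have "norm x \<le> b \<or> norm y \<le> b" using b by (auto simp: subset_eq)
      moreover have "norm x \<le> norm y + dist y x" "norm y \<le> norm x + dist y x"
        by norm+
      ultimately have "norm x \<le> b + 1" "norm y \<le> b + 1" using dist by auto
      then show ?thesis using d(2)[of x y] dist by simp
    next
      case False then show ?thesis using out e by simp
    qed
    then show "\<exists>d>0. \<forall>x\<in>UNIV. \<forall>x'\<in>UNIV. dist x' x < d \<longrightarrow> dist (?g x') (?g x) < e"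
      using d(1) by (intro exI[of _ "min d 1"]) auto
  qed
  moreover have "?g x = 0" if "norm x < \<delta>" for x
    using that \<delta> by (intro out) auto
  ultimately show ?thesis
    unfolding tail_test_def using nn \<delta>(1)
    by (intro conjI exI[of _ "max c 0"] exI[of _ \<delta>] allI impI) auto
qed

lemma nn_integral_scaled_law:
  fixes f :: "'a::euclidean_space \<Rightarrow> real"
  assumes f: "f \<in> borel_measurable borel" "f 0 = 0" and X: "X \<in> borel_measurable M"
  shows "(\<integral>\<^sup>+x. ennreal (f x) \<partial>scaled_law M X Z t) =
    ennreal (1 / measure M {\<omega> \<in> space M. Z \<omega> > t}) * (\<integral>\<^sup>+\<omega>. ennreal (f (X \<omega> /\<^sub>R t)) \<partial>M)"
proof -
  note [measurable] = f X
  have "(\<integral>\<^sup>+x. ennreal (f x) \<partial>scaled_law M X Z t) =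
    ennreal (1 / measure M {\<omega> \<in> space M. Z \<omega> > t}) *
      (\<integral>\<^sup>+x. ennreal (f x) \<partial>restrict_space (distr M borel (\<lambda>\<omega>. X \<omega> /\<^sub>R t)) (- {0}))"
    unfolding scaled_law_def
    by (subst nn_integral_scale_measure) (auto intro!: measurable_restrict_space1)
  also have "(\<integral>\<^sup>+x. ennreal (f x) \<partial>restrict_space (distr M borel (\<lambda>\<omega>. X \<omega> /\<^sub>R t)) (- {0})) =
      (\<integral>\<^sup>+x. ennreal (f x) * indicator (- {0}) x \<partial>distr M borel (\<lambda>\<omega>. X \<omega> /\<^sub>R t))"
    by (subst nn_integral_restrict_space) auto
  also have "\<dots> = (\<integral>\<^sup>+x. ennreal (f x) \<partial>distr M borel (\<lambda>\<omega>. X \<omega> /\<^sub>R t))"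
    by (rule nn_integral_cong) (auto simp: f indicator_def)
  also have "\<dots> = (\<integral>\<^sup>+\<omega>. ennreal (f (X \<omega> /\<^sub>R t)) \<partial>M)"
    by (subst nn_integral_distr) auto
  finally show ?thesis .
qed

lemma nn_integral_punctured_cong:
  fixes f :: "'a::euclidean_space \<Rightarrow> real"
  assumes "sets \<mu> = sets (borel_punctured :: 'a measure)"
  shows "(\<integral>\<^sup>+x. ennreal (f x) \<partial>\<mu>) = (\<integral>\<^sup>+x. ennreal (if x = 0 then 0 else f x) \<partial>\<mu>)"
  by (rule nn_integral_cong) (auto simp: space_punctured[OF assms])

lemma sets_scaled_law: "sets (scaled_law M X Z t) = sets borel_punctured"
  by (auto simp: scaled_law_def sets_restrict_space)

text \<open>
  A test function may have any value at the origin, where the scaled law has no mass. After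
  resetting that value to zero, the integral becomes an expectation on the original space.
\<close>

lemma nn_integral_scaled_law_punctured:
  fixes f :: "'a::euclidean_space \<Rightarrow> real"
  assumes f: "punctured_test_function f" and X: "X \<in> borel_measurable M"
  shows "(\<integral>\<^sup>+x. ennreal (f x) \<partial>scaled_law M X Z t) =
    ennreal (1 / measure M {\<omega> \<in> space M. Z \<omega> > t}) *
      (\<integral>\<^sup>+\<omega>. ennreal (if X \<omega> /\<^sub>R t = 0 then 0 else f (X \<omega> /\<^sub>R t)) \<partial>M)"
  unfolding nn_integral_punctured_cong[OF sets_scaled_law, where f=f]
  by (rule nn_integral_scaled_law[OF borel_measurable_continuous_onI[OF continuous_punctured_test[OF f]] _ X]) simp

text \<open>
  Piecewise linear substitutes for the indicator of a half-line: \<open>ramp a b\<close> lies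
  between the indicators of \<open>[b, \<infinity>)\<close> and \<open>(a, \<infinity>)\<close>.
\<close>

definition ramp :: "real \<Rightarrow> real \<Rightarrow> real \<Rightarrow> real" where
  "ramp a b s = max 0 (min 1 ((s - a) / (b - a)))"

lemma ramp_bounds [simp]: "0 \<le> ramp a b s" "ramp a b s \<le> 1"
  by (auto simp: ramp_def)

lemma ramp_eq_0: "a < b \<Longrightarrow> s \<le> a \<Longrightarrow> ramp a b s = 0"
  by (auto simp: ramp_def divide_simps max_def min_def)

lemma ramp_eq_1: "a < b \<Longrightarrow> b \<le> s \<Longrightarrow> ramp a b s = 1"
  by (auto simp: ramp_def divide_simps max_def min_def)

lemma continuous_on_ramp [continuous_intros]:
  "a < b \<Longrightarrow> continuous_on S f \<Longrightarrow> continuous_on S (\<lambda>x. ramp a b (f x))"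
  unfolding ramp_def by (intro continuous_intros) auto

section \<open>Regularly varying laws\<close>

text \<open>
  The norm \<open>N\<close> enters only through continuity, homogeneity and positivity, which
  suffice to make its shells compact. The law \<open>D\<close> of the regularly varying element
  is studied in place of the element.
\<close>

locale regvar = prob_space D for D :: "'a::euclidean_space measure" +
  fixes N :: "'a \<Rightarrow> real" and \<alpha> :: real and \<mu> :: "'a measure"
  assumes sets_D [measurable_cong, simp]: "sets D = sets borel"
    and N_cont: "continuous_on UNIV N"
    and N_scale: "\<And>c x. N (c *\<^sub>R x) = \<bar>c\<bar> * N x"
    and N_pos: "\<And>x. x \<noteq> 0 \<Longrightarrow> 0 < N x"
    and rv: "regularly_varying N D (\<lambda>x. x) \<alpha> \<mu>"
begin

definition F :: "real \<Rightarrow> real" where "F t = measure D {x. N x > t}"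

abbreviation \<mu>0 where "\<mu>0 \<equiv> extend0 \<mu>"

lemma space_D [simp]: "space D = UNIV"
  using sets_eq_imp_space_eq[OF sets_D] by simp

lemma sets_mu: "sets \<mu> = sets borel_punctured"
  and alpha_pos: "\<alpha> > 0"
  using rv by (auto simp: regularly_varying_def radon_punctured_def)

lemma N_measurable [measurable]: "N \<in> borel_measurable borel"
  using N_cont by (rule borel_measurable_continuous_onI)

lemma N_0 [simp]: "N 0 = 0" using N_scale[of 0 0] by simp

lemma N_nonneg [simp]: "0 \<le> N x" using N_pos[of x] by (cases "x = 0") auto

lemma N_divide: "t > 0 \<Longrightarrow> N (x /\<^sub>R t) = N x / t"
  by (simp add: N_scale field_simps)

text \<open>
  \<open>N\<close> attains a positive minimum on the compact unit sphere.
\<close>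

lemma N_lower: obtains m where "m > 0" "\<And>x. m * norm x \<le> N x"
proof -
  have "\<exists>m>0. \<forall>x. m * norm x \<le> N x"
  proof -
    have "compact (sphere (0::'a) 1)" "sphere (0::'a) 1 \<noteq> {}" by auto
    then obtain y where y: "y \<in> sphere 0 1" "\<forall>x\<in>sphere 0 1. N y \<le> N x"
      using continuous_attains_inf[of "sphere 0 1" N] N_cont continuous_on_subset by blast
    have "N y * norm x \<le> N x" for x
    proof (cases "x = 0")
      case False
      then have "N y \<le> N (x /\<^sub>R norm x)" using y by auto
      also have "\<dots> = N x / norm x" using False by (intro N_divide) auto
      finally show ?thesis using False by (simp add: field_simps)
    qed auto
    moreover have "N y > 0" using y by (intro N_pos) auto
    ultimately show ?thesis by auto
  qed
  then show ?thesis using that by auto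
qed

lemma compact_shell: "0 < u \<Longrightarrow> compact {x. u \<le> N x \<and> N x \<le> v}"
proof -
  obtain m where m: "m > 0" "\<And>x. m * norm x \<le> N x" using N_lower by blast
  have "closed {x. u \<le> N x \<and> N x \<le> v}"
    using N_cont by (intro closed_Collect_conj closed_Collect_le continuous_intros) auto
  moreover have "norm x \<le> v / m" if "N x \<le> v" for x
    using m(2)[of x] m(1) that by (simp add: field_simps)
  then have "bounded {x. u \<le> N x \<and> N x \<le> v}" by (auto simp: bounded_iff)
  ultimately show ?thesis by (simp add: compact_eq_bounded_closed)
qed

lemma mu0_scale:
  assumes t: "t > 0" and S: "S \<in> sets borel"
  shows "emeasure \<mu>0 {x. x /\<^sub>R t \<in> S} = ennreal (t powr - \<alpha>) * emeasure \<mu>0 S"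
proof -
  have *: "{x. x /\<^sub>R t \<in> S} \<in> sets borel" using S by measurable
  have "{x. x /\<^sub>R t \<in> S} - {0} = (\<lambda>x. t *\<^sub>R x) ` (S - {0})"
  proof (intro set_eqI iffI)
    fix x assume "x \<in> {x. x /\<^sub>R t \<in> S} - {0}"
    then show "x \<in> (\<lambda>x. t *\<^sub>R x) ` (S - {0})"
      using t by (intro image_eqI[of _ _ "x /\<^sub>R t"]) auto
  qed (use t in auto)
  moreover have "S - {0} \<in> sets \<mu>" unfolding sets_mu using S by (intro sets_puncturedI) auto
  then have "emeasure \<mu> ((\<lambda>x. t *\<^sub>R x) ` (S - {0})) = ennreal (t powr - \<alpha>) * emeasure \<mu> (S - {0})"
    using rv t unfolding regularly_varying_def by blast
  ultimately show ?thesis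
    using S * by (simp add: emeasure_extend0 sets_mu)
qed

lemma mu0_N_greater:
  assumes "s > 0"
  shows "emeasure \<mu>0 {x. N x > s} = ennreal (s powr - \<alpha>) * emeasure \<mu>0 {x. N x > 1}"
  using mu0_scale[of s "{x. N x > 1}"] assms by (simp add: N_divide)

lemma vague_limit_extend0:
  assumes f: "punctured_test_function f" "f 0 = 0" "f \<in> borel_measurable borel"
  shows "((\<lambda>t. ennreal (1 / F t) * (\<integral>\<^sup>+x. ennreal (f (x /\<^sub>R t)) \<partial>D)) \<longlongrightarrow> (\<integral>\<^sup>+x. ennreal (f x) \<partial>\<mu>0)) at_top"
proof -
  have "((\<lambda>t. \<integral>\<^sup>+x. ennreal (f x) \<partial>scaled_law D (\<lambda>x. x) N t) \<longlongrightarrow> (\<integral>\<^sup>+x. ennreal (f x) \<partial>\<mu>)) at_top"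
    using rv f unfolding regularly_varying_def vague_limit_def by auto
  moreover have "(\<lambda>x. x) \<in> borel_measurable D" by measurable
  ultimately show ?thesis
    using f by (simp add: nn_integral_scaled_law nn_integral_extend0 sets_mu F_def)
qed

lemma punctured_test_shell:
  assumes "continuous_on UNIV f" "\<And>x. 0 \<le> f x" "0 < u" "\<And>x. N x < u \<or> v < N x \<Longrightarrow> f x = 0"
  shows "punctured_test_function f"
  unfolding punctured_test_function_def
proof (intro conjI exI ballI)
  show "compact {x. u \<le> N x \<and> N x \<le> v}" using compact_shell assms by auto
  show "continuous_on (- {0}) f" using assms continuous_on_subset by blast
  show "f x = 0" if "x \<in> - {0} - {x. u \<le> N x \<and> N x \<le> v}" for x
    using that assms(4)[of x] by (auto simp: not_le)
qed (use assms in auto)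

lemma F_antimono: "s \<le> t \<Longrightarrow> F t \<le> F s"
  unfolding F_def by (rule finite_measure_mono) auto

lemma F_nonneg [simp]: "0 \<le> F t" by (simp add: F_def)


text \<open>
  By homogeneity, a null set \<open>N > 1\<close> would make every set \<open>N > 1 / n\<close>
  null, hence the whole measure.
\<close>

lemma mu0_pos: "emeasure \<mu>0 {x. N x > 1} \<noteq> 0"
proof
  assume null: "emeasure \<mu>0 {x. N x > 1} = 0"
  have nullU: "(\<Union>n. {x. N x > 1 / Suc n}) \<in> null_sets \<mu>0"
    using mu0_N_greater null by (intro null_sets_UN) (auto simp: null_sets_def)
  have all: "x \<in> (\<Union>n. {x. N x > 1 / Suc n})" if x: "x \<noteq> 0" for x
    using reals_Archimedean[of "N x"] N_pos[OF x] by (auto simp: inverse_eq_divide)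
  have "AE x in \<mu>0. False"
    using AE_extend0_neq_0[OF sets_mu] AE_not_in[OF nullU] by eventually_elim (use all in blast)
  then have "emeasure \<mu>0 (space \<mu>0) = 0" by (simp add: AE_iff_null null_sets_def)
  moreover have "emeasure \<mu>0 UNIV = emeasure \<mu> (- {0})"
    by (subst emeasure_extend0) (auto simp: sets_mu Compl_eq_Diff_UNIV)
  ultimately show False using rv by (auto simp: regularly_varying_def)
qed

lemma integral_D_mono:
  assumes "f \<in> borel_measurable borel" "g \<in> borel_measurable borel"
    "\<And>x. 0 \<le> f x" "\<And>x. f x \<le> g x" "\<And>x. g x \<le> (c::real)"
  shows "(\<integral>x. f x \<partial>D) \<le> (\<integral>x. g x \<partial>D)"
  using assms order_trans[OF assms(3) assms(4)] order_trans[OF assms(4) assms(5)]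
  by (intro integral_mono integrable_const_bound[where B=c]) auto

lemma F_shell: "a \<le> b \<Longrightarrow> measure D {x. a < N x \<and> N x \<le> b} = F a - F b"
proof -
  assume ab: "a \<le> b"
  have "{x. a < N x \<and> N x \<le> b} = {x. N x > a} - {x. N x > b}" by auto
  then show ?thesis
    using ab unfolding F_def by (simp add: finite_measure_Diff subset_eq)
qed

text \<open>
  The indicator of a shell is not continuous. A continuous function between the indicators of
  two nested shells carries the vague convergence over to the tail function \<open>F\<close>:
  the limit \<open>I\<close> of the functionals \<open>\<Phi>\<close> and the functionals
  themselves are both trapped by the two shells.
\<close>

lemma shell_sandwich:
  assumes ord: "0 < a" "a < b" "b \<le> c" "c < d"
  obtains \<Phi> I where "((\<lambda>t. \<Phi> t) \<longlongrightarrow> (I::ennreal)) at_top"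
    "emeasure \<mu>0 {x. b < N x \<and> N x \<le> c} \<le> I" "I \<le> emeasure \<mu>0 {x. a < N x \<and> N x \<le> d}"
    "\<forall>t>0. ennreal ((F (b * t) - F (c * t)) / F t) \<le> \<Phi> t"
    "\<forall>t>0. \<Phi> t \<le> ennreal ((F (a * t) - F (d * t)) / F t)"
proof -
  define f where "f x = ramp a b (N x) * (1 - ramp c d (N x))" for x
  have cont: "continuous_on UNIV f" unfolding f_def using ord N_cont by (intro continuous_intros) auto
  then have meas [measurable]: "f \<in> borel_measurable borel" by (rule borel_measurable_continuous_onI)
  have test: "punctured_test_function f"
  proof (rule punctured_test_shell[of f a d])
    show "f x = 0" if "N x < a \<or> d < N x" for x
      using that ord by (auto simp: f_def ramp_eq_0 ramp_eq_1)
  qed (use ord cont in \<open>auto simp: f_def\<close>)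
  have "f 0 = 0" using ord by (simp add: f_def ramp_eq_0)
  have le: "f x \<le> indicator {x. a < N x \<and> N x \<le> d} x" for x
    using ord mult_mono[of "ramp a b (N x)" 1 "1 - ramp c d (N x)" 1]
    by (auto simp: f_def indicator_def ramp_eq_0 ramp_eq_1)
  have ge: "indicator {x. b < N x \<and> N x \<le> c} x \<le> f x" for x
    using ord by (auto simp: f_def indicator_def ramp_eq_0 ramp_eq_1)
  have shell_D: "(\<integral>\<^sup>+x. ennreal (indicator {x. p < N x \<and> N x \<le> q} (x /\<^sub>R t)) \<partial>D) = ennreal (F (p * t) - F (q * t))"
    if "p \<le> q" "t > 0" for p q t
  proof -
    have "ennreal (indicator {x. p < N x \<and> N x \<le> q} (x /\<^sub>R t)) = indicator {x. p * t < N x \<and> N x \<le> q * t} x" for x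
      unfolding indicator_def mem_Collect_eq N_divide[OF that(2)] using that(2) by (auto simp: field_simps)
    then have "(\<integral>\<^sup>+x. ennreal (indicator {x. p < N x \<and> N x \<le> q} (x /\<^sub>R t)) \<partial>D) =
        emeasure D {x. p * t < N x \<and> N x \<le> q * t}"
      by simp
    then show ?thesis using that by (simp add: emeasure_eq_measure F_shell)
  qed
  show ?thesis
  proof (rule that[OF vague_limit_extend0[OF test \<open>f 0 = 0\<close> meas]])
    have "emeasure \<mu>0 {x. b < N x \<and> N x \<le> c} = (\<integral>\<^sup>+x. ennreal (indicator {x. b < N x \<and> N x \<le> c} x) \<partial>\<mu>0)"
      by (simp add: ennreal_indicator)
    also have "\<dots> \<le> (\<integral>\<^sup>+x. ennreal (f x) \<partial>\<mu>0)" by (intro nn_integral_mono ennreal_leI ge)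
    finally show "emeasure \<mu>0 {x. b < N x \<and> N x \<le> c} \<le> (\<integral>\<^sup>+x. ennreal (f x) \<partial>\<mu>0)" .
    have "(\<integral>\<^sup>+x. ennreal (f x) \<partial>\<mu>0) \<le> (\<integral>\<^sup>+x. ennreal (indicator {x. a < N x \<and> N x \<le> d} x) \<partial>\<mu>0)"
      by (intro nn_integral_mono ennreal_leI le)
    also have "\<dots> = emeasure \<mu>0 {x. a < N x \<and> N x \<le> d}" by (simp add: ennreal_indicator)
    finally show "(\<integral>\<^sup>+x. ennreal (f x) \<partial>\<mu>0) \<le> emeasure \<mu>0 {x. a < N x \<and> N x \<le> d}" .
  next
    show "\<forall>t>0. ennreal ((F (b * t) - F (c * t)) / F t) \<le> ennreal (1 / F t) * (\<integral>\<^sup>+x. ennreal (f (x /\<^sub>R t)) \<partial>D)"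
    proof (intro allI impI)
      fix t :: real assume t: "t > 0"
      have "ennreal ((F (b * t) - F (c * t)) / F t) = ennreal (1 / F t) * ennreal (F (b * t) - F (c * t))"
        by (subst ennreal_mult'[symmetric]) auto
      also have "ennreal (F (b * t) - F (c * t)) \<le> (\<integral>\<^sup>+x. ennreal (f (x /\<^sub>R t)) \<partial>D)"
        unfolding shell_D[OF ord(3) t, symmetric] by (intro nn_integral_mono ennreal_leI ge)
      finally show "ennreal ((F (b * t) - F (c * t)) / F t) \<le> ennreal (1 / F t) * (\<integral>\<^sup>+x. ennreal (f (x /\<^sub>R t)) \<partial>D)"
        by (simp add: mult_left_mono)
    qed
  next
    show "\<forall>t>0. ennreal (1 / F t) * (\<integral>\<^sup>+x. ennreal (f (x /\<^sub>R t)) \<partial>D) \<le> ennreal ((F (a * t) - F (d * t)) / F t)"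
    proof (intro allI impI)
      fix t :: real assume t: "t > 0"
      have "a \<le> d" using ord by auto
      have "(\<integral>\<^sup>+x. ennreal (f (x /\<^sub>R t)) \<partial>D) \<le> ennreal (F (a * t) - F (d * t))"
        unfolding shell_D[OF \<open>a \<le> d\<close> t, symmetric] by (intro nn_integral_mono ennreal_leI le)
      then have "ennreal (1 / F t) * (\<integral>\<^sup>+x. ennreal (f (x /\<^sub>R t)) \<partial>D) \<le> ennreal (1 / F t) * ennreal (F (a * t) - F (d * t))"
        by (simp add: mult_left_mono)
      also have "\<dots> = ennreal ((F (a * t) - F (d * t)) / F t)"
        by (subst ennreal_mult'[symmetric]) auto
      finally show "ennreal (1 / F t) * (\<integral>\<^sup>+x. ennreal (f (x /\<^sub>R t)) \<partial>D) \<le> ennreal ((F (a * t) - F (d * t)) / F t)" .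
    qed
  qed
qed

text \<open>
  If \<open>F\<close> vanished somewhere, the rescaled laws would be zero from then on (the
  reciprocal of zero is zero), whereas their limit gives positive mass to some shell.
\<close>

lemma F_pos: "0 < F t"
proof -
  have "\<exists>n. emeasure \<mu>0 {x. 1 < N x \<and> N x \<le> real n} \<noteq> 0"
  proof (rule ccontr)
    assume "\<not> ?thesis"
    then have null: "(\<Union>n. {x. 1 < N x \<and> N x \<le> real n}) \<in> null_sets \<mu>0"
      by (intro null_sets_UN) (auto simp: null_sets_def)
    have "(\<Union>n. {x. 1 < N x \<and> N x \<le> real n}) = {x. N x > 1}"
    proof (intro set_eqI iffI)
      fix x assume x: "x \<in> {x. N x > 1}"
      obtain n where "N x \<le> real n" using real_arch_simple by blast
      with x show "x \<in> (\<Union>n. {x. 1 < N x \<and> N x \<le> real n})" by blast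
    qed auto
    then show False using null mu0_pos by (auto simp: null_sets_def)
  qed
  then obtain n :: nat where n: "emeasure \<mu>0 {x. 1 < N x \<and> N x \<le> real n} \<noteq> 0" by blast
  have ord: "0 < (1/2::real)" "1/2 < (1::real)" "1 \<le> real n + 1" "real n + 1 < real n + 2" by auto
  obtain \<Phi> I where *: "((\<lambda>t. \<Phi> t) \<longlongrightarrow> (I::ennreal)) at_top"
      "emeasure \<mu>0 {x. 1 < N x \<and> N x \<le> real n + 1} \<le> I" "I \<le> emeasure \<mu>0 {x. 1/2 < N x \<and> N x \<le> real n + 2}"
      "\<forall>t>0. ennreal ((F (1 * t) - F ((real n + 1) * t)) / F t) \<le> \<Phi> t"
      "\<forall>t>0. \<Phi> t \<le> ennreal ((F ((1/2) * t) - F ((real n + 2) * t)) / F t)"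
      by (rule shell_sandwich[OF ord]) blast
  have "emeasure \<mu>0 {x. 1 < N x \<and> N x \<le> real n} \<le> emeasure \<mu>0 {x. 1 < N x \<and> N x \<le> real n + 1}"
    by (intro emeasure_mono) auto
  then have "0 < I" using n *(2) by (auto simp: zero_less_iff_neq_zero)
  from order_tendstoD(1)[OF *(1) this] have "eventually (\<lambda>s. 0 < \<Phi> s \<and> t \<le> s \<and> 0 < s) at_top"
    by (intro eventually_conj eventually_ge_at_top eventually_gt_at_top)
  then obtain s where s: "0 < \<Phi> s" "t \<le> s" "0 < s"
    by (auto simp: eventually_at_top_linorder)
  have "\<Phi> s \<le> ennreal ((F ((1/2) * s) - F ((real n + 2) * s)) / F s)" using *(5) s by blast
  then have "F s \<noteq> 0" using s by auto
  then show ?thesis using F_antimono[OF s(2)] F_nonneg[of s] by linarith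
qed

text \<open>
  Compact sets say nothing about the mass near infinity, but every shell inside \<open>N >
  2\<close> carries at most the limit of \<open>P(N > t) / F t = 1\<close>, and homogeneity
  leads from \<open>N > 2\<close> to \<open>N > 1\<close>.
\<close>

lemma mu0_finite: "emeasure \<mu>0 {x. N x > 1} < \<infinity>"
proof -
  have shell: "emeasure \<mu>0 {x. 2 < N x \<and> N x \<le> c} \<le> 1" if c2: "2 \<le> c" for c
  proof -
    have ord: "0 < (1::real)" "1 < (2::real)" "2 \<le> c" "c < c + 1" using c2 by auto
    obtain \<Phi> I where *: "((\<lambda>t. \<Phi> t) \<longlongrightarrow> (I::ennreal)) at_top"
      "emeasure \<mu>0 {x. 2 < N x \<and> N x \<le> c} \<le> I" "I \<le> emeasure \<mu>0 {x. 1 < N x \<and> N x \<le> c + 1}"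
      "\<forall>t>0. ennreal ((F (2 * t) - F (c * t)) / F t) \<le> \<Phi> t"
      "\<forall>t>0. \<Phi> t \<le> ennreal ((F (1 * t) - F ((c + 1) * t)) / F t)"
      by (rule shell_sandwich[OF ord]) blast
    have "\<Phi> t \<le> 1" if "t > 0" for t
    proof -
      have "\<Phi> t \<le> ennreal ((F (1 * t) - F ((c + 1) * t)) / F t)" using *(5) that by blast
      also have "\<dots> \<le> 1" using F_pos[of t] by (simp add: ennreal_le_1)
      finally show ?thesis .
    qed
    then have "I \<le> 1"
      by (intro tendsto_upperbound[OF *(1)])
         (auto intro: eventually_mono[OF eventually_gt_at_top[of 0]])
    then show ?thesis using *(2) by simp
  qed
  have "emeasure \<mu>0 {x. N x > 2} = (SUP n. emeasure \<mu>0 {x. 2 < N x \<and> N x \<le> real n + 2})"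
  proof (subst SUP_emeasure_incseq)
    have "{x. N x > 2} = (\<Union>n. {x. 2 < N x \<and> N x \<le> real n + 2})"
    proof (intro set_eqI iffI)
      fix x assume "x \<in> {x. N x > 2}"
      moreover obtain n where "N x \<le> real n" using real_arch_simple by blast
      ultimately have "x \<in> {x. 2 < N x \<and> N x \<le> real n + 2}" by auto
      then show "x \<in> (\<Union>n. {x. 2 < N x \<and> N x \<le> real n + 2})" by blast
    qed auto
    then show "emeasure \<mu>0 {x. N x > 2} = emeasure \<mu>0 (\<Union>n. {x. 2 < N x \<and> N x \<le> real n + 2})" by simp
  qed (auto simp: incseq_def)
  also have "\<dots> \<le> 1" by (intro SUP_least shell) auto
  finally have "ennreal (2 powr - \<alpha>) * emeasure \<mu>0 {x. N x > 1} \<le> 1"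
    by (simp add: mu0_N_greater[of 2])
  then have "ennreal (2 powr - \<alpha>) * emeasure \<mu>0 {x. N x > 1} < \<infinity>"
    by (rule le_less_trans) simp
  then show ?thesis by (auto simp: ennreal_mult_less_top)
qed

definition mass where "mass = measure \<mu>0 {x. N x > 1}"

lemma mass_pos: "mass > 0"
  using mu0_pos mu0_finite unfolding mass_def measure_def
  by (simp add: enn2real_positive_iff zero_less_iff_neq_zero)

lemma mu0_greater: "s > 0 \<Longrightarrow> emeasure \<mu>0 {x. N x > s} = ennreal (s powr - \<alpha> * mass)"
  using mu0_N_greater[of s] mu0_finite
  by (simp add: mass_def emeasure_eq_ennreal_measure ennreal_mult')

lemma mu0_shell:
  assumes "0 < a" "a \<le> b"
  shows "emeasure \<mu>0 {x. a < N x \<and> N x \<le> b} = ennreal (mass * (a powr - \<alpha> - b powr - \<alpha>))"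
proof -
  have "{x. a < N x \<and> N x \<le> b} = {x. N x > a} - {x. N x > b}" by auto
  also have "emeasure \<mu>0 \<dots> = emeasure \<mu>0 {x. N x > a} - emeasure \<mu>0 {x. N x > b}"
    using assms mu0_greater[of b] by (intro emeasure_Diff) auto
  also have "\<dots> = ennreal (mass * (a powr - \<alpha> - b powr - \<alpha>))"
    using assms mass_pos by (simp add: mu0_greater ennreal_minus algebra_simps)
  finally show ?thesis .
qed

text \<open>
  Homogeneity makes the \<open>\<mu>\<close>-mass of a shell a continuous function of its radii,
  so the inner and the outer shell of \<open>shell_sandwich\<close> can be squeezed together.
\<close>

lemma F_shell_limit:
  assumes uv: "0 < u" "u < v"
  shows "((\<lambda>t. (F (u * t) - F (v * t)) / F t) \<longlongrightarrow> mass * (u powr - \<alpha> - v powr - \<alpha>)) at_top"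
proof (rule order_tendstoI)
  fix y assume y: "y < mass * (u powr - \<alpha> - v powr - \<alpha>)"
  have nn: "0 \<le> (F (u * t) - F (v * t)) / F t" if "t > 0" for t
    using F_antimono[of "u * t" "v * t"] uv that F_pos[of t] by auto
  show "eventually (\<lambda>t. y < (F (u * t) - F (v * t)) / F t) at_top"
  proof (cases "y < 0")
    case True
    show ?thesis
      using eventually_gt_at_top[of 0] by eventually_elim (use nn True in force)
  next
    case False
    have lim: "((\<lambda>e. mass * ((u * (1 + e)) powr - \<alpha> - (v * (1 - e)) powr - \<alpha>)) \<longlongrightarrow>
       mass * ((u * (1 + 0)) powr - \<alpha> - (v * (1 - 0)) powr - \<alpha>)) (at_right 0)"
      using uv by (intro tendsto_intros) auto
    have lim2: "((\<lambda>e. v * (1 - e) - u * (1 + e)) \<longlongrightarrow> v * (1 - 0) - u * (1 + 0)) (at_right 0)"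
      by (intro tendsto_intros)
    have "eventually (\<lambda>e. y < mass * ((u * (1 + e)) powr - \<alpha> - (v * (1 - e)) powr - \<alpha>) \<and>
        0 < v * (1 - e) - u * (1 + e) \<and> 0 < e) (at_right 0)"
      using order_tendstoD(1)[OF lim, of y] order_tendstoD(1)[OF lim2, of 0] y uv
      by (intro eventually_conj) (auto intro: eventually_at_right_less)
    then obtain e where e: "y < mass * ((u * (1 + e)) powr - \<alpha> - (v * (1 - e)) powr - \<alpha>)"
        "0 < v * (1 - e) - u * (1 + e)" "0 < e"
      using eventually_happens[of _ "at_right (0::real)"] by auto
    have ord: "0 < u" "u < u * (1 + e)" "u * (1 + e) \<le> v * (1 - e)" "v * (1 - e) < v" using uv e by auto
    obtain \<Phi> I where *: "((\<lambda>t. \<Phi> t) \<longlongrightarrow> (I::ennreal)) at_top"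
      "emeasure \<mu>0 {x. u * (1 + e) < N x \<and> N x \<le> v * (1 - e)} \<le> I" "I \<le> emeasure \<mu>0 {x. u < N x \<and> N x \<le> v}"
      "\<forall>t>0. ennreal ((F ((u * (1 + e)) * t) - F ((v * (1 - e)) * t)) / F t) \<le> \<Phi> t"
      "\<forall>t>0. \<Phi> t \<le> ennreal ((F (u * t) - F (v * t)) / F t)"
      by (rule shell_sandwich[OF ord]) blast
    have "ennreal y < I"
    proof (rule less_le_trans[OF _ *(2)])
      show "ennreal y < emeasure \<mu>0 {x. u * (1 + e) < N x \<and> N x \<le> v * (1 - e)}"
        using uv e False by (subst mu0_shell) (auto simp: ennreal_less_iff)
    qed
    from order_tendstoD(1)[OF *(1) this] eventually_gt_at_top[of 0]
    show ?thesis
    proof eventually_elim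
      case (elim t)
      then have "ennreal y < ennreal ((F (u * t) - F (v * t)) / F t)" using *(5) by fastforce
      then show ?case using False by (simp add: ennreal_less_iff)
    qed
  qed
next
  fix y assume y: "mass * (u powr - \<alpha> - v powr - \<alpha>) < y"
  have nn: "0 \<le> (F (u * t) - F (v * t)) / F t" if "t > 0" for t
    using F_antimono[of "u * t" "v * t"] uv that F_pos[of t] by auto
  have lim: "((\<lambda>e. mass * ((u * (1 - e)) powr - \<alpha> - (v * (1 + e)) powr - \<alpha>)) \<longlongrightarrow>
     mass * ((u * (1 - 0)) powr - \<alpha> - (v * (1 + 0)) powr - \<alpha>)) (at_right 0)"
    using uv by (intro tendsto_intros) auto
  have "eventually (\<lambda>e. mass * ((u * (1 - e)) powr - \<alpha> - (v * (1 + e)) powr - \<alpha>) < y \<and>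
      e < 1 \<and> 0 < e) (at_right (0::real))"
    using order_tendstoD(2)[OF lim, of y] y eventually_at_right_less[of "0::real"]
      order_tendstoD(2)[OF tendsto_ident_at[of "0::real" "{0<..}"], of 1]
    by (intro eventually_conj) auto
  then obtain e where e: "mass * ((u * (1 - e)) powr - \<alpha> - (v * (1 + e)) powr - \<alpha>) < y" "e < 1" "0 < e"
    using eventually_happens[of _ "at_right (0::real)"] by auto
  have ord: "0 < u * (1 - e)" "u * (1 - e) < u" "u \<le> v" "v < v * (1 + e)" using uv e by auto
  obtain \<Phi> I where *: "((\<lambda>t. \<Phi> t) \<longlongrightarrow> (I::ennreal)) at_top"
      "emeasure \<mu>0 {x. u < N x \<and> N x \<le> v} \<le> I" "I \<le> emeasure \<mu>0 {x. u * (1 - e) < N x \<and> N x \<le> v * (1 + e)}"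
      "\<forall>t>0. ennreal ((F (u * t) - F (v * t)) / F t) \<le> \<Phi> t"
      "\<forall>t>0. \<Phi> t \<le> ennreal ((F ((u * (1 - e)) * t) - F ((v * (1 + e)) * t)) / F t)"
      by (rule shell_sandwich[OF ord]) blast
  have "u * (1 - e) \<le> v * (1 + e)" using ord uv by linarith
  then have "0 \<le> mass * ((u * (1 - e)) powr - \<alpha> - (v * (1 + e)) powr - \<alpha>)"
    using uv e mass_pos alpha_pos by (auto intro!: mult_nonneg_nonneg powr_mono2')
  then have "I < ennreal y"
    using uv e \<open>u * (1 - e) \<le> v * (1 + e)\<close>
    by (intro le_less_trans[OF *(3)]) (subst mu0_shell, auto simp: ennreal_less_iff)
  from order_tendstoD(2)[OF *(1) this] eventually_gt_at_top[of 0]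
  show "eventually (\<lambda>t. (F (u * t) - F (v * t)) / F t < y) at_top"
  proof eventually_elim
    case (elim t)
    then have "ennreal ((F (u * t) - F (v * t)) / F t) < ennreal y" using *(4) by fastforce
    then show ?case using nn[of t] elim by (simp add: ennreal_less_iff)
  qed
qed

text \<open>
  Vague convergence on the punctured space does not exclude that mass escapes to infinity. If
  \<open>m\<close> is the mass of \<open>N > 1\<close>, shells give \<open>F(s t) / F t
  \<rightarrow> 1 - m (1 - s powr (-\<alpha>))\<close> for \<open>s > 1\<close>. A limit of such
  ratios is multiplicative in \<open>s\<close>; comparing \<open>s = 2\<close> with \<open>s =
  4\<close> leaves only \<open>m = 0\<close> and \<open>m = 1\<close>.
\<close>

lemma mass_eq_1: "mass = 1"
proof -
  have lim: "((\<lambda>t. F (s * t) / F t) \<longlongrightarrow> 1 - mass * (1 - s powr - \<alpha>)) at_top" if "s > 1" for s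
  proof -
    have "((\<lambda>t. 1 - (F (1 * t) - F (s * t)) / F t) \<longlongrightarrow> 1 - mass * (1 powr - \<alpha> - s powr - \<alpha>)) at_top"
      using that by (intro tendsto_intros F_shell_limit) auto
    moreover have "1 - (F (1 * t) - F (s * t)) / F t = F (s * t) / F t" for t
      using F_pos[of t] by (simp add: field_simps)
    ultimately show ?thesis by simp
  qed
  define u where "u = 2 powr - \<alpha>"
  have u: "u < 1" "u > 0" using alpha_pos by (auto simp: u_def powr_less_one)
  have u4: "4 powr - \<alpha> = u * u"
    using powr_mult[of 2 2 "- \<alpha>"] by (simp add: u_def)
  have "filterlim (\<lambda>t::real. 2 * t) at_top at_top"
    by (rule filterlim_tendsto_pos_mult_at_top[OF tendsto_const]) (auto simp: filterlim_ident)
  then have "((\<lambda>t. F (2 * (2 * t)) / F (2 * t)) \<longlongrightarrow> 1 - mass * (1 - u)) at_top"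
    using filterlim_compose[OF lim[of 2], of "\<lambda>t. 2 * t" at_top] by (simp add: u_def)
  then have "((\<lambda>t. F (2 * (2 * t)) / F (2 * t) * (F (2 * t) / F t)) \<longlongrightarrow> (1 - mass * (1 - u)) * (1 - mass * (1 - u))) at_top"
    using lim[of 2] by (intro tendsto_mult) (auto simp: u_def)
  moreover have "F (2 * (2 * t)) / F (2 * t) * (F (2 * t) / F t) = F (4 * t) / F t" for t
    using F_pos[of "2 * t"] by (simp add: field_simps)
  ultimately have "((\<lambda>t. F (4 * t) / F t) \<longlongrightarrow> (1 - mass * (1 - u)) * (1 - mass * (1 - u))) at_top" by (simp only:)
  from tendsto_unique[OF _ this lim[of 4]]
  have "(1 - mass * (1 - u)) * (1 - mass * (1 - u)) = 1 - mass * (1 - u * u)" by (simp add: u4)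
  then have "mass * (1 - u) * (1 - u) * (mass - 1) = 0" by algebra
  then show ?thesis using mass_pos u by simp
qed

lemma mu0_tail: "s > 0 \<Longrightarrow> emeasure \<mu>0 {x. N x > s} = ennreal (s powr - \<alpha>)"
  by (simp add: mu0_greater mass_eq_1)

text \<open>
  For \<open>s < 1\<close> the ratio is the reciprocal of the one for \<open>1 / s\<close>, read
  at \<open>s t\<close>.
\<close>

lemma F_rv:
  assumes s: "s > 0"
  shows "((\<lambda>t. F (s * t) / F t) \<longlongrightarrow> s powr - \<alpha>) at_top"
proof -
  have gt: "((\<lambda>t. F (s * t) / F t) \<longlongrightarrow> s powr - \<alpha>) at_top" if "s > 1" for s
  proof -
    have "((\<lambda>t. 1 - (F (1 * t) - F (s * t)) / F t) \<longlongrightarrow> 1 - mass * (1 powr - \<alpha> - s powr - \<alpha>)) at_top"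
      using that by (intro tendsto_intros F_shell_limit) auto
    moreover have "1 - (F (1 * t) - F (s * t)) / F t = F (s * t) / F t" for t
      using F_pos[of t] by (simp add: field_simps)
    ultimately show ?thesis by (simp add: mass_eq_1)
  qed
  consider "s > 1" | "s = 1" | "s < 1" by linarith
  then show ?thesis
  proof cases
    case 2
    have "F t / F t = 1" for t using F_pos[of t] by simp
    then show ?thesis using 2 by simp
  next
    case 3
    have "filterlim (\<lambda>t. s * t) at_top at_top"
      by (rule filterlim_tendsto_pos_mult_at_top[OF tendsto_const s]) (auto simp: filterlim_ident)
    then have "((\<lambda>t. F (1 / s * (s * t)) / F (s * t)) \<longlongrightarrow> (1 / s) powr - \<alpha>) at_top"
      using s 3 by (intro filterlim_compose[OF gt[of "1/s"]]) auto
    then have "((\<lambda>t. inverse (F (1 / s * (s * t)) / F (s * t))) \<longlongrightarrow> inverse ((1 / s) powr - \<alpha>)) at_top"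
      using s by (intro tendsto_inverse) auto
    moreover have "inverse ((1 / s) powr - \<alpha>) = s powr - \<alpha>"
      using s by (simp add: powr_divide powr_minus)
    ultimately show ?thesis using s by simp
  qed (rule gt)
qed

lemma F_rv_bound:
  assumes "s > 0"
  shows "eventually (\<lambda>t. F (s * t) \<le> (s powr - \<alpha> + 1) * F t) at_top"
proof -
  have "eventually (\<lambda>t. F (s * t) / F t < s powr - \<alpha> + 1) at_top"
    using F_rv[OF assms] by (rule order_tendstoD) auto
  then show ?thesis
    by eventually_elim (use F_pos in \<open>simp add: pos_divide_less_eq less_imp_le\<close>)
qed

lemma F_tendsto_0: "(F \<longlongrightarrow> 0) at_top"
proof (rule tendsto_at_topI_sequentially)
  fix X :: "nat \<Rightarrow> real" assume X: "filterlim X at_top sequentially"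
  show "(\<lambda>n. F (X n)) \<longlonglongrightarrow> 0"
  proof -
    have "(\<lambda>n. measure D {x. N x > real n}) \<longlonglongrightarrow> measure D (\<Inter>n. {x. N x > real n})"
      by (intro finite_Lim_measure_decseq) (auto simp: decseq_def)
    moreover have "(\<Inter>n. {x. N x > real n}) = {}"
    proof (intro equals0I)
      fix x assume "x \<in> (\<Inter>n. {x. N x > real n})"
      moreover obtain n where "N x \<le> real n" using real_arch_simple by blast
      ultimately show False by (auto simp: not_less[symmetric])
    qed
    ultimately have *: "(\<lambda>n. F (real n)) \<longlonglongrightarrow> 0" by (simp add: F_def)
    show ?thesis
    proof (rule order_tendstoI)
      fix e :: real assume "0 < e"
      then obtain n where n: "F (real n) < e"
        using order_tendstoD(2)[OF *] eventually_happens'[OF sequentially_bot] by blast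
      have "eventually (\<lambda>k. X k \<ge> real n) sequentially"
        using X by (auto simp: filterlim_at_top)
      then show "eventually (\<lambda>k. F (X k) < e) sequentially"
        by eventually_elim (use n F_antimono in force)
    next
      fix e :: real assume "e < 0"
      then show "eventually (\<lambda>k. e < F (X k)) sequentially"
        using F_nonneg order_less_le_trans by (intro always_eventually) blast
    qed
  qed
qed

text \<open>
  Compactness of the support is traded for the tail estimate \<open>F_rv\<close>: cutting
  \<open>g\<close> off beyond \<open>N > s\<close> changes both sides by at most a constant
  times \<open>s powr (-\<alpha>)\<close> in the limit.
\<close>

lemma tail_test_limit:
  assumes cont: "continuous_on UNIV g" and g: "\<And>x. 0 \<le> g x" "\<And>x. g x \<le> c"
    and \<kappa>: "\<kappa> > 0" "\<And>x. N x < \<kappa> \<Longrightarrow> g x = 0"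
  shows "integrable \<mu>0 g" "((\<lambda>t. (\<integral>x. g (x /\<^sub>R t) \<partial>D) / F t) \<longlongrightarrow> (\<integral>x. g x \<partial>\<mu>0)) at_top"
proof -
  have [measurable]: "g \<in> borel_measurable borel" using cont by (rule borel_measurable_continuous_onI)
  have c: "0 \<le> c" using g order_trans by blast
  have ind: "integrable \<mu>0 (\<lambda>x. c * indicator {x. N x > s} x)" if "s > 0" for s
    using mu0_tail[OF that] by (intro integrable_mult_right integrable_real_indicator) auto
  have bound: "integrable \<mu>0 h" if [measurable]: "h \<in> borel_measurable borel" and
    h: "\<And>x. 0 \<le> h x" "\<And>x. h x \<le> g x" for h
  proof (rule Bochner_Integration.integrable_bound[OF ind[of "\<kappa>/2"]])
    show "AE x in \<mu>0. norm (h x) \<le> norm (c * indicator {x. \<kappa> / 2 < N x} x)"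
    proof (intro AE_I2)
      fix x
      show "norm (h x) \<le> norm (c * indicator {x. \<kappa> / 2 < N x} x)"
        using h[of x] g[of x] c \<kappa>(2)[of x] \<kappa>(1) by (cases "N x < \<kappa>") (auto simp: indicator_def)
    qed
  qed (use \<kappa> in auto)
  show int: "integrable \<mu>0 g" by (rule bound) (use g in auto)
  have intD: "integrable D (\<lambda>x. h (x /\<^sub>R t))" if [measurable]: "h \<in> borel_measurable borel" and
    h: "\<And>x. 0 \<le> h x" "\<And>x. h x \<le> g x" for h t
    by (rule integrable_const_bound[where B=c])
       (use h(1) order_trans[OF h(2) g(2)] in auto)
  show "((\<lambda>t. (\<integral>x. g (x /\<^sub>R t) \<partial>D) / F t) \<longlongrightarrow> (\<integral>x. g x \<partial>\<mu>0)) at_top"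
  proof (rule tendstoI)
    fix e :: real assume e: "e > 0"
    have "((\<lambda>s. c * s powr - \<alpha>) \<longlongrightarrow> c * 0) at_top"
      using alpha_pos by (intro tendsto_intros tendsto_neg_powr filterlim_ident) auto
    then have "eventually (\<lambda>s. c * s powr - \<alpha> < e / 4 \<and> \<kappa> < s) at_top"
      using e by (intro eventually_conj eventually_gt_at_top order_tendstoD(2)) auto
    then obtain s where s: "c * s powr - \<alpha> < e / 4" "\<kappa> < s"
      by (auto simp: eventually_at_top_linorder)
    have s0: "s > 0" using s \<kappa> by simp
    define h where "h x = g x * (1 - ramp s (2 * s) (N x))" for x
    have hcont: "continuous_on UNIV h"
      unfolding h_def using s0 N_cont cont by (intro continuous_intros) auto
    then have [measurable]: "h \<in> borel_measurable borel" by (rule borel_measurable_continuous_onI)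
    have h: "0 \<le> h x" "h x \<le> g x" for x using g[of x] by (auto simp: h_def mult_left_le)
    have hint: "integrable \<mu>0 h" by (rule bound) (use h in auto)
    have diff: "\<bar>g x - h x\<bar> \<le> c * indicator {x. N x > s} x" for x
    proof (cases "N x > s")
      case True then show ?thesis using h[of x] g[of x] by auto
    next
      case False then show ?thesis using s0 by (simp add: h_def ramp_eq_0)
    qed
    have test: "punctured_test_function h"
      by (rule punctured_test_shell[of h \<kappa> "2 * s"])
         (use hcont h \<kappa> s0 in \<open>auto simp: h_def ramp_eq_1\<close>)
    have "h 0 = 0" using \<kappa> by (auto simp: h_def)
    have "((\<lambda>t. ennreal (1 / F t) * (\<integral>\<^sup>+x. ennreal (h (x /\<^sub>R t)) \<partial>D)) \<longlongrightarrow> (\<integral>\<^sup>+x. ennreal (h x) \<partial>\<mu>0)) at_top"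
      by (rule vague_limit_extend0) (use test \<open>h 0 = 0\<close> in auto)
    also have "(\<lambda>t. ennreal (1 / F t) * (\<integral>\<^sup>+x. ennreal (h (x /\<^sub>R t)) \<partial>D)) =
       (\<lambda>t. ennreal ((\<integral>x. h (x /\<^sub>R t) \<partial>D) / F t))"
    proof
      fix t
      have "(\<integral>\<^sup>+x. ennreal (h (x /\<^sub>R t)) \<partial>D) = ennreal (\<integral>x. h (x /\<^sub>R t) \<partial>D)"
        using h by (intro nn_integral_eq_integral intD) auto
      then show "ennreal (1 / F t) * (\<integral>\<^sup>+x. ennreal (h (x /\<^sub>R t)) \<partial>D) = ennreal ((\<integral>x. h (x /\<^sub>R t) \<partial>D) / F t)"
        by (simp add: ennreal_mult'[symmetric])
    qed
    also have "(\<integral>\<^sup>+x. ennreal (h x) \<partial>\<mu>0) = ennreal (\<integral>x. h x \<partial>\<mu>0)"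
      using h by (intro nn_integral_eq_integral bound) auto
    finally have "((\<lambda>t. (\<integral>x. h (x /\<^sub>R t) \<partial>D) / F t) \<longlongrightarrow> (\<integral>x. h x \<partial>\<mu>0)) at_top"
      using h by (subst (asm) tendsto_ennreal_iff)
        (auto intro!: always_eventually divide_nonneg_nonneg integral_nonneg_AE)
    then have "eventually (\<lambda>t. dist ((\<integral>x. h (x /\<^sub>R t) \<partial>D) / F t) (\<integral>x. h x \<partial>\<mu>0) < e / 4) at_top"
      using e by (intro tendstoD) auto
    moreover have "((\<lambda>t. c * (F (s * t) / F t)) \<longlongrightarrow> c * s powr - \<alpha>) at_top"
      by (intro tendsto_intros F_rv s0)
    then have "eventually (\<lambda>t. c * (F (s * t) / F t) < e / 4) at_top"
      using s(1) by (rule order_tendstoD)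
    ultimately show "eventually (\<lambda>t. dist ((\<integral>x. g (x /\<^sub>R t) \<partial>D) / F t) (\<integral>x. g x \<partial>\<mu>0) < e) at_top"
      using eventually_gt_at_top[of 0]
    proof eventually_elim
      case (elim t)
      have "\<bar>(\<integral>x. g (x /\<^sub>R t) \<partial>D) - (\<integral>x. h (x /\<^sub>R t) \<partial>D)\<bar> = \<bar>\<integral>x. g (x /\<^sub>R t) - h (x /\<^sub>R t) \<partial>D\<bar>"
        by (subst Bochner_Integration.integral_diff) (use h g intD in auto)
      also have "\<dots> \<le> (\<integral>x. \<bar>g (x /\<^sub>R t) - h (x /\<^sub>R t)\<bar> \<partial>D)" by (rule integral_abs_bound)
      also have "\<dots> \<le> (\<integral>x. c * indicator {x. N x > s * t} x \<partial>D)"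
      proof (rule integral_mono)
        show "\<bar>g (x /\<^sub>R t) - h (x /\<^sub>R t)\<bar> \<le> c * indicator {x. N x > s * t} x" for x
        proof -
          have "N (x /\<^sub>R t) > s \<longleftrightarrow> N x > s * t"
            unfolding N_divide[OF elim(3)] using elim(3) by (simp add: field_simps)
          then show ?thesis using diff[of "x /\<^sub>R t"] by (simp add: indicator_def)
        qed
        show "integrable D (\<lambda>x. \<bar>g (x /\<^sub>R t) - h (x /\<^sub>R t)\<bar>)"
          by (intro integrable_abs Bochner_Integration.integrable_diff intD) (use h g in auto)
        show "integrable D (\<lambda>x. c * indicator {x. N x > s * t} x)"
          by (intro integrable_mult_right integrable_real_indicator) (auto simp: emeasure_eq_measure)
      qed
      also have "\<dots> = c * F (s * t)" by (simp add: F_def)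
      finally have "\<bar>(\<integral>x. g (x /\<^sub>R t) \<partial>D) - (\<integral>x. h (x /\<^sub>R t) \<partial>D)\<bar> / F t \<le> c * F (s * t) / F t"
        using F_pos[of t] by (intro divide_right_mono) auto
      then have 1: "\<bar>(\<integral>x. g (x /\<^sub>R t) \<partial>D) / F t - (\<integral>x. h (x /\<^sub>R t) \<partial>D) / F t\<bar> \<le> c * (F (s * t) / F t)"
        using F_pos[of t] by (simp add: diff_divide_distrib[symmetric])
      have "\<bar>(\<integral>x. g x \<partial>\<mu>0) - (\<integral>x. h x \<partial>\<mu>0)\<bar> = \<bar>\<integral>x. g x - h x \<partial>\<mu>0\<bar>"
        by (simp add: Bochner_Integration.integral_diff[OF int hint])
      also have "\<dots> \<le> (\<integral>x. \<bar>g x - h x\<bar> \<partial>\<mu>0)" by (rule integral_abs_bound)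
      also have "\<dots> \<le> (\<integral>x. c * indicator {x. N x > s} x \<partial>\<mu>0)"
        using diff by (intro integral_mono ind s0 integrable_abs Bochner_Integration.integrable_diff int hint) auto
      also have "\<dots> = c * s powr - \<alpha>" using s0 by (simp add: measure_def mu0_tail)
      finally have 2: "\<bar>(\<integral>x. g x \<partial>\<mu>0) - (\<integral>x. h x \<partial>\<mu>0)\<bar> \<le> c * s powr - \<alpha>" .
      show ?case using 1 2 elim s(1) unfolding dist_real_def by linarith
    qed
  qed
qed

end

section \<open>Product laws, the operator norm and matrix operations\<close>

lemma measure_pair_cut:
  assumes "prob_space M1" "prob_space M2" and A: "A \<in> sets (M1 \<Otimes>\<^sub>M M2)"
  shows "measure (M1 \<Otimes>\<^sub>M M2) A = (\<integral>x. measure M2 (Pair x -` A) \<partial>M1)"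
    and "integrable M1 (\<lambda>x. measure M2 (Pair x -` A))"
proof -
  interpret M1: prob_space M1 by fact
  interpret M2: prob_space M2 by fact
  have meas: "(\<lambda>x. measure M2 (Pair x -` A)) \<in> borel_measurable M1"
    unfolding measure_def using M2.finite_measure_cut_measurable[OF A] by measurable
  show int: "integrable M1 (\<lambda>x. measure M2 (Pair x -` A))"
    by (rule M1.integrable_const_bound[where B=1]) (use meas in auto)
  have "emeasure (M1 \<Otimes>\<^sub>M M2) A = (\<integral>\<^sup>+x. ennreal (measure M2 (Pair x -` A)) \<partial>M1)"
    by (simp add: M2.emeasure_pair_measure_alt[OF A] M2.emeasure_eq_measure)
  also have "\<dots> = ennreal (\<integral>x. measure M2 (Pair x -` A) \<partial>M1)"
    by (rule nn_integral_eq_integral[OF int]) auto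
  finally show "measure (M1 \<Otimes>\<^sub>M M2) A = (\<integral>x. measure M2 (Pair x -` A) \<partial>M1)"
    by (simp add: measure_def integral_nonneg_AE)
qed

lemma (in finite_measure) measurable_measure_Collect:
  assumes "Measurable.pred (K \<Otimes>\<^sub>M M) (\<lambda>x. P (fst x) (snd x))"
  shows "(\<lambda>x. measure M {y \<in> space M. P x y}) \<in> borel_measurable K"
proof -
  have "{x \<in> space (K \<Otimes>\<^sub>M M). P (fst x) (snd x)} \<in> sets (K \<Otimes>\<^sub>M M)" using assms by measurable
  from finite_measure_cut_measurable[OF this]
  have "(\<lambda>x. measure M (Pair x -` {x \<in> space (K \<Otimes>\<^sub>M M). P (fst x) (snd x)})) \<in> borel_measurable K"
    unfolding measure_def by measurable
  then show ?thesis
    by (rule measurable_cong[THEN iffD1, rotated])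
       (auto simp: space_pair_measure intro!: arg_cong[where f="measure M"])
qed

lemma op_norm_nonneg [simp]: "0 \<le> op_norm a"
  unfolding op_norm_def by (rule onorm_pos_le) auto

lemma norm_mult_le_op_norm: "norm (a *v x) \<le> op_norm a * norm x"
  unfolding op_norm_def by (rule onorm) auto

lemma op_norm_triangle: "op_norm (a + b) \<le> op_norm a + op_norm b"
proof -
  have "(*v) (a + b) = (\<lambda>x. a *v x + b *v x)" by (auto simp: matrix_vector_mult_add_rdistrib)
  then show ?thesis unfolding op_norm_def using onorm_triangle[of "(*v) a" "(*v) b"] by simp
qed

lemma op_norm_scale: "op_norm (c *\<^sub>R a) = \<bar>c\<bar> * op_norm a"
proof -
  have "(*v) (c *\<^sub>R a) = (\<lambda>x. c *\<^sub>R (a *v x))" by (auto simp: scaleR_matrix_vector_assoc)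
  then show ?thesis unfolding op_norm_def using onorm_scaleR[of "(*v) a" c] by simp
qed

lemma op_norm_0 [simp]: "op_norm 0 = 0"
  using op_norm_scale[of 0 0] by simp

text \<open>
  The Frobenius norm, which defines the topology of the matrix type, dominates the operator norm
  up to a factor. This makes the operator norm Lipschitz, hence continuous.
\<close>

lemma op_norm_le_norm: "op_norm (a :: real^'d^'d) \<le> real CARD('d) * real CARD('d) * norm a"
proof -
  have "\<bar>a $ i $ j\<bar> \<le> norm a" for i j
    using component_le_norm_cart[of "a $ i" j]
      Finite_Cartesian_Product.norm_nth_le[of a i] by linarith
  then show ?thesis unfolding op_norm_def by (rule onorm_le_matrix_component)
qed

lemma op_norm_diff: "\<bar>op_norm a - op_norm b\<bar> \<le> op_norm (a - b)"
proof -
  have "op_norm (b - a) = op_norm (a - b)"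
    using op_norm_scale[of "-1" "a - b"] by simp
  then show ?thesis
    using op_norm_triangle[of "a - b" b] op_norm_triangle[of "b - a" a] by simp
qed

lemma continuous_on_op_norm: "continuous_on S (op_norm :: real^'d^'d \<Rightarrow> real)"
proof -
  let ?K = "real CARD('d) * real CARD('d)"
  have "?K-lipschitz_on S op_norm"
  proof (rule lipschitz_onI)
    show "dist (op_norm x) (op_norm y) \<le> ?K * dist x y" for x y :: "real^'d^'d"
      using op_norm_diff[of x y] op_norm_le_norm[of "x - y"] by (simp add: dist_real_def dist_norm)
  qed auto
  then show ?thesis by (rule lipschitz_on_continuous_on)
qed

lemma op_norm_measurable [measurable]: "op_norm \<in> borel_measurable borel"
  using continuous_on_op_norm by (rule borel_measurable_continuous_onI)

lemma continuous_on_pair_norm: "continuous_on UNIV (pair_norm :: (real^'d^'d) \<times> (real^'d) \<Rightarrow> real)"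
  unfolding pair_norm_def
  by (intro continuous_intros continuous_on_compose2[OF continuous_on_op_norm[of UNIV]]) auto

lemma pair_norm_scale: "pair_norm (c *\<^sub>R p) = \<bar>c\<bar> * pair_norm p"
  by (simp add: pair_norm_def op_norm_scale algebra_simps)

lemma pair_norm_pos:
  assumes "p \<noteq> 0" shows "0 < pair_norm (p :: (real^'d^'d) \<times> (real^'d))"
proof (cases "snd p = 0")
  case True
  then have "fst p \<noteq> 0" using assms by (auto simp: prod_eq_iff)
  then obtain i j where "fst p $ i $ j \<noteq> 0" by (auto simp: vec_eq_iff)
  then have "0 < \<bar>fst p $ i $ j\<bar>" by simp
  also have "\<dots> \<le> op_norm (fst p)" unfolding op_norm_def by (rule matrix_component_le_onorm)
  finally show ?thesis by (simp add: pair_norm_def add_pos_nonneg)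
qed (simp add: pair_norm_def add_nonneg_pos)

lemma continuous_on_mat_vec [continuous_intros]:
  fixes f :: "_ \<Rightarrow> real^'n^'m"
  assumes "continuous_on S f" "continuous_on S g"
  shows "continuous_on S (\<lambda>x. f x *v g x)"
  unfolding matrix_vector_mult_def
  by (intro continuous_on_vec_lambda continuous_intros assms)

lemma continuous_on_mat_mat [continuous_intros]:
  fixes f :: "_ \<Rightarrow> real^'n^'m"
  assumes "continuous_on S f" "continuous_on S g"
  shows "continuous_on S (\<lambda>x. f x ** g x)"
  unfolding matrix_matrix_mult_def
  by (intro continuous_on_vec_lambda continuous_intros assms)

lemma borel_measurable_mat_vec [measurable (raw)]:
  fixes f :: "_ \<Rightarrow> real^'n^'m"
  assumes "f \<in> borel_measurable M" "g \<in> borel_measurable M"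
  shows "(\<lambda>x. f x *v g x) \<in> borel_measurable M"
  by (rule borel_measurable_continuous_Pair[OF assms]) (intro continuous_intros)

lemma borel_measurable_mat_mat [measurable (raw)]:
  fixes f :: "_ \<Rightarrow> real^'n^'m"
  assumes "f \<in> borel_measurable M" "g \<in> borel_measurable M"
  shows "(\<lambda>x. f x ** g x) \<in> borel_measurable M"
  by (rule borel_measurable_continuous_Pair[OF assms]) (intro continuous_intros)

lemma borel_measurable_fst_snd [measurable]:
  "fst \<in> borel_measurable (borel :: ('a::euclidean_space \<times> 'b::euclidean_space) measure)"
  "snd \<in> borel_measurable (borel :: ('a::euclidean_space \<times> 'b::euclidean_space) measure)"
  by (auto intro!: borel_measurable_continuous_onI continuous_intros)

section \<open>The tail bound under one affine step\<close>

text \<open>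
  Breiman's lemma for a bounded independent factor: each ratio tends to \<open>z powr
  \<alpha>\<close> by regular variation, and boundedness of \<open>z\<close> supplies an
  integrable majorant. The factor is kept inside the event so that the value \<open>z =
  0\<close> is handled correctly.
\<close>

lemma (in regvar) F_mixture:
  assumes fin: "finite_measure \<Omega>" and z [measurable]: "z \<in> borel_measurable \<Omega>"
    and bd: "\<And>\<omega>. \<omega> \<in> space \<Omega> \<Longrightarrow> 0 \<le> z \<omega>" "\<And>\<omega>. \<omega> \<in> space \<Omega> \<Longrightarrow> z \<omega> \<le> k"
  shows "((\<lambda>t. (\<integral>\<omega>. measure D {p. z \<omega> * N p > t} \<partial>\<Omega>) / F t) \<longlongrightarrow> (\<integral>\<omega>. z \<omega> powr \<alpha> \<partial>\<Omega>)) at_top"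
proof -
  interpret \<Omega>: finite_measure \<Omega> by fact
  define k' where "k' = max k 1"
  have k': "k' > 0" "\<And>\<omega>. \<omega> \<in> space \<Omega> \<Longrightarrow> z \<omega> \<le> k'" using bd(2) by (fastforce simp: k'_def)+
  have meas [measurable]: "(\<lambda>\<omega>. measure D {p. z \<omega> * N p > t}) \<in> borel_measurable \<Omega>" for t
    using measurable_measure_Collect[where K=\<Omega> and P="\<lambda>\<omega> p. z \<omega> * N p > t"] by simp
  have kpos: "0 < 1 / k'" using k'(1) by simp
  have eq: "z \<omega> > 0 \<Longrightarrow> measure D {p. z \<omega> * N p > t} = F (1 / z \<omega> * t)" for \<omega> t
    unfolding F_def by (intro arg_cong[where f="measure D"]) (auto simp: field_simps)
  have "((\<lambda>t. \<integral>\<omega>. measure D {p. z \<omega> * N p > t} / F t \<partial>\<Omega>) \<longlongrightarrow> (\<integral>\<omega>. z \<omega> powr \<alpha> \<partial>\<Omega>)) at_top"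
  proof (rule integral_dominated_convergence_at_top)
    show "AE \<omega> in \<Omega>. ((\<lambda>t. measure D {p. z \<omega> * N p > t} / F t) \<longlongrightarrow> z \<omega> powr \<alpha>) at_top"
    proof (rule AE_I2)
      fix \<omega> assume \<omega>: "\<omega> \<in> space \<Omega>"
      show "((\<lambda>t. measure D {p. z \<omega> * N p > t} / F t) \<longlongrightarrow> z \<omega> powr \<alpha>) at_top"
      proof (cases "z \<omega> = 0")
        case True
        have "eventually (\<lambda>t. measure D {p. z \<omega> * N p > t} / F t = 0) at_top"
          using eventually_ge_at_top[of 0] by eventually_elim (simp add: True)
        then show ?thesis using True by (simp add: tendsto_eventually)
      next
        case False
        then have "z \<omega> > 0" using bd(1)[OF \<omega>] by simp
        then show ?thesis
          using F_rv[of "1 / z \<omega>"] by (simp add: eq powr_divide powr_minus)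
      qed
    qed
    show "eventually (\<lambda>t. AE \<omega> in \<Omega>. norm (measure D {p. z \<omega> * N p > t} / F t) \<le> (1 / k') powr - \<alpha> + 1) at_top"
      using F_rv_bound[OF kpos] eventually_ge_at_top[of 0]
    proof (eventually_elim, intro AE_I2)
      fix t \<omega> assume t: "F (1 / k' * t) \<le> ((1 / k') powr - \<alpha> + 1) * F t" "0 \<le> t" and \<omega>: "\<omega> \<in> space \<Omega>"
      show "norm (measure D {p. z \<omega> * N p > t} / F t) \<le> (1 / k') powr - \<alpha> + 1"
      proof -
        have "{p. z \<omega> * N p > t} \<subseteq> {p. N p > 1 / k' * t}"
        proof safe
          fix p assume "t < z \<omega> * N p"
          also have "\<dots> \<le> k' * N p" using k'(2)[OF \<omega>] by (intro mult_right_mono) auto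
          finally show "N p > 1 / k' * t" using k'(1) by (simp add: field_simps)
        qed
        then have "measure D {p. z \<omega> * N p > t} \<le> F (1 / k' * t)"
          unfolding F_def by (intro finite_measure_mono) auto
        also have "\<dots> \<le> ((1 / k') powr - \<alpha> + 1) * F t" by (rule t)
        finally show ?thesis using F_pos[of t] by (simp add: pos_divide_le_eq)
      qed
    qed
  qed auto
  then show ?thesis by simp
qed


text \<open>
  Hypothesis \<open>C2\<close> is stated with the second, independent pair integrated out. The
  probability space is that of the law of a single pair; copies are introduced below as
  coordinates of a product.
\<close>

locale affine_recursion = regvar D pair_norm \<alpha> \<mu>
  for D :: "((real^'d^'d) \<times> (real^'d)) measure" and \<alpha> \<mu> +
  assumes C2: "\<And>e. e > 0 \<Longrightarrow> eventually (\<lambda>m. eventually (\<lambda>x.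
      (\<integral>p. indicator {p. m < pair_norm p \<and> pair_norm p \<le> x / m} p *
         measure D {q. pair_norm p * pair_norm q > x} \<partial>D) \<le> e * F x) at_top) at_top"
    and moment: "(\<integral>\<^sup>+p. ennreal (op_norm (fst p) powr \<alpha>) \<partial>D) < 1"
begin

definition \<rho> where "\<rho> = (\<integral>p. op_norm (fst p) powr \<alpha> \<partial>D)"

lemma integrable_moment: "integrable D (\<lambda>p. op_norm (fst p) powr \<alpha>)"
  by (rule integrableI_nonneg) (use moment in \<open>auto intro: less_trans[OF moment]\<close>)

lemma rho: "0 \<le> \<rho>" "\<rho> < 1"
proof -
  show "0 \<le> \<rho>" by (simp add: \<rho>_def)
  have "ennreal \<rho> = (\<integral>\<^sup>+p. ennreal (op_norm (fst p) powr \<alpha>) \<partial>D)"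
    unfolding \<rho>_def by (rule nn_integral_eq_integral[symmetric, OF integrable_moment]) auto
  then show "\<rho> < 1" using moment by (metis ennreal_less_one_iff)
qed

lemma op_le_pair: "op_norm (fst p) \<le> pair_norm p" and norm_le_pair: "norm (snd p) \<le> pair_norm p"
  by (auto simp: pair_norm_def)

lemma cut_measurable:
  "Measurable.pred (K \<Otimes>\<^sub>M D) (\<lambda>x. P (fst x) (snd x)) \<Longrightarrow> (\<lambda>x. measure D {y. P x y}) \<in> borel_measurable K"
  using measurable_measure_Collect[where K=K and P=P] by simp

text \<open>
  The part \<open>N \<le> m\<close> of the product with an independent copy of \<open>N\<close>:
  by Breiman's lemma its tail is governed by a truncated moment, and this is at most
  \<open>\<rho>\<close>.
\<close>

lemma trunc_mixture:
  "eventually (\<lambda>x. (\<integral>p. measure D {q. (op_norm (fst p) * indicator {p. pair_norm p \<le> m} p) * pair_norm q > x} \<partial>D)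
      \<le> (\<rho> + e) * F x) at_top" if "e > 0"
proof -
  define z where "z p = op_norm (fst p) * indicator {p. pair_norm p \<le> m} p" for p :: "(real^'d^'d) \<times> (real^'d)"
  have [measurable]: "z \<in> borel_measurable borel" unfolding z_def by measurable
  have z: "0 \<le> z p" "z p \<le> max m 0" "z p \<le> op_norm (fst p)" for p
    using op_le_pair[of p] by (auto simp: z_def indicator_def)
  have "((\<lambda>t. (\<integral>p. measure D {q. z p * pair_norm q > t} \<partial>D) / F t) \<longlongrightarrow> (\<integral>p. z p powr \<alpha> \<partial>D)) at_top"
    by (rule F_mixture[where k="max m 0"]) (use z finite_measure_axioms in auto)
  moreover have "(\<integral>p. z p powr \<alpha> \<partial>D) \<le> \<rho>"
    unfolding \<rho>_def using z alpha_pos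
    by (intro integral_mono' integrable_moment) (auto intro!: powr_mono2)
  then have "(\<integral>p. z p powr \<alpha> \<partial>D) < \<rho> + e" using that by simp
  ultimately have "eventually (\<lambda>t. (\<integral>p. measure D {q. z p * pair_norm q > t} \<partial>D) / F t < \<rho> + e) at_top"
    by (rule order_tendstoD)
  then show ?thesis
    unfolding z_def by eventually_elim (use F_pos in \<open>simp add: pos_divide_less_eq less_imp_le\<close>)
qed

text \<open>
  The constant \<open>C\<close> reproduces itself under one affine step. Split by
  \<open>N\<close>: the event \<open>N > k t\<close> costs a fixed multiple \<open>c\<close> of
  \<open>F t\<close>. Otherwise \<open>|b| \<le> k t\<close>, so \<open>|a| v\<close> exceeds
  \<open>s t\<close> with \<open>s = 1 - k\<close>, and replacing \<open>v\<close> by an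
  independent copy of \<open>N\<close> costs a factor \<open>C\<close>; what remains is
  \<open>(\<rho> + e) F(s t)\<close> from \<open>N \<le> m\<close> and \<open>e F(s t)\<close>
  from \<open>C2\<close>. With \<open>k\<close> small the total is \<open>(c + \<theta> C) F
  t\<close> with \<open>\<theta> < 1\<close>, and a large enough \<open>C\<close> absorbs
  \<open>c\<close>, as well as the bounded range of \<open>t\<close> in which the asymptotic
  estimates are not yet valid.
\<close>

lemma tail_step:
  "\<exists>C>0. \<forall>V. prob_space V \<and> sets V = sets borel \<and> (\<forall>t\<ge>0. measure V {v. v > t} \<le> C * F t) \<longrightarrow>
    (\<forall>t\<ge>0. (\<integral>p. measure V {v. norm (snd p) + op_norm (fst p) * v > t} \<partial>D) \<le> C * F t)"
proof -
  \<comment> \<open>\<open>e\<close> bounds three errors: that of Breiman's lemma, that of \<open>C2\<close> and that of \<open>F(s t) / F t\<close>.\<close>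
  have "((\<lambda>e. (\<rho> + e + e) * (1 + e + e)) \<longlongrightarrow> (\<rho> + 0 + 0) * (1 + 0 + 0)) (at_right 0)"
    by (intro tendsto_intros)
  then have "eventually (\<lambda>e. (\<rho> + e + e) * (1 + e + e) < 1 \<and> 0 < e) (at_right 0)"
    using rho by (intro eventually_conj order_tendstoD(2)) (auto intro: eventually_at_right_less)
  then obtain e where e: "(\<rho> + e + e) * (1 + e + e) < 1" "0 < e"
    using eventually_happens[of _ "at_right (0::real)"] by auto
  define \<theta> where "\<theta> = (\<rho> + e + e) * (1 + e + e)"
  have \<theta>: "0 \<le> \<theta>" "\<theta> < 1" using e rho by (auto simp: \<theta>_def)
  have "((\<lambda>m::real. (m / (m + 1)) powr - \<alpha>) \<longlongrightarrow> 1 powr - \<alpha>) at_top"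
    by (intro tendsto_powr) (real_asymp | simp)+
  then have "eventually (\<lambda>m::real. (m / (m + 1)) powr - \<alpha> < 1 + e) at_top"
    using e by (intro order_tendstoD(2)) auto
  from eventually_conj[OF eventually_gt_at_top[of 0] eventually_conj[OF this C2[OF e(2)]]]
  obtain m where m: "0 < m" "(m / (m + 1)) powr - \<alpha> < 1 + e"
    and C2m: "eventually (\<lambda>x. (\<integral>p. indicator {p. m < pair_norm p \<and> pair_norm p \<le> x / m} p *
         measure D {q. pair_norm p * pair_norm q > x} \<partial>D) \<le> e * F x) at_top"
    unfolding eventually_at_top_linorder by blast
  define s where "s = m / (m + 1)"
  have s: "s > 0" using m by (simp add: s_def)
  have slim: "filterlim (\<lambda>t. s * t) at_top at_top"
    by (rule filterlim_tendsto_pos_mult_at_top[OF tendsto_const s]) (auto simp: filterlim_ident)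
  define z where "z p = op_norm (fst p) * indicator {p. pair_norm p \<le> m} p" for p :: "(real^'d^'d) \<times> (real^'d)"
  have [measurable]: "z \<in> borel_measurable borel" unfolding z_def by measurable
  let ?Z = "\<lambda>t p. measure D {q. z p * pair_norm q > s * t}"
  let ?J = "\<lambda>t p. indicator {p. m < pair_norm p \<and> pair_norm p \<le> s * t / m} p *
    measure D {q. pair_norm p * pair_norm q > s * t}"
  have ev1: "eventually (\<lambda>t. (\<integral>p. ?Z t p \<partial>D) \<le> (\<rho> + e) * F (s * t)) at_top"
    using trunc_mixture[OF e(2), of m] slim unfolding z_def filterlim_iff by blast
  have ev2: "eventually (\<lambda>t. (\<integral>p. ?J t p \<partial>D) \<le> e * F (s * t)) at_top"
    using C2m slim unfolding filterlim_iff by blast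
  have "eventually (\<lambda>t. F (s * t) / F t < s powr - \<alpha> + e) at_top"
    using F_rv[OF s] e by (intro order_tendstoD(2)) auto
  then have ev3: "eventually (\<lambda>t. F (s * t) \<le> (1 + e + e) * F t) at_top"
  proof eventually_elim
    case (elim t)
    then have "F (s * t) / F t \<le> 1 + e + e" using m(2) by (simp add: s_def)
    then show ?case using F_pos[of t] by (simp add: pos_divide_le_eq)
  qed
  define k where "k = 1 / (m + 1)"
  have k: "k > 0" using m by (simp add: k_def)
  define c where "c = k powr - \<alpha> + 1"
  have ev4: "eventually (\<lambda>t. F (k * t) \<le> c * F t) at_top"
    unfolding c_def by (rule F_rv_bound[OF k])
  from eventually_conj[OF ev1 eventually_conj[OF ev2 eventually_conj[OF ev3 eventually_conj[OF ev4 eventually_gt_at_top[of 0]]]]]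
  obtain t0 where t0:
    "\<And>t. t \<ge> t0 \<Longrightarrow> (\<integral>p. ?Z t p \<partial>D) \<le> (\<rho> + e) * F (s * t)"
    "\<And>t. t \<ge> t0 \<Longrightarrow> (\<integral>p. ?J t p \<partial>D) \<le> e * F (s * t)"
    "\<And>t. t \<ge> t0 \<Longrightarrow> F (s * t) \<le> (1 + e + e) * F t"
    "\<And>t. t \<ge> t0 \<Longrightarrow> F (k * t) \<le> c * F t" "\<And>t. t \<ge> t0 \<Longrightarrow> 0 < t"
    unfolding eventually_at_top_linorder by blast
  have c: "0 < c" by (simp add: c_def add_nonneg_pos)
  \<comment> \<open>The first term solves \<open>c + \<theta> C \<le> C\<close>; the second makes the bound trivial for \<open>t < t0\<close>.\<close>
  define C where "C = max (c / (1 - \<theta>)) (1 / F t0)"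
  have C: "0 < C" "c + C * \<theta> \<le> C" "1 \<le> C * F t0"
  proof -
    show C0: "0 < C" using F_pos[of t0] by (auto simp: C_def less_max_iff_disj)
    have "c / (1 - \<theta>) \<le> C" by (simp add: C_def)
    then show "c + C * \<theta> \<le> C" using \<theta> by (simp add: field_simps)
    have "1 / F t0 \<le> C" by (simp add: C_def)
    then show "1 \<le> C * F t0" using F_pos[of t0] by (simp add: pos_divide_le_eq)
  qed
  show ?thesis
  proof (intro exI[of _ C] conjI C(1) allI impI; elim conjE)
    fix V :: "real measure" and t :: real
    assume V: "prob_space V" "sets V = sets borel" and tail: "\<forall>t\<ge>0. measure V {v. v > t} \<le> C * F t" and t: "0 \<le> t"
    interpret V: prob_space V by fact
    note [measurable_cong] = V(2)
    have spV: "space V = UNIV" using sets_eq_imp_space_eq[OF V(2)] by simp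
    let ?V = "\<lambda>p. measure V {v. norm (snd p) + op_norm (fst p) * v > t}"
    have measV [measurable]: "(\<lambda>p. ?V p) \<in> borel_measurable D"
      using V.measurable_measure_Collect[where K=D and P="\<lambda>p v. norm (snd p) + op_norm (fst p) * v > t"] by (simp add: spV)
    have intV: "integrable D (\<lambda>p. ?V p)"
      by (rule integrable_const_bound[where B=1]) auto
    show "(\<integral>p. ?V p \<partial>D) \<le> C * F t"
    proof (cases "t < t0")
      case True
      have "(\<integral>p. ?V p \<partial>D) \<le> (\<integral>p. 1 \<partial>D)"
        by (intro integral_mono intV) auto
      also have "\<dots> = 1" using prob_space by simp
      also have "\<dots> \<le> C * F t0" by (rule C)
      also have "\<dots> \<le> C * F t" using F_antimono[of t t0] True C by (intro mult_left_mono) auto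
      finally show ?thesis .
    next
      case False
      then have tt: "t \<ge> t0" by simp
      then have tpos: "t > 0" using t0(5) by blast
      have scaled: "measure V {v. a * v > u} \<le> C * measure D {q. a * pair_norm q > u}" if "0 \<le> a" "0 \<le> u" for a u
      proof (cases "a = 0")
        case False
        then have eq: "{v. a * v > u} = {v. v > u / a}" "{q. a * pair_norm q > u} = {q. pair_norm q > u / a}"
          using that by (auto simp: field_simps)
        have "0 \<le> u / a" using that by simp
        then show ?thesis using tail unfolding eq F_def by blast
      qed (use that in simp)
      have [measurable]: "(\<lambda>p. ?Z t p) \<in> borel_measurable D"
        "(\<lambda>p. measure D {q. pair_norm p * pair_norm q > s * t}) \<in> borel_measurable D"
        by (rule cut_measurable; measurable)+
      have i1: "integrable D (indicator {p. pair_norm p > k * t} :: _ \<Rightarrow> real)"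
        by (intro integrable_real_indicator) (auto simp: emeasure_eq_measure)
      have i2: "integrable D (\<lambda>p. C * ?Z t p)"
        by (intro integrable_mult_right integrable_const_bound[where B=1]) auto
      have i3: "integrable D (\<lambda>p. C * (?J t p))"
        by (intro integrable_mult_right integrable_const_bound[where B=1]) (auto simp: indicator_def)
      have sk1: "s = 1 - k" and sk2: "s = k * m" using m by (auto simp: s_def k_def diff_divide_eq_iff)
      have sk: "s * t / m = k * t" "s * t = t - k * t"
        using m by (simp add: sk2) (simp add: sk1 left_diff_distrib)
      have pt: "?V p \<le>
        indicator {p. pair_norm p > k * t} p + C * ?Z t p +
        C * (?J t p)" for p
      proof (cases "pair_norm p > k * t")
        case True
        have "0 \<le> C * ?Z t p +
          C * (?J t p)" using C by (auto simp: indicator_def)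
        moreover have "indicator {p. pair_norm p > k * t} p = (1::real)" using True by simp
        ultimately show ?thesis using V.prob_le_1[of "{v. norm (snd p) + op_norm (fst p) * v > t}"] by linarith
      next
        case False
        have "{v. norm (snd p) + op_norm (fst p) * v > t} \<subseteq> {v. op_norm (fst p) * v > s * t}"
          using norm_le_pair[of p] False sk by auto
        then have "?V p \<le> measure V {v. op_norm (fst p) * v > s * t}"
          by (intro V.finite_measure_mono) auto
        also have "\<dots> \<le> C * measure D {q. op_norm (fst p) * pair_norm q > s * t}"
          using s tpos by (intro scaled) auto
        also have "\<dots> \<le> C * ?Z t p +
          C * (?J t p)"
        proof (cases "pair_norm p \<le> m")
          case True then show ?thesis by (simp add: z_def)
        next
          case gt: False
          have "measure D {q. op_norm (fst p) * pair_norm q > s * t} \<le> measure D {q. pair_norm p * pair_norm q > s * t}"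
          proof (rule finite_measure_mono)
            show "{q :: (real^'d^'d) \<times> (real^'d). op_norm (fst p) * pair_norm q > s * t} \<subseteq> {q. pair_norm p * pair_norm q > s * t}"
            proof (intro Collect_mono impI)
              fix q :: "(real^'d^'d) \<times> (real^'d)" assume "s * t < op_norm (fst p) * pair_norm q"
              also have "\<dots> \<le> pair_norm p * pair_norm q"
                using op_le_pair[of p] N_nonneg[of q] by (intro mult_right_mono)
              finally show "s * t < pair_norm p * pair_norm q" .
            qed
          qed measurable
          then show ?thesis using gt False sk C(1) by (simp add: add_nonneg_pos mult_left_mono add_increasing)
        qed
        finally show ?thesis using False by simp
      qed
      have "(\<integral>p. ?V p \<partial>D) \<le>
        (\<integral>p. indicator {p. pair_norm p > k * t} p + C * ?Z t p +
        C * (?J t p) \<partial>D)"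
        by (intro integral_mono intV pt Bochner_Integration.integrable_add i1 i2 i3)
      also have "\<dots> = F (k * t) + C * (\<integral>p. ?Z t p \<partial>D) +
        C * (\<integral>p. ?J t p \<partial>D)"
        using i1 i2 i3 by (simp add: F_def)
      also have "\<dots> \<le> c * F t + C * ((\<rho> + e) * F (s * t)) + C * (e * F (s * t))"
        using t0(1,2,4)[OF tt] C(1) by (intro add_mono mult_left_mono) auto
      also have "\<dots> = c * F t + C * (\<rho> + e + e) * F (s * t)" by (simp add: algebra_simps)
      also have "\<dots> \<le> c * F t + C * (\<rho> + e + e) * ((1 + e + e) * F t)"
        using t0(3)[OF tt] C(1) rho e by (intro add_mono[OF order_refl] mult_left_mono) auto
      also have "\<dots> = (c + C * \<theta>) * F t" by (simp add: \<theta>_def algebra_simps)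
      also have "\<dots> \<le> C * F t" by (intro mult_right_mono C) auto
      finally show ?thesis .
    qed
  qed
qed

end

section \<open>The random series and its fixed point equation\<close>

text \<open>
  The products grow at the right end, but the fixed point equation needs the first factor split
  off.
\<close>

lemma matrix_prod_Suc_shift:
  "matrix_prod a (Suc k) = a 1 ** matrix_prod (\<lambda>i. a (Suc i)) k"
  by (induction k) (simp_all add: matrix_mul_assoc)

lemma matrix_prod_cong:
  "(\<And>i. i \<ge> 1 \<Longrightarrow> a i = b i) \<Longrightarrow> matrix_prod a k = matrix_prod b k"
  by (induction k) auto

text \<open>
  Sequences of pairs start at index 0, whereas \<open>matrix_prod\<close> uses the factors with
  indices \<open>1, ..., k\<close>. Hence the shift.
\<close>

definition prefix_prod :: "(nat \<Rightarrow> (real^'d^'d) \<times> (real^'d)) \<Rightarrow> nat \<Rightarrow> real^'d^'d" where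
  "prefix_prod \<omega> k = matrix_prod (\<lambda>i. fst (\<omega> (i - 1))) k"

lemma prefix_prod_0 [simp]: "prefix_prod \<omega> 0 = mat 1"
  by (simp add: prefix_prod_def)

lemma prefix_prod_Suc:
  "prefix_prod \<omega> (Suc k) = fst (\<omega> 0) ** prefix_prod (\<lambda>i. \<omega> (Suc i)) k"
proof -
  have "matrix_prod (\<lambda>i. fst (\<omega> i)) k = matrix_prod (\<lambda>i. fst (\<omega> (Suc (i - 1)))) k"
    by (rule matrix_prod_cong) auto
  then show ?thesis unfolding prefix_prod_def matrix_prod_Suc_shift by simp
qed

definition perpetuity :: "(nat \<Rightarrow> (real^'d^'d) \<times> (real^'d)) \<Rightarrow> real^'d" where
  "perpetuity \<omega> = (\<Sum>k. prefix_prod \<omega> k *v snd (\<omega> k))"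

text \<open>
  This recursion bounds the partial sums of norms of the series. It peels off the first pair, so
  that it has in law the form of one affine step applied to an independent copy of the previous
  stage.
\<close>

primrec majorant :: "nat \<Rightarrow> (nat \<Rightarrow> (real^'d^'d) \<times> (real^'d)) \<Rightarrow> real" where
  "majorant 0 \<omega> = 0"
| "majorant (Suc n) \<omega> = norm (snd (\<omega> 0)) + op_norm (fst (\<omega> 0)) * majorant n (\<lambda>i. \<omega> (Suc i))"

lemma majorant_mono: "majorant n \<omega> \<le> majorant (Suc n) \<omega>"
proof (induction n arbitrary: \<omega>)
  case (Suc n)
  have "op_norm (fst (\<omega> 0)) * majorant n (\<lambda>i. \<omega> (Suc i)) \<le> op_norm (fst (\<omega> 0)) * majorant (Suc n) (\<lambda>i. \<omega> (Suc i))"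
    by (intro mult_left_mono Suc) auto
  then show ?case by simp
qed auto

lemma sum_le_majorant: "(\<Sum>k<n. norm (prefix_prod \<omega> k *v snd (\<omega> k))) \<le> majorant n \<omega>"
proof (induction n arbitrary: \<omega>)
  case (Suc n)
  have "(\<Sum>k<n. norm (prefix_prod \<omega> (Suc k) *v snd (\<omega> (Suc k)))) \<le>
    (\<Sum>k<n. op_norm (fst (\<omega> 0)) * norm (prefix_prod (\<lambda>i. \<omega> (Suc i)) k *v snd (\<omega> (Suc k))))"
    unfolding prefix_prod_Suc matrix_vector_mul_assoc[symmetric]
    by (intro sum_mono norm_mult_le_op_norm)
  also have "\<dots> \<le> op_norm (fst (\<omega> 0)) * majorant n (\<lambda>i. \<omega> (Suc i))"
    unfolding sum_distrib_left[symmetric] by (intro mult_left_mono Suc) auto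
  finally show ?case by (simp add: sum.lessThan_Suc_shift del: sum.lessThan_Suc)
qed auto

text \<open>
  Boundedness of the majorant gives absolute convergence and the bound for the sum at once;
  hence \<open>|R| > t\<close> forces some stage of the majorant above \<open>t\<close>, even
  where the series diverges.
\<close>

lemma bounded_majorant:
  assumes "\<And>n. majorant n \<omega> \<le> t"
  shows "summable (\<lambda>k. prefix_prod \<omega> k *v snd (\<omega> k))" "norm (perpetuity \<omega>) \<le> t"
proof -
  have bd: "(\<Sum>k<n. norm (prefix_prod \<omega> k *v snd (\<omega> k))) \<le> t" for n
    using sum_le_majorant[where n=n and \<omega>=\<omega>] assms order_trans by blast
  have s: "summable (\<lambda>k. norm (prefix_prod \<omega> k *v snd (\<omega> k)))"
    by (rule summableI_nonneg_bounded[OF _ bd]) auto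
  then show "summable (\<lambda>k. prefix_prod \<omega> k *v snd (\<omega> k))" by (rule summable_norm_cancel)
  have "norm (perpetuity \<omega>) \<le> (\<Sum>k. norm (prefix_prod \<omega> k *v snd (\<omega> k)))"
    unfolding perpetuity_def by (rule summable_norm[OF s])
  also have "\<dots> \<le> t" by (rule suminf_le_const[OF s bd])
  finally show "norm (perpetuity \<omega>) \<le> t" .
qed

lemma perpetuity_Suc:
  assumes "summable (\<lambda>k. prefix_prod \<omega> k *v snd (\<omega> k))"
  shows "perpetuity (case_nat p \<omega>) = fst p *v perpetuity \<omega> + snd p"
proof -
  let ?f = "\<lambda>k. prefix_prod (case_nat p \<omega>) k *v snd (case_nat p \<omega> k)"
  have shift: "?f (Suc k) = fst p *v (prefix_prod \<omega> k *v snd (\<omega> k))" for k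
    by (simp add: prefix_prod_Suc matrix_vector_mul_assoc)
  have lin: "bounded_linear ((*v) (fst p))" by auto
  have "summable (\<lambda>k. ?f (Suc k))"
    unfolding shift by (rule bounded_linear.summable[OF lin assms])
  then have "summable ?f" by (rule summable_Suc_iff[THEN iffD1])
  from suminf_split_head[OF this] have "perpetuity (case_nat p \<omega>) = (\<Sum>k. ?f (Suc k)) + ?f 0"
    unfolding perpetuity_def by simp
  also have "(\<Sum>k. ?f (Suc k)) = fst p *v perpetuity \<omega>"
    unfolding shift perpetuity_def by (rule bounded_linear.suminf[OF lin assms, symmetric])
  finally show ?thesis by simp
qed

context affine_recursion
begin

definition \<S> where "\<S> = PiM (UNIV :: nat set) (\<lambda>_. D)"

definition L where "L = distr \<S> borel perpetuity"

definition prod_law where "prod_law n = distr \<S> borel (\<lambda>\<omega>. prefix_prod \<omega> n)"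

lemma space_S [simp]: "space \<S> = UNIV"
  by (simp add: \<S>_def space_PiM)

lemma prob_space_S: "prob_space \<S>"
  unfolding \<S>_def by (intro prob_space_PiM prob_space_axioms)

lemma proj_measurable: "(\<lambda>\<omega>. \<omega> i) \<in> measurable \<S> borel"
proof -
  have "(\<lambda>\<omega>. \<omega> i) \<in> measurable \<S> D"
    unfolding \<S>_def by (rule measurable_component_singleton) auto
  then show ?thesis by (simp cong: measurable_cong_sets)
qed

lemma shift_measurable [measurable]: "(\<lambda>\<omega> i. \<omega> (Suc i)) \<in> measurable \<S> \<S>"
  unfolding \<S>_def by (rule measurable_PiM_single') (auto simp: space_PiM)

lemma prefix_prod_measurable [measurable]: "(\<lambda>\<omega>. prefix_prod \<omega> n) \<in> borel_measurable \<S>"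
proof -
  note [measurable] = proj_measurable
  have "(\<lambda>\<omega>. matrix_prod (\<lambda>i. fst (\<omega> (i - 1))) n) \<in> borel_measurable \<S>"
    by (induction n) simp_all
  then show ?thesis by (simp add: prefix_prod_def)
qed

lemma perpetuity_measurable [measurable]: "perpetuity \<in> borel_measurable \<S>"
  unfolding perpetuity_def using proj_measurable by measurable

lemma majorant_measurable [measurable]: "majorant n \<in> borel_measurable \<S>"
proof (induction n)
  case 0
  have "majorant 0 = (\<lambda>_. 0)" by auto
  then show ?case by simp
next
  case (Suc n)
  note [measurable] = Suc proj_measurable
  have "majorant (Suc n) = (\<lambda>\<omega>. norm (snd (\<omega> 0)) + op_norm (fst (\<omega> 0)) * majorant n (\<lambda>i. \<omega> (Suc i)))"
    by auto
  then show ?case by simp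
qed

lemma S_iter: "distr (D \<Otimes>\<^sub>M \<S>) \<S> (\<lambda>(p, \<omega>). case_nat p \<omega>) = \<S>"
  and iter_measurable [measurable]: "(\<lambda>(p, \<omega>). case_nat p \<omega>) \<in> measurable (D \<Otimes>\<^sub>M \<S>) \<S>"
proof -
  interpret sequence_space D by unfold_locales
  show "distr (D \<Otimes>\<^sub>M \<S>) \<S> (\<lambda>(p, \<omega>). case_nat p \<omega>) = \<S>"
    unfolding \<S>_def by (rule PiM_iter)
  show "(\<lambda>(p, \<omega>). case_nat p \<omega>) \<in> measurable (D \<Otimes>\<^sub>M \<S>) \<S>"
    unfolding \<S>_def by measurable
qed

text \<open>
  Induction over the stages; \<open>tail_step\<close> returns the same constant at each of them,
  which makes the bound uniform.
\<close>

lemma majorant_tail: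
  obtains C where "C > 0" "\<And>n t. t \<ge> 0 \<Longrightarrow> measure \<S> {\<omega>. majorant n \<omega> > t} \<le> C * F t"
proof -
  interpret S: prob_space \<S> by (rule prob_space_S)
  from tail_step obtain C where C: "C > 0" and
    "\<forall>V. prob_space V \<and> sets V = sets borel \<and> (\<forall>t\<ge>0. measure V {v. v > t} \<le> C * F t) \<longrightarrow>
      (\<forall>t\<ge>0. (\<integral>p. measure V {v. norm (snd p) + op_norm (fst p) * v > t} \<partial>D) \<le> C * F t)"
    by (elim exE conjE)
  note step = this(2)[rule_format, OF conjI[OF _ conjI]]
  have "measure \<S> {\<omega>. majorant n \<omega> > t} \<le> C * F t" if "t \<ge> 0" for n t
    using that
  proof (induction n arbitrary: t)
    case 0
    then show ?case using C by simp
  next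
    case (Suc n)
    define V where "V = distr \<S> borel (majorant n)"
    have V: "prob_space V" "sets V = sets borel"
      unfolding V_def by (auto intro!: S.prob_space_distr)
    have mV: "measure V {v. P v} = measure \<S> {\<omega>. P (majorant n \<omega>)}" if "Measurable.pred borel P" for P
      using that unfolding V_def by (subst measure_distr) (auto intro: arg_cong[where f="measure \<S>"])
    have A: "{x. t < majorant (Suc n) (case_nat (fst x) (snd x))} \<in> sets (D \<Otimes>\<^sub>M \<S>)"
      (is "?A \<in> _")
    proof -
      have "{x \<in> space (D \<Otimes>\<^sub>M \<S>). t < norm (snd (fst x)) + op_norm (fst (fst x)) * majorant n (snd x)} \<in> sets (D \<Otimes>\<^sub>M \<S>)"
        by measurable
      then show ?thesis by (simp add: space_pair_measure)
    qed
    have "measure \<S> {\<omega>. majorant (Suc n) \<omega> > t} = measure (distr (D \<Otimes>\<^sub>M \<S>) \<S> (\<lambda>(p, \<omega>). case_nat p \<omega>)) {\<omega>. majorant (Suc n) \<omega> > t}"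
      unfolding S_iter ..
    also have "\<dots> = measure (D \<Otimes>\<^sub>M \<S>) ?A"
    proof (subst measure_distr)
      have "{\<omega> \<in> space \<S>. majorant (Suc n) \<omega> > t} \<in> sets \<S>" by measurable
      then show "{\<omega>. majorant (Suc n) \<omega> > t} \<in> sets \<S>" by simp
    qed (auto simp: space_pair_measure intro!: arg_cong[where f="measure _"] iter_measurable)
    also have "\<dots> = (\<integral>p. measure \<S> (Pair p -` ?A) \<partial>D)"
      by (rule measure_pair_cut(1)[OF prob_space_axioms prob_space_S A])
    also have "\<dots> = (\<integral>p. measure V {v. norm (snd p) + op_norm (fst p) * v > t} \<partial>D)"
      by (intro Bochner_Integration.integral_cong refl) (simp add: mV)
    also have "\<dots> \<le> C * F t"
      using Suc by (intro step V allI impI) (simp_all add: mV)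
    finally show ?case .
  qed
  then show ?thesis using that C by blast
qed

lemma majorant_sup_tail:
  obtains C where "C > 0" "\<And>t. t \<ge> 0 \<Longrightarrow> measure \<S> (\<Union>n. {\<omega>. majorant n \<omega> > t}) \<le> C * F t"
proof -
  interpret S: prob_space \<S> by (rule prob_space_S)
  obtain C where C: "C > 0" "\<And>n t. t \<ge> 0 \<Longrightarrow> measure \<S> {\<omega>. majorant n \<omega> > t} \<le> C * F t"
    using majorant_tail by blast
  have m: "{\<omega>. majorant n \<omega> > t} \<in> sets \<S>" for n t
  proof -
    have "{\<omega> \<in> space \<S>. majorant n \<omega> > t} \<in> sets \<S>" by measurable
    then show ?thesis by simp
  qed
  have "measure \<S> (\<Union>n. {\<omega>. majorant n \<omega> > t}) \<le> C * F t" if "t \<ge> 0" for t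
  proof (rule LIMSEQ_le_const2)
    show "(\<lambda>n. measure \<S> {\<omega>. majorant n \<omega> > t}) \<longlonglongrightarrow> measure \<S> (\<Union>n. {\<omega>. majorant n \<omega> > t})"
      using m by (intro S.finite_Lim_measure_incseq incseq_SucI)
        (auto simp del: majorant.simps intro: less_le_trans[OF _ majorant_mono])
  qed (use C(2)[OF that] in auto)
  then show ?thesis using that C(1) by blast
qed

lemma prob_space_L: "prob_space L"
  unfolding L_def by (intro prob_space.prob_space_distr prob_space_S) auto

lemma sets_L [simp, measurable_cong]: "sets L = sets borel"
  by (simp add: L_def)

lemma space_L [simp]: "space L = UNIV"
  by (simp add: L_def)

lemma L_tail:
  obtains C where "C > 0" "\<And>t. t \<ge> 0 \<Longrightarrow> measure L {r. norm r > t} \<le> C * F t"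
proof -
  interpret S: prob_space \<S> by (rule prob_space_S)
  obtain C where C: "C > 0" "\<And>t. t \<ge> 0 \<Longrightarrow> measure \<S> (\<Union>n. {\<omega>. majorant n \<omega> > t}) \<le> C * F t"
    using majorant_sup_tail by blast
  have "measure L {r. norm r > t} \<le> C * F t" if "t \<ge> 0" for t
  proof -
    have "measure L {r. norm r > t} = measure \<S> {\<omega>. norm (perpetuity \<omega>) > t}"
      unfolding L_def by (subst measure_distr) (auto intro: arg_cong[where f="measure \<S>"])
    also have "\<dots> \<le> measure \<S> (\<Union>n. {\<omega>. majorant n \<omega> > t})"
    proof (rule S.finite_measure_mono)
      show "{\<omega>. norm (perpetuity \<omega>) > t} \<subseteq> (\<Union>n. {\<omega>. majorant n \<omega> > t})"
        using bounded_majorant(2) by (force simp: not_less[symmetric])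
      have "(\<Union>n. {\<omega> \<in> space \<S>. majorant n \<omega> > t}) \<in> sets \<S>" by measurable
      then show "(\<Union>n. {\<omega>. majorant n \<omega> > t}) \<in> sets \<S>" by simp
    qed
    also have "\<dots> \<le> C * F t" by (rule C(2)[OF that])
    finally show ?thesis .
  qed
  then show ?thesis using that C(1) by blast
qed

text \<open>
  Divergence forces the majorant above every level, an event of probability at most \<open>C F
  j\<close> for all \<open>j\<close>.
\<close>

lemma null_divergence:
  obtains Z where "Z \<in> null_sets \<S>" "\<And>\<omega>. \<omega> \<notin> Z \<Longrightarrow> summable (\<lambda>k. prefix_prod \<omega> k *v snd (\<omega> k))"
proof -
  interpret S: prob_space \<S> by (rule prob_space_S)
  obtain C where C: "C > 0" "\<And>t. t \<ge> 0 \<Longrightarrow> measure \<S> (\<Union>n. {\<omega>. majorant n \<omega> > t}) \<le> C * F t"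
    using majorant_sup_tail by blast
  define Z :: "(nat \<Rightarrow> (real^'d^'d) \<times> (real^'d)) set" where "Z = (\<Inter>j::nat. \<Union>n. {\<omega>. majorant n \<omega> > real j})"
  have U: "(\<Union>n. {\<omega>. majorant n \<omega> > t}) \<in> sets \<S>" for t
  proof -
    have "(\<Union>n. {\<omega> \<in> space \<S>. majorant n \<omega> > t}) \<in> sets \<S>" by measurable
    then show ?thesis by simp
  qed
  have Zm: "Z \<in> sets \<S>" unfolding Z_def using U by (intro sets.countable_INT) auto
  have "measure \<S> Z \<le> C * F (real j)" for j
  proof -
    have "measure \<S> Z \<le> measure \<S> (\<Union>n. {\<omega>. majorant n \<omega> > real j})"
      by (intro S.finite_measure_mono U) (auto simp: Z_def)
    then show ?thesis using C(2)[of "real j"] by simp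
  qed
  moreover have "(\<lambda>j. C * F (real j)) \<longlonglongrightarrow> C * 0"
    by (intro tendsto_intros filterlim_compose[OF F_tendsto_0] filterlim_real_sequentially)
  ultimately have "measure \<S> Z \<le> C * 0"
    by (intro LIMSEQ_le_const) auto
  then have "Z \<in> null_sets \<S>" using Zm measure_nonneg[of \<S> Z] by (simp add: null_sets_def S.emeasure_eq_measure)
  moreover have "summable (\<lambda>k. prefix_prod \<omega> k *v snd (\<omega> k))" if "\<omega> \<notin> Z" for \<omega>
  proof -
    obtain j :: nat where "\<And>n. majorant n \<omega> \<le> real j" using \<open>\<omega> \<notin> Z\<close> by (auto simp: Z_def not_less)
    then show ?thesis by (rule bounded_majorant(1))
  qed
  ultimately show ?thesis using that by blast
qed

text \<open>
  Prepending an independent pair to the sequence does not change its law and, where the series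
  converges, turns its sum \<open>r\<close> into \<open>a r + b\<close>.
\<close>

lemma L_fixed_point: "distr (D \<Otimes>\<^sub>M L) borel (\<lambda>(p, r). fst p *v r + snd p) = L"
proof -
  interpret S: prob_space \<S> by (rule prob_space_S)
  interpret L: prob_space L by (rule prob_space_L)
  obtain Z where Z: "Z \<in> null_sets \<S>" "\<And>\<omega>. \<omega> \<notin> Z \<Longrightarrow> summable (\<lambda>k. prefix_prod \<omega> k *v snd (\<omega> k))"
    using null_divergence by blast
  \<comment> \<open>The null set is enlarged to a measurable product set to avoid a measurability
    proof for the domain of convergence.\<close>
  have Z': "UNIV \<times> Z \<in> null_sets (D \<Otimes>\<^sub>M \<S>)"
    using Z(1) S.emeasure_pair_measure_Times[of UNIV D Z] by (auto simp: null_sets_def)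
  have "L = distr (distr (D \<Otimes>\<^sub>M \<S>) \<S> (\<lambda>(p, \<omega>). case_nat p \<omega>)) borel perpetuity"
    unfolding S_iter L_def ..
  also have "\<dots> = distr (D \<Otimes>\<^sub>M \<S>) borel (\<lambda>x. perpetuity (case_nat (fst x) (snd x)))"
    by (subst distr_distr) (auto simp: comp_def case_prod_beta)
  also have "\<dots> = distr (D \<Otimes>\<^sub>M \<S>) borel (\<lambda>x. fst (fst x) *v perpetuity (snd x) + snd (fst x))"
  proof (rule distr_cong_AE)
    show "AE x in D \<Otimes>\<^sub>M \<S>. perpetuity (case_nat (fst x) (snd x)) = fst (fst x) *v perpetuity (snd x) + snd (fst x)"
      using AE_not_in[OF Z'] by eventually_elim (auto intro!: perpetuity_Suc Z(2))
    show "(\<lambda>x. perpetuity (case_nat (fst x) (snd x))) \<in> borel_measurable (D \<Otimes>\<^sub>M \<S>)"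
      using measurable_comp[OF iter_measurable perpetuity_measurable] by (simp add: comp_def case_prod_beta)
  qed auto
  also have "\<dots> = distr (distr (D \<Otimes>\<^sub>M \<S>) (D \<Otimes>\<^sub>M borel) (\<lambda>(p, \<omega>). (p, perpetuity \<omega>))) borel (\<lambda>(p, r). fst p *v r + snd p)"
    by (subst distr_distr) (auto simp: comp_def case_prod_beta)
  also have "distr (D \<Otimes>\<^sub>M \<S>) (D \<Otimes>\<^sub>M borel) (\<lambda>(p, \<omega>). (p, perpetuity \<omega>)) = distr D D (\<lambda>x. x) \<Otimes>\<^sub>M L"
    unfolding L_def
    by (rule pair_measure_distr[symmetric])
       (use L.sigma_finite_measure_axioms in \<open>auto simp: L_def[symmetric]\<close>)
  also have "distr D D (\<lambda>x. x) = D" by (rule distr_id2) simp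
  finally show ?thesis by simp
qed

lemma prob_space_prod_law: "prob_space (prod_law n)"
  unfolding prod_law_def by (intro prob_space.prob_space_distr prob_space_S) auto

lemma sets_prod_law [simp, measurable_cong]: "sets (prod_law n) = sets borel"
  by (simp add: prod_law_def)

lemma space_prod_law [simp]: "space (prod_law n) = UNIV"
  by (simp add: prod_law_def)

lemma nn_integral_prod_law_0:
  assumes "h \<in> borel_measurable borel"
  shows "(\<integral>\<^sup>+P. h P \<partial>prod_law 0) = h (mat 1)"
proof -
  interpret S: prob_space \<S> by (rule prob_space_S)
  show ?thesis
    unfolding prod_law_def using assms S.emeasure_space_1
    by (subst nn_integral_distr) auto
qed

lemma nn_integral_prod_law_Suc:
  assumes [measurable]: "h \<in> borel_measurable borel"
  shows "(\<integral>\<^sup>+P. h P \<partial>prod_law (Suc n)) = (\<integral>\<^sup>+p. \<integral>\<^sup>+P. h (fst p ** P) \<partial>prod_law n \<partial>D)"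
proof -
  interpret S: prob_space \<S> by (rule prob_space_S)
  have "(\<integral>\<^sup>+P. h P \<partial>prod_law (Suc n)) = (\<integral>\<^sup>+\<omega>. h (prefix_prod \<omega> (Suc n)) \<partial>\<S>)"
    unfolding prod_law_def by (rule nn_integral_distr) auto
  also have "\<dots> = (\<integral>\<^sup>+\<omega>. h (prefix_prod \<omega> (Suc n)) \<partial>distr (D \<Otimes>\<^sub>M \<S>) \<S> (\<lambda>(p, \<omega>). case_nat p \<omega>))"
    unfolding S_iter ..
  also have "\<dots> = (\<integral>\<^sup>+x. h (prefix_prod ((\<lambda>(p, \<omega>). case_nat p \<omega>) x) (Suc n)) \<partial>(D \<Otimes>\<^sub>M \<S>))"
    by (rule nn_integral_distr) auto
  also have "\<dots> = (\<integral>\<^sup>+x. h (fst (fst x) ** prefix_prod (snd x) n) \<partial>(D \<Otimes>\<^sub>M \<S>))"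
    by (intro nn_integral_cong) (auto simp: prefix_prod_Suc)
  also have "\<dots> = (\<integral>\<^sup>+p. \<integral>\<^sup>+\<omega>. h (fst p ** prefix_prod \<omega> n) \<partial>\<S> \<partial>D)"
    by (subst S.nn_integral_fst[symmetric]) auto
  also have "\<dots> = (\<integral>\<^sup>+p. \<integral>\<^sup>+P. h (fst p ** P) \<partial>prod_law n \<partial>D)"
    unfolding prod_law_def by (intro nn_integral_cong nn_integral_distr[symmetric]) auto
  finally show ?thesis .
qed

end

section \<open>One step: bounded, intermediate and large shocks\<close>

lemma tail_testD:
  assumes "tail_test f"
  obtains c \<delta> where "0 < c" "\<And>x. f x \<le> c" "0 < \<delta>" "\<And>x. norm x < \<delta> \<Longrightarrow> f x = 0"
proof -
  obtain c \<delta> where *: "\<forall>x. f x \<le> c" "0 < \<delta>" "\<forall>x. norm x < \<delta> \<longrightarrow> f x = 0"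
    using assms unfolding tail_test_def by blast
  have "f x \<le> max c 1" for x using *(1) by (simp add: le_max_iff_disj)
  then show ?thesis using that[of "max c 1" \<delta>] * by auto
qed

lemma tail_test_bound:
  assumes "tail_test f"
  obtains c where "0 < c" "\<And>x. f x \<le> c"
  by (rule tail_testD[OF assms]) (erule that)

lemma tail_test_nonneg: "tail_test f \<Longrightarrow> 0 \<le> f x"
  by (auto simp: tail_test_def)

lemma tail_test_continuous: "tail_test f \<Longrightarrow> continuous_on UNIV f"
  by (auto simp: tail_test_def uniformly_continuous_imp_continuous)

lemma tail_test_measurable: "tail_test f \<Longrightarrow> f \<in> borel_measurable borel"
  by (rule borel_measurable_continuous_onI[OF tail_test_continuous])

lemma tail_test_uniform:
  assumes "tail_test f" "e > 0"
  obtains d where "d > 0" "\<And>x y. norm (x - y) < d \<Longrightarrow> \<bar>f x - f y\<bar> < e"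
proof -
  have "uniformly_continuous_on UNIV f" using assms by (simp add: tail_test_def)
  then obtain d where "d > 0" "\<And>x y. dist y x < d \<Longrightarrow> dist (f y) (f x) < e"
    using assms(2) unfolding uniformly_continuous_on_def by (metis UNIV_I)
  then show ?thesis using that by (simp add: dist_norm)
qed

lemma (in finite_measure) integrable_indicator_bound:
  fixes h :: "'a \<Rightarrow> real"
  assumes "0 \<le> c" "\<And>x. 0 \<le> h x" "\<And>x. h x \<le> c"
    and [measurable]: "h \<in> borel_measurable M" "Measurable.pred M (\<lambda>x. g x \<in> A)"
  shows "integrable M (\<lambda>x. h x * indicator A (g x))"
proof (rule integrable_const_bound[where B=c])
  show "AE x in M. norm (h x * indicator A (g x)) \<le> c"
    using assms(1-3) by (auto simp: indicator_def)
  have "(\<lambda>x. h x * (if g x \<in> A then 1 else 0)) \<in> borel_measurable M" by measurable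
  then show "(\<lambda>x. h x * indicator A (g x)) \<in> borel_measurable M"
    by (simp add: indicator_def of_bool_def)
qed

lemma measure_cut_swap:
  assumes M1: "prob_space M1" and M2: "prob_space M2"
    and P: "Measurable.pred (M1 \<Otimes>\<^sub>M M2) (\<lambda>x. P (fst x) (snd x))"
  shows "(\<integral>x. measure M2 {y \<in> space M2. P x y} \<partial>M1) = (\<integral>y. measure M1 {x \<in> space M1. P x y} \<partial>M2)"
proof -
  interpret M1: prob_space M1 by fact
  interpret M2: prob_space M2 by fact
  interpret pair_prob_space M1 M2 ..
  define A where "A = {x \<in> space (M1 \<Otimes>\<^sub>M M2). P (fst x) (snd x)}"
  have A: "A \<in> sets (M1 \<Otimes>\<^sub>M M2)" unfolding A_def using P by measurable
  have i: "integrable (M1 \<Otimes>\<^sub>M M2) (\<lambda>(x, y). indicator A (x, y) :: real)"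
    using A by (auto intro!: integrable_real_indicator simp: emeasure_eq_measure)
  have "(\<integral>x. measure M2 {y \<in> space M2. P x y} \<partial>M1) = (\<integral>x. (\<integral>y. indicat_real A (x, y) \<partial>M2) \<partial>M1)"
  proof (intro Bochner_Integration.integral_cong refl)
    fix x assume x: "x \<in> space M1"
    have "(\<integral>y. indicat_real A (x, y) \<partial>M2) = (\<integral>y. indicat_real {y \<in> space M2. P x y} y \<partial>M2)"
      using x by (intro Bochner_Integration.integral_cong refl) (auto simp: A_def indicator_def space_pair_measure)
    also have "\<dots> = measure M2 ({y \<in> space M2. P x y} \<inter> space M2)" by simp
    also have "{y \<in> space M2. P x y} \<inter> space M2 = {y \<in> space M2. P x y}" by auto
    finally show "measure M2 {y \<in> space M2. P x y} = (\<integral>y. indicat_real A (x, y) \<partial>M2)" ..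
  qed
  also have "\<dots> = (\<integral>y. (\<integral>x. indicat_real A (x, y) \<partial>M1) \<partial>M2)"
    by (rule Fubini_integral[symmetric, OF i])
  also have "\<dots> = (\<integral>y. measure M1 {x \<in> space M1. P x y} \<partial>M2)"
  proof (intro Bochner_Integration.integral_cong refl)
    fix y assume y: "y \<in> space M2"
    have "(\<integral>x. indicat_real A (x, y) \<partial>M1) = (\<integral>x. indicat_real {x \<in> space M1. P x y} x \<partial>M1)"
      using y by (intro Bochner_Integration.integral_cong refl) (auto simp: A_def indicator_def space_pair_measure)
    also have "\<dots> = measure M1 ({x \<in> space M1. P x y} \<inter> space M1)" by simp
    also have "{x \<in> space M1. P x y} \<inter> space M1 = {x \<in> space M1. P x y}" by auto
    finally show "(\<integral>x. indicat_real A (x, y) \<partial>M1) = measure M1 {x \<in> space M1. P x y}" .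
  qed
  finally show ?thesis .
qed

lemma (in regvar) sigma_finite_mu0: "sigma_finite_measure \<mu>0"
proof
  show "\<exists>A. countable A \<and> A \<subseteq> sets \<mu>0 \<and> \<Union> A = space \<mu>0 \<and> (\<forall>a\<in>A. emeasure \<mu>0 a \<noteq> \<infinity>)"
  proof (intro exI[of _ "insert {0} (range (\<lambda>n::nat. {x. N x > 1 / Suc n}))"] conjI ballI)
    show "\<Union> (insert {0} (range (\<lambda>n::nat. {x. N x > 1 / Suc n}))) = space \<mu>0"
    proof (intro set_eqI iffI)
      fix x :: 'a
      show "x \<in> \<Union> (insert {0} (range (\<lambda>n::nat. {x. N x > 1 / Suc n})))"
      proof (cases "x = 0")
        case False
        then obtain n where "inverse (real (Suc n)) < N x" using reals_Archimedean[OF N_pos] by blast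
        then show ?thesis by (auto simp: inverse_eq_divide)
      qed auto
    qed simp
    fix a assume "a \<in> insert {0} (range (\<lambda>n::nat. {x. N x > 1 / Suc n}))"
    then consider "a = {0}" | n :: nat where "a = {x. N x > 1 / Suc n}" by blast
    then show "emeasure \<mu>0 a \<noteq> \<infinity>"
    proof cases
      case 1
      then show ?thesis by (simp add: emeasure_extend0 sets_mu)
    next
      case 2
      then show ?thesis by (simp add: mu0_tail)
    qed
  qed auto
qed

context affine_recursion
begin

abbreviation DL where "DL \<equiv> D \<Otimes>\<^sub>M L"

abbreviation LM where "LM \<equiv> L \<Otimes>\<^sub>M \<mu>0"

abbreviation affine where "affine x \<equiv> fst (fst x) *v snd x + snd (fst x)"

definition tail_mean :: "real \<Rightarrow> (real^'d \<Rightarrow> real) \<Rightarrow> real" where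
  "tail_mean t f = (\<integral>r. f (r /\<^sub>R t) \<partial>L) / F t"

text \<open>
  The truncation to bounded shocks keeps functions that vanish near the origin in that class;
  without it the averaged function is only small there.
\<close>

definition trunc_op :: "real \<Rightarrow> (real^'d \<Rightarrow> real) \<Rightarrow> real^'d \<Rightarrow> real" where
  "trunc_op K f r = (\<integral>p. f (fst p *v r) * indicator {p. pair_norm p \<le> K} p \<partial>D)"

text \<open>
  On \<open>N \<le> K\<close> the map \<open>r \<mapsto> a r\<close> is
  \<open>K\<close>-Lipschitz, so the modulus of continuity and the radius of the zero ball
  change by the factor \<open>K\<close> only.
\<close>

lemma trunc_op_tail_test:
  assumes f: "tail_test f" and K: "K > 0"
  shows "tail_test (trunc_op K f)"
proof -
  obtain c \<delta> where c: "0 < c" "\<And>x. f x \<le> c" "0 < \<delta>" "\<And>x. norm x < \<delta> \<Longrightarrow> f x = 0"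
    using tail_testD[OF f] by blast
  note [measurable] = tail_test_measurable[OF f]
  note nn = tail_test_nonneg[OF f]
  have int: "integrable D (\<lambda>p. f (fst p *v r) * indicator {p. pair_norm p \<le> K} p)" for r
  proof (rule integrable_indicator_bound[where c=c])
    show "(\<lambda>p. f (fst p *v r)) \<in> borel_measurable D" by measurable
    show "Measurable.pred D (\<lambda>p. p \<in> {p. pair_norm p \<le> K})" by measurable
    show "0 \<le> c" using c(1) by simp
  qed (rule nn c(2))+
  have opK: "norm (fst p *v r) \<le> K * norm r" if "pair_norm p \<le> K" for p and r :: "real^'d"
  proof -
    have "norm (fst p *v r) \<le> op_norm (fst p) * norm r" by (rule norm_mult_le_op_norm)
    also have "\<dots> \<le> K * norm r" using op_le_pair[of p] that by (intro mult_right_mono) auto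
    finally show ?thesis .
  qed
  have "0 \<le> trunc_op K f r" for r unfolding trunc_op_def using nn by (intro integral_nonneg_AE) auto
  moreover have "trunc_op K f r \<le> c" for r
  proof -
    have "trunc_op K f r \<le> (\<integral>p. c \<partial>D)"
      unfolding trunc_op_def using c nn by (intro integral_mono int) (auto simp: indicator_def)
    then show ?thesis using prob_space by simp
  qed
  moreover have "uniformly_continuous_on UNIV (trunc_op K f)"
    unfolding uniformly_continuous_on_def
  proof (intro allI impI)
    fix e :: real assume e: "e > 0"
    then have "e / 2 > 0" by simp
    then obtain d where d: "d > 0" "\<And>x y. norm (x - y) < d \<Longrightarrow> \<bar>f x - f y\<bar> < e / 2"
      using tail_test_uniform[OF f] by blast
    have "dist (trunc_op K f x') (trunc_op K f x) < e" if "dist x' x < d / K" for x x'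
    proof -
      have "\<bar>trunc_op K f x' - trunc_op K f x\<bar> = \<bar>\<integral>p. f (fst p *v x') * indicator {p. pair_norm p \<le> K} p -
          f (fst p *v x) * indicator {p. pair_norm p \<le> K} p \<partial>D\<bar>"
        unfolding trunc_op_def by (simp add: Bochner_Integration.integral_diff[OF int int])
      also have "\<dots> \<le> (\<integral>p. \<bar>f (fst p *v x') * indicator {p. pair_norm p \<le> K} p -
          f (fst p *v x) * indicator {p. pair_norm p \<le> K} p\<bar> \<partial>D)" by (rule integral_abs_bound)
      also have "\<dots> \<le> (\<integral>p. e / 2 \<partial>D)"
      proof (intro integral_mono integrable_abs Bochner_Integration.integrable_diff int)
        fix p
        show "\<bar>f (fst p *v x') * indicator {p. pair_norm p \<le> K} p -
          f (fst p *v x) * indicator {p. pair_norm p \<le> K} p\<bar> \<le> e / 2"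
        proof (cases "pair_norm p \<le> K")
          case True
          have "norm (fst p *v x' - fst p *v x) \<le> K * norm (x' - x)"
            using opK[OF True, of "x' - x"] by (simp add: matrix_vector_mult_diff_distrib)
          also have "\<dots> < d" using that K by (simp add: dist_norm field_simps)
          finally show ?thesis using d(2) True by (fastforce intro: less_imp_le)
        qed (use e in auto)
      qed auto
      also have "\<dots> = e / 2" using prob_space by simp
      finally show ?thesis using e by (simp add: dist_real_def)
    qed
    then show "\<exists>d>0. \<forall>x\<in>UNIV. \<forall>x'\<in>UNIV. dist x' x < d \<longrightarrow> dist (trunc_op K f x') (trunc_op K f x) < e"
      using d(1) K by (intro exI[of _ "d / K"]) auto
  qed
  moreover have "trunc_op K f r = 0" if "norm r < \<delta> / K" for r
  proof -
    have "f (fst p *v r) * indicator {p. pair_norm p \<le> K} p = 0" for p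
    proof (cases "pair_norm p \<le> K")
      case True
      have "norm (fst p *v r) \<le> K * norm r" by (rule opK[OF True])
      also have "\<dots> < \<delta>" using that K by (simp add: field_simps)
      finally show ?thesis using c(4) by simp
    qed auto
    note zero = this
    show ?thesis unfolding trunc_op_def zero by simp
  qed
  ultimately show ?thesis
    unfolding tail_test_def using c(3) K by (intro conjI allI exI[of _ c] exI[of _ "\<delta> / K"]) auto
qed

lemma tail_mean_fixed_point:
  assumes f: "tail_test f"
  shows "tail_mean t f = (\<integral>x. f (affine x /\<^sub>R t) \<partial>DL) / F t"
proof -
  note [measurable] = tail_test_measurable[OF f]
  have "(\<integral>r. f (r /\<^sub>R t) \<partial>L) = (\<integral>r. f (r /\<^sub>R t) \<partial>distr DL borel (\<lambda>(p, r). fst p *v r + snd p))"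
    unfolding L_fixed_point ..
  also have "\<dots> = (\<integral>x. f (affine x /\<^sub>R t) \<partial>DL)"
    by (subst integral_distr) (auto simp: case_prod_beta)
  finally show ?thesis by (simp add: tail_mean_def)
qed

lemma tail_mean_trunc_op:
  assumes f: "tail_test f"
  shows "tail_mean t (trunc_op K f) =
    (\<integral>x. f ((fst (fst x) *v snd x) /\<^sub>R t) * indicator {p. pair_norm p \<le> K} (fst x) \<partial>DL) / F t"
proof -
  interpret L: prob_space L by (rule prob_space_L)
  interpret DL: pair_prob_space D L ..
  obtain c where c: "0 < c" "\<And>x. f x \<le> c" using tail_test_bound[OF f] by blast
  note [measurable] = tail_test_measurable[OF f]
  have int: "integrable DL (\<lambda>(p, r). f (fst p *v (r /\<^sub>R t)) * indicator {p. pair_norm p \<le> K} p)"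
    unfolding case_prod_beta
    by (rule DL.integrable_indicator_bound[where c=c]) (use c(1,2) tail_test_nonneg[OF f] in auto)
  have "(\<integral>r. trunc_op K f (r /\<^sub>R t) \<partial>L) =
     (\<integral>r. \<integral>p. f (fst p *v (r /\<^sub>R t)) * indicator {p. pair_norm p \<le> K} p \<partial>D \<partial>L)"
    unfolding trunc_op_def ..
  also have "\<dots> = (\<integral>x. f (fst (fst x) *v (snd x /\<^sub>R t)) * indicator {p. pair_norm p \<le> K} (fst x) \<partial>DL)"
    using DL.integral_snd[OF int] unfolding case_prod_beta' by simp
  also have "\<dots> = (\<integral>x. f ((fst (fst x) *v snd x) /\<^sub>R t) * indicator {p. pair_norm p \<le> K} (fst x) \<partial>DL)"
    by (simp add: matrix_vector_mult_scaleR)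
  finally show ?thesis by (simp add: tail_mean_def)
qed

text \<open>
  For \<open>N \<le> K\<close> the summand \<open>b\<close> moves the argument of
  \<open>f\<close> by at most \<open>K / t\<close>, which uniform continuity makes harmless. The
  change can only occur if \<open>|r|\<close> exceeds a multiple of \<open>t\<close>, and this
  event has probability of order \<open>F t\<close>; so the error is small even after division
  by \<open>F t\<close>.
\<close>

lemma bounded_shock_limit:
  assumes f: "tail_test f" and K: "K > 0"
  shows "((\<lambda>t. (\<integral>x. f (affine x /\<^sub>R t) * indicator {p. pair_norm p \<le> K} (fst x) \<partial>DL) / F t
     - tail_mean t (trunc_op K f)) \<longlongrightarrow> 0) at_top"
proof (rule tendstoI)
  fix e :: real assume e: "e > 0"
  interpret L: prob_space L by (rule prob_space_L)
  interpret DL: pair_prob_space D L ..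
  obtain c \<delta> where c: "0 < c" "\<And>x. f x \<le> c" "0 < \<delta>" "\<And>x. norm x < \<delta> \<Longrightarrow> f x = 0"
    using tail_testD[OF f] by blast
  let ?v = "\<lambda>t x. f (affine x /\<^sub>R t)"
  let ?u = "\<lambda>t x. f ((fst (fst x) *v snd x) /\<^sub>R t)"
  obtain C where C: "C > 0" "\<And>t. t \<ge> 0 \<Longrightarrow> measure L {r. norm r > t} \<le> C * F t" using L_tail by blast
  note [measurable] = tail_test_measurable[OF f]
  note nn = tail_test_nonneg[OF f]
  define s where "s = \<delta> / (4 * K)"
  have s: "s > 0" using c K by (simp add: s_def)
  define b where "b = C * (s powr - \<alpha> + 1)"
  have b: "b > 0" using C by (simp add: b_def add_nonneg_pos)
  define e' where "e' = e / (2 * b)"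
  have e': "e' > 0" using e b by (simp add: e'_def)
  obtain d where d: "d > 0" "\<And>x y. norm (x - y) < d \<Longrightarrow> \<bar>f x - f y\<bar> < e'"
    using tail_test_uniform[OF f e'] by blast
  let ?I = "\<lambda>x. indicator {p. pair_norm p \<le> K} (fst x) :: real"
  show "eventually (\<lambda>t. dist ((\<integral>x. ?v t x * ?I x \<partial>DL) / F t
     - tail_mean t (trunc_op K f)) 0 < e) at_top"
    using F_rv_bound[OF s] eventually_gt_at_top[of "K / d"] eventually_gt_at_top[of "2 * K / \<delta>"] eventually_gt_at_top[of 0]
  proof eventually_elim
    case (elim t)
    have Kd: "K / t < d" and K\<delta>: "2 * K < \<delta> * t" using elim d(1) c(3) by (simp_all add: field_simps)
    have small: "norm (v /\<^sub>R t) < \<delta>" if "norm v < \<delta> * t" for v :: "real^'d"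
    proof -
      have "norm (v /\<^sub>R t) = norm v / t" using elim(4) by (simp add: divide_inverse mult.commute)
      also have "\<dots> < \<delta>" using that elim(4) by (simp add: pos_divide_less_eq)
      finally show ?thesis .
    qed
    have i1: "integrable DL (\<lambda>x. ?v t x * ?I x)"
      by (rule DL.integrable_indicator_bound[where c=c]) (use c(1,2) nn in auto)
    have i2: "integrable DL (\<lambda>x. ?u t x * ?I x)"
      by (rule DL.integrable_indicator_bound[where c=c]) (use c(1,2) nn in auto)
    have i3: "integrable DL (\<lambda>x. e' * indicator (UNIV \<times> {r. norm r > s * t}) x)"
      by (intro integrable_mult_right integrable_real_indicator) (auto simp: DL.emeasure_eq_measure)
    have pt: "\<bar>f ((a *v r + b) /\<^sub>R t) * indicator {p. pair_norm p \<le> K} (a, b) - f ((a *v r) /\<^sub>R t) * indicator {p. pair_norm p \<le> K} (a, b)\<bar>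
        \<le> e' * indicator {r. norm r > s * t} r" for a :: "real^'d^'d" and b r
    proof (cases "pair_norm (a, b) \<le> K")
      case True
      have bK: "norm b \<le> K" "op_norm a \<le> K" using True norm_le_pair[of "(a, b)"] op_le_pair[of "(a, b)"] by auto
      have arK: "norm (a *v r) \<le> K * norm r"
        using norm_mult_le_op_norm[of a r] bK(2) by (meson mult_right_mono norm_ge_zero order_trans)
      show ?thesis
      proof (cases "norm r > s * t")
        case True
        have "norm ((a *v r + b) /\<^sub>R t - (a *v r) /\<^sub>R t) = norm b / t"
          using elim(4) by (simp add: scaleR_add_right divide_inverse mult.commute)
        also have "\<dots> \<le> K / t" using bK elim(4) by (simp add: divide_right_mono)
        also note Kd
        finally have "\<bar>f ((a *v r + b) /\<^sub>R t) - f ((a *v r) /\<^sub>R t)\<bar> < e'" by (rule d(2))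
        then show ?thesis using True \<open>pair_norm (a, b) \<le> K\<close> by simp
      next
        case False
        have "norm (a *v r) \<le> K * (s * t)" using arK False K mult_left_mono[of "norm r" "s * t" K] by linarith
        also have "K * (s * t) = \<delta> * t / 4" using K by (simp add: s_def)
        finally have 1: "norm (a *v r) \<le> \<delta> * t / 4" .
        have "norm (a *v r + b) \<le> norm (a *v r) + norm b" by (rule norm_triangle_ineq)
        then have 2: "norm (a *v r + b) < \<delta> * t" using 1 bK(1) K\<delta> K by linarith
        have "0 < \<delta> * t" using c(3) elim(4) by simp
        then have 3: "norm (a *v r) < \<delta> * t" using 1 by linarith
        have "norm ((a *v r + b) /\<^sub>R t) < \<delta>" "norm ((a *v r) /\<^sub>R t) < \<delta>"
          using small[OF 2] small[OF 3] by auto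
        then have "f ((a *v r + b) /\<^sub>R t) = 0" "f ((a *v r) /\<^sub>R t) = 0" by (auto intro: c(4))
        then show ?thesis using e' by simp
      qed
    qed (use e' in simp)
    have "\<bar>(\<integral>x. ?v t x * ?I x \<partial>DL) - (\<integral>x. ?u t x * ?I x \<partial>DL)\<bar>
      = \<bar>\<integral>x. ?v t x * ?I x - ?u t x * ?I x \<partial>DL\<bar>"
      by (simp add: Bochner_Integration.integral_diff[OF i1 i2])
    also have "\<dots> \<le> (\<integral>x. \<bar>?v t x * ?I x - ?u t x * ?I x\<bar> \<partial>DL)"
      by (rule integral_abs_bound)
    also have "\<dots> \<le> (\<integral>x. e' * indicator (UNIV \<times> {r. norm r > s * t}) x \<partial>DL)"
    proof (intro integral_mono integrable_abs Bochner_Integration.integrable_diff i1 i2 i3)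
      fix x :: "((real^'d^'d) \<times> (real^'d)) \<times> (real^'d)"
      obtain a b r where x: "x = ((a, b), r)" by (metis surj_pair)
      show "\<bar>?v t x * ?I x - ?u t x * ?I x\<bar>
        \<le> e' * indicator (UNIV \<times> {r. norm r > s * t}) x"
        using pt[of a r b] by (simp add: x indicator_def)
    qed
    also have "\<dots> = e' * measure L {r. norm r > s * t}"
      using L.emeasure_pair_measure_Times[of UNIV D "{r. norm r > s * t}"] emeasure_space_1
      by (simp add: measure_def)
    also have "\<dots> \<le> e' * (C * F (s * t))" using C(2)[of "s * t"] s elim(4) e' by (intro mult_left_mono) auto
    also have "\<dots> \<le> e' * (b * F t)" using elim(1) e' C(1) by (simp add: b_def mult.assoc)
    finally have "\<bar>(\<integral>x. ?v t x * ?I x \<partial>DL) - (\<integral>x. ?u t x * ?I x \<partial>DL)\<bar> / F t \<le> e' * b"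
      using F_pos[of t] by (simp add: pos_divide_le_eq mult.assoc)
    also have "\<dots> < e" using e b by (simp add: e'_def)
    finally show ?case
      unfolding tail_mean_trunc_op[OF f] dist_real_def
      using F_pos[of t] by (simp add: diff_divide_distrib[symmetric])
  qed
qed

end

lemma ramp_measurable [measurable (raw)]:
  "h \<in> borel_measurable M \<Longrightarrow> (\<lambda>x. ramp a b (h x)) \<in> borel_measurable M"
  unfolding ramp_def
  by (intro borel_measurable_max borel_measurable_min borel_measurable_divide borel_measurable_diff) auto

context affine_recursion
begin

text \<open>
  The ramp is a continuous cutoff that selects shocks of order \<open>t\<close>; on
  \<open>\<mu>\<close> it removes the neighbourhood of the origin in which \<open>\<mu>\<close>
  may have infinite mass.
\<close>

definition shock_part :: "real \<Rightarrow> (real^'d \<Rightarrow> real) \<Rightarrow> real" where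
  "shock_part \<kappa> f = (\<integral>r. (\<integral>p. f (fst p *v r + snd p) * ramp \<kappa> (2 * \<kappa>) (pair_norm p) \<partial>\<mu>0) \<partial>L)"

text \<open>
  For fixed \<open>r\<close> this is the convergence of the rescaled law of the shock, tested
  with \<open>p \<mapsto> f(a r + b)\<close> times the cutoff: dividing \<open>p\<close> by
  \<open>t\<close> divides \<open>a r + b\<close> by \<open>t\<close>. The ratios are bounded by
  \<open>F(\<kappa> t) / F t\<close> uniformly in \<open>r\<close>, hence dominated convergence
  over \<open>L\<close> applies.
\<close>

lemma shock_limit:
  assumes f: "tail_test f" and \<kappa>: "\<kappa> > 0"
  shows "((\<lambda>t. (\<integral>x. f (affine x /\<^sub>R t) * ramp \<kappa> (2 * \<kappa>) (pair_norm (fst x) / t) \<partial>DL) / F t)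
      \<longlongrightarrow> shock_part \<kappa> f) at_top" (is "?A")
    and "ennreal (shock_part \<kappa> f) =
      (\<integral>\<^sup>+r. \<integral>\<^sup>+p. ennreal (f (fst p *v r + snd p) * ramp \<kappa> (2 * \<kappa>) (pair_norm p)) \<partial>\<mu>0 \<partial>L)" (is "?B")
proof -
  interpret L: prob_space L by (rule prob_space_L)
  interpret DL: pair_prob_space D L ..
  interpret M0: sigma_finite_measure \<mu>0 by (rule sigma_finite_mu0)
  obtain c where c: "0 < c" "\<And>x. f x \<le> c" using tail_test_bound[OF f] by blast
  note [measurable] = tail_test_measurable[OF f]
  note nn = tail_test_nonneg[OF f]
  define g where "g r p = f (fst p *v r + snd p) * ramp \<kappa> (2 * \<kappa>) (pair_norm p)" for r and p :: "(real^'d^'d) \<times> (real^'d)"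
  have gcont: "continuous_on UNIV (g r)" for r
    unfolding g_def using \<kappa>
    by (intro continuous_intros continuous_on_pair_norm continuous_on_compose2[OF tail_test_continuous[OF f]]) auto
  have g: "0 \<le> g r p" "g r p \<le> c" for r p
    using nn c mult_mono[of "f (fst p *v r + snd p)" c "ramp \<kappa> (2 * \<kappa>) (pair_norm p)" 1] by (auto simp: g_def)
  have g0: "g r p = 0" if "pair_norm p \<le> \<kappa>" for r p
    using that \<kappa> by (simp add: g_def ramp_eq_0)
  have g0': "g r p = 0" if "pair_norm p < \<kappa>" for r p using g0 that by simp
  note lim = tail_test_limit[OF gcont g \<kappa> g0']
  have gmeas [measurable]: "(\<lambda>x. g (fst x) (snd x)) \<in> borel_measurable (L \<Otimes>\<^sub>M D)" "(\<lambda>x. g (fst x) (snd x)) \<in> borel_measurable LM"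
    "(\<lambda>x. g (fst x) (snd x /\<^sub>R t)) \<in> borel_measurable (L \<Otimes>\<^sub>M D)" for t
    unfolding g_def by measurable
  have m1 [measurable]: "(\<lambda>r. \<integral>p. g r p \<partial>\<mu>0) \<in> borel_measurable L"
    by (rule M0.borel_measurable_lebesgue_integral) (simp add: case_prod_beta')
  have m2 [measurable]: "(\<lambda>r. \<integral>p. g r (p /\<^sub>R t) \<partial>D) \<in> borel_measurable L" for t
    by (rule borel_measurable_lebesgue_integral) (simp add: case_prod_beta')
  have lim': "((\<lambda>t. \<integral>r. (\<integral>p. g r (p /\<^sub>R t) \<partial>D) / F t \<partial>L) \<longlongrightarrow> (\<integral>r. (\<integral>p. g r p \<partial>\<mu>0) \<partial>L)) at_top"
  proof (rule integral_dominated_convergence_at_top[where w="\<lambda>_. c * (\<kappa> powr - \<alpha> + 1)"])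
    show "eventually (\<lambda>t. AE r in L. norm ((\<integral>p. g r (p /\<^sub>R t) \<partial>D) / F t) \<le> c * (\<kappa> powr - \<alpha> + 1)) at_top"
      using F_rv_bound[OF \<kappa>] eventually_gt_at_top[of 0]
    proof (eventually_elim, intro AE_I2)
      fix t r assume t: "F (\<kappa> * t) \<le> (\<kappa> powr - \<alpha> + 1) * F t" "0 < t"
      have "(\<integral>p. g r (p /\<^sub>R t) \<partial>D) \<le> (\<integral>p. c * indicator {p. pair_norm p > \<kappa> * t} p \<partial>D)"
      proof (rule integral_D_mono)
        show "g r (p /\<^sub>R t) \<le> c * indicator {p. pair_norm p > \<kappa> * t} p" for p
        proof (cases "pair_norm p > \<kappa> * t")
          case False
          then have "pair_norm (p /\<^sub>R t) \<le> \<kappa>" unfolding N_divide[OF t(2)] using t(2) by (simp add: field_simps)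
          then show ?thesis using False by (simp add: g0)
        qed (use g in simp)
        show "c * indicator {p. pair_norm p > \<kappa> * t} p \<le> c" for p using c(1) by (simp add: indicator_def)
        show "(\<lambda>p. g r (p /\<^sub>R t)) \<in> borel_measurable borel" unfolding g_def by measurable
      qed (use g in auto)
      also have "\<dots> = c * F (\<kappa> * t)" by (simp add: F_def)
      also have "\<dots> \<le> c * ((\<kappa> powr - \<alpha> + 1) * F t)" using t c by (intro mult_left_mono) auto
      finally have "(\<integral>p. g r (p /\<^sub>R t) \<partial>D) \<le> c * (\<kappa> powr - \<alpha> + 1) * F t" by (simp add: mult.assoc)
      moreover have "0 \<le> (\<integral>p. g r (p /\<^sub>R t) \<partial>D)" using g by (intro integral_nonneg_AE) auto
      ultimately show "norm ((\<integral>p. g r (p /\<^sub>R t) \<partial>D) / F t) \<le> c * (\<kappa> powr - \<alpha> + 1)"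
        using F_pos[of t] by (simp add: pos_divide_le_eq)
    qed
    show "AE r in L. ((\<lambda>t. (\<integral>p. g r (p /\<^sub>R t) \<partial>D) / F t) \<longlongrightarrow> (\<integral>p. g r p \<partial>\<mu>0)) at_top"
      using lim(2) by simp
  qed auto
  have "eventually (\<lambda>t. (\<integral>r. (\<integral>p. g r (p /\<^sub>R t) \<partial>D) / F t \<partial>L) =
     (\<integral>x. f (affine x /\<^sub>R t) * ramp \<kappa> (2 * \<kappa>) (pair_norm (fst x) / t) \<partial>DL) / F t) at_top"
    using eventually_gt_at_top[of 0]
  proof eventually_elim
    case (elim t)
    have gm: "(\<lambda>x. g (snd x) (fst x /\<^sub>R t)) \<in> borel_measurable DL"
      unfolding g_def by measurable
    have "integrable DL (\<lambda>(p, r). g r (p /\<^sub>R t))"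
      unfolding case_prod_beta'
      by (rule DL.integrable_const_bound[where B=c]) (use g gm in auto)
    from DL.integral_snd[OF this]
    have "(\<integral>r. (\<integral>p. g r (p /\<^sub>R t) \<partial>D) \<partial>L) = (\<integral>x. g (snd x) (fst x /\<^sub>R t) \<partial>DL)"
      by (simp add: case_prod_beta')
    also have "\<dots> = (\<integral>x. f (affine x /\<^sub>R t) * ramp \<kappa> (2 * \<kappa>) (pair_norm (fst x) / t) \<partial>DL)"
      unfolding g_def N_divide[OF elim]
      by (simp add: scaleR_matrix_vector_assoc[symmetric] scaleR_add_right)
    finally show ?case by simp
  qed
  from Lim_transform_eventually[OF lim' this]
  show ?A by (simp add: shock_part_def g_def)
  have inner: "ennreal (\<integral>p. g r p \<partial>\<mu>0) = (\<integral>\<^sup>+p. ennreal (g r p) \<partial>\<mu>0)" for r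
    by (rule nn_integral_eq_integral[symmetric]) (use lim(1) g in auto)
  have "(\<integral>p. g r p \<partial>\<mu>0) \<le> c * \<kappa> powr - \<alpha>" for r
  proof -
    have "(\<integral>\<^sup>+p. ennreal (g r p) \<partial>\<mu>0) \<le> (\<integral>\<^sup>+p. ennreal c * indicator {p. pair_norm p > \<kappa>} p \<partial>\<mu>0)"
    proof (intro nn_integral_mono)
      fix p
      show "ennreal (g r p) \<le> ennreal c * indicator {p. pair_norm p > \<kappa>} p"
        using g[of r p] g0[of p r] by (cases "pair_norm p > \<kappa>") (auto intro: ennreal_leI)
    qed
    also have "\<dots> = ennreal (c * \<kappa> powr - \<alpha>)"
      using c(1) \<kappa> by (simp add: nn_integral_cmult_indicator mu0_tail ennreal_mult')
    finally show ?thesis using c(1) by (simp add: inner[symmetric])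
  qed
  then have intL: "integrable L (\<lambda>r. \<integral>p. g r p \<partial>\<mu>0)"
    by (intro L.integrable_const_bound[where B="c * \<kappa> powr - \<alpha>"]) (use g in \<open>auto simp: integral_nonneg_AE\<close>)
  have "ennreal (\<integral>r. (\<integral>p. g r p \<partial>\<mu>0) \<partial>L) = (\<integral>\<^sup>+r. ennreal (\<integral>p. g r p \<partial>\<mu>0) \<partial>L)"
    by (rule nn_integral_eq_integral[symmetric, OF intL]) (use g in \<open>auto simp: integral_nonneg_AE\<close>)
  then show ?B unfolding inner by (simp add: shock_part_def g_def)
qed

lemma shock_part_nonneg: "tail_test f \<Longrightarrow> 0 \<le> shock_part \<kappa> f"
  unfolding shock_part_def by (intro integral_nonneg_AE AE_I2) (auto simp: tail_test_nonneg)

lemma tail_mean_nonneg: "tail_test f \<Longrightarrow> 0 \<le> tail_mean t f"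
  unfolding tail_mean_def by (intro divide_nonneg_nonneg integral_nonneg_AE AE_I2) (auto simp: tail_test_nonneg)

lemma L_scaled_tail:
  assumes C: "C > 0" "\<And>t. t \<ge> 0 \<Longrightarrow> measure L {r. norm r > t} \<le> C * F t" and "0 \<le> a" "0 \<le> u"
  shows "measure L {r. a * norm r > u} \<le> C * measure D {q. a * pair_norm q > u}"
proof (cases "a = 0")
  case False
  then have eq: "{r::real^'d. a * norm r > u} = {r. norm r > u / a}"
      "{q::(real^'d^'d) \<times> (real^'d). a * pair_norm q > u} = {q. pair_norm q > u / a}"
    using assms by (auto simp: field_simps)
  have "0 \<le> u / a" using assms by simp
  then show ?thesis using C(2) unfolding eq F_def by blast
qed (use assms in simp)

text \<open>
  Here \<open>|b| \<le> N\<close> is too small to bring \<open>a r + b\<close> out of the zero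
  ball of \<open>f\<close>, so \<open>|a| |r|\<close> must exceed a multiple of
  \<open>t\<close>. Replacing \<open>|r|\<close> by an independent copy of \<open>N\<close> at
  the cost of the constant of the tail bound turns this event into the one of hypothesis
  \<open>C2\<close>.
\<close>

lemma middle_shock:
  assumes f: "tail_test f" and e: "e > 0"
  shows "\<exists>m>0. \<exists>\<kappa>>0. eventually (\<lambda>t.
    (\<integral>x. f (affine x /\<^sub>R t) *
       indicator {p. m < pair_norm p \<and> pair_norm p \<le> 2 * \<kappa> * t} (fst x) \<partial>DL) \<le> e * F t) at_top"
proof -
  interpret L: prob_space L by (rule prob_space_L)
  interpret DL: pair_prob_space D L ..
  obtain c \<delta> where c: "0 < c" "\<And>x. f x \<le> c" "0 < \<delta>" "\<And>x. norm x < \<delta> \<Longrightarrow> f x = 0"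
    using tail_testD[OF f] by blast
  let ?v = "\<lambda>t x. f (affine x /\<^sub>R t)"
  obtain C where C: "C > 0" "\<And>t. t \<ge> 0 \<Longrightarrow> measure L {r. norm r > t} \<le> C * F t" using L_tail by blast
  note [measurable] = tail_test_measurable[OF f]
  note nn = tail_test_nonneg[OF f]
  define s where "s = \<delta> / 4"
  have s: "s > 0" using c by (simp add: s_def)
  define b where "b = s powr - \<alpha> + 1"
  have b: "b > 0" by (simp add: b_def add_nonneg_pos)
  define e' where "e' = e / (c * C * b)"
  have e': "e' > 0" using e b c C by (simp add: e'_def)
  have "eventually (\<lambda>m. 1 \<le> m \<and> eventually (\<lambda>x.
      (\<integral>p. indicator {p. m < pair_norm p \<and> pair_norm p \<le> x / m} p *
         measure D {q. pair_norm p * pair_norm q > x} \<partial>D) \<le> e' * F x) at_top) at_top"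
    by (intro eventually_conj eventually_ge_at_top C2 e')
  then obtain m where m: "1 \<le> m" and J: "eventually (\<lambda>x.
      (\<integral>p. indicator {p. m < pair_norm p \<and> pair_norm p \<le> x / m} p *
         measure D {q. pair_norm p * pair_norm q > x} \<partial>D) \<le> e' * F x) at_top"
    unfolding eventually_at_top_linorder by blast
  \<comment> \<open>With this choice \<open>2 \<kappa> t\<close> is the upper limit \<open>x / m\<close> of \<open>C2\<close> at \<open>x = s t\<close>.\<close>
  define \<kappa> where "\<kappa> = s / (2 * m)"
  have \<kappa>: "\<kappa> > 0" using s m by (simp add: \<kappa>_def)
  have slim: "filterlim (\<lambda>t. s * t) at_top at_top"
    by (rule filterlim_tendsto_pos_mult_at_top[OF tendsto_const s]) (auto simp: filterlim_ident)
  have J': "eventually (\<lambda>t. (\<integral>p. indicator {p. m < pair_norm p \<and> pair_norm p \<le> s * t / m} p *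
         measure D {q. pair_norm p * pair_norm q > s * t} \<partial>D) \<le> e' * F (s * t)) at_top"
    using J slim unfolding filterlim_iff by blast
  have "eventually (\<lambda>t.
    (\<integral>x. ?v t x *
       indicator {p. m < pair_norm p \<and> pair_norm p \<le> 2 * \<kappa> * t} (fst x) \<partial>DL) \<le> e * F t) at_top"
    using J' F_rv_bound[OF s] eventually_gt_at_top[of 0]
  proof eventually_elim
    case (elim t)
    define U where "U = {p :: (real^'d^'d) \<times> (real^'d). m < pair_norm p \<and> pair_norm p \<le> s * t / m}"
    have U [measurable]: "U \<in> sets borel" unfolding U_def by measurable
    have kt: "2 * \<kappa> * t = s * t / m" using m by (simp add: \<kappa>_def)
    define Q where "Q = {x :: ((real^'d^'d) \<times> (real^'d)) \<times> (real^'d). fst x \<in> U \<and> op_norm (fst (fst x)) * norm (snd x) > s * t}"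
    have Q: "Q \<in> sets DL"
    proof -
      have "{x \<in> space DL. fst x \<in> U \<and> op_norm (fst (fst x)) * norm (snd x) > s * t} \<in> sets DL"
        by measurable
      then show ?thesis by (simp add: Q_def space_pair_measure)
    qed
    have pt: "?v t x * indicator U (fst x) \<le> c * indicator Q x" for x
    proof (cases "x \<in> Q")
      case True
      then show ?thesis using c(2) by (simp add: Q_def)
    next
      case False
      have "?v t x = 0" if xU: "fst x \<in> U"
      proof (rule c(4))
        have small: "op_norm (fst (fst x)) * norm (snd x) \<le> s * t" using False xU by (auto simp: Q_def not_less)
        have st: "0 < s * t" using s elim(3) by simp
        have "s * t / m \<le> s * t" using m st divide_left_mono[of 1 m "s * t"] by simp
        then have "norm (snd (fst x)) \<le> s * t" using xU norm_le_pair[of "fst x"] by (auto simp: U_def)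
        then have "norm (affine x) \<le> 2 * (s * t)"
          using norm_triangle_ineq[of "fst (fst x) *v snd x" "snd (fst x)"] norm_mult_le_op_norm[of "fst (fst x)" "snd x"] small
          by linarith
        also have "\<dots> < \<delta> * t" using c(3) elim(3) by (simp add: s_def)
        finally have *: "norm (affine x) < \<delta> * t" .
        have "norm (affine x /\<^sub>R t) = norm (affine x) / t"
          using elim(3) by (simp add: divide_inverse mult.commute)
        also have "\<dots> < \<delta>" using * elim(3) by (simp add: pos_divide_less_eq)
        finally show "norm (affine x /\<^sub>R t) < \<delta>" .
      qed
      then show ?thesis using False by (simp add: indicator_def)
    qed
    have [measurable]: "(\<lambda>p. measure D {q. pair_norm p * pair_norm q > s * t}) \<in> borel_measurable D"
      by (rule cut_measurable) measurable
    have "(\<integral>x. ?v t x * indicator U (fst x) \<partial>DL) \<le> (\<integral>x. c * indicator Q x \<partial>DL)"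
    proof (rule integral_mono)
      show "integrable DL (\<lambda>x. ?v t x * indicator U (fst x))"
        by (rule DL.integrable_indicator_bound[where c=c]) (use c(1,2) nn in auto)
      show "integrable DL (\<lambda>x. c * indicator Q x)"
        using Q by (intro integrable_mult_right integrable_real_indicator) (auto simp: DL.emeasure_eq_measure)
    qed (rule pt)
    also have "\<dots> = c * measure DL Q" using Q by simp
    also have "measure DL Q = (\<integral>p. measure L (Pair p -` Q) \<partial>D)"
      by (rule measure_pair_cut(1)[OF prob_space_axioms prob_space_L Q])
    also have "\<dots> \<le> (\<integral>p. C * (indicator U p * measure D {q. pair_norm p * pair_norm q > s * t}) \<partial>D)"
    proof (rule integral_mono)
      show "integrable D (\<lambda>p. measure L (Pair p -` Q))"
        by (rule measure_pair_cut(2)[OF prob_space_axioms prob_space_L Q])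
      show "integrable D (\<lambda>p. C * (indicator U p * measure D {q. pair_norm p * pair_norm q > s * t}))"
        by (intro integrable_mult_right integrable_const_bound[where B=1]) (auto simp: indicator_def)
      fix p :: "(real^'d^'d) \<times> (real^'d)"
      show "measure L (Pair p -` Q) \<le> C * (indicator U p * measure D {q. pair_norm p * pair_norm q > s * t})"
      proof (cases "p \<in> U")
        case True
        then have "Pair p -` Q = {r. op_norm (fst p) * norm r > s * t}" by (auto simp: Q_def)
        then have "measure L (Pair p -` Q) \<le> C * measure D {q. op_norm (fst p) * pair_norm q > s * t}"
          using L_scaled_tail[OF C, of "op_norm (fst p)" "s * t"] s elim(3) by simp
        also have "\<dots> \<le> C * measure D {q. pair_norm p * pair_norm q > s * t}"
        proof (intro mult_left_mono finite_measure_mono Collect_mono impI)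
          fix q :: "(real^'d^'d) \<times> (real^'d)" assume "s * t < op_norm (fst p) * pair_norm q"
          also have "\<dots> \<le> pair_norm p * pair_norm q"
            using op_le_pair[of p] N_nonneg[of q] by (intro mult_right_mono)
          finally show "s * t < pair_norm p * pair_norm q" .
        qed (use C in auto)
        finally show ?thesis using True by simp
      next
        case False
        then have "Pair p -` Q = {}" by (auto simp: Q_def)
        then show ?thesis using False by simp
      qed
    qed
    also have "\<dots> = C * (\<integral>p. indicator U p * measure D {q. pair_norm p * pair_norm q > s * t} \<partial>D)" by simp
    also have "\<dots> \<le> C * (e' * F (s * t))" using elim(1) C(1) unfolding U_def by (intro mult_left_mono) auto
    also have "\<dots> \<le> C * (e' * (b * F t))" using elim(2) C(1) e' by (simp add: b_def)
    finally have "(\<integral>x. ?v t x * indicator U (fst x) \<partial>DL) \<le> c * (C * (e' * (b * F t)))"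
      using c(1) by simp
    also have "\<dots> = e * F t" using c(1) C(1) b by (simp add: e'_def)
    finally show ?case unfolding kt U_def .
  qed
  then show ?thesis using m \<kappa> by (intro exI[of _ m] conjI exI[of _ \<kappa>]) auto
qed

text \<open>
  For large \<open>t\<close> the two ranges of shocks are disjoint, and dropping the shocks in
  between only decreases the mean.
\<close>

lemma tail_mean_lower_step:
  assumes f: "tail_test f" and "\<kappa> > 0" "K > 0" "e > 0"
  shows "eventually (\<lambda>t. shock_part \<kappa> f + tail_mean t (trunc_op K f) - e \<le> tail_mean t f) at_top"
proof -
  interpret L: prob_space L by (rule prob_space_L)
  interpret DL: pair_prob_space D L ..
  obtain c where c: "0 < c" "\<And>x. f x \<le> c" using tail_test_bound[OF f] by blast
  note [measurable] = tail_test_measurable[OF f]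
  note nn = tail_test_nonneg[OF f]
  let ?v = "\<lambda>t x. f (affine x /\<^sub>R t)"
  have e2: "e / 2 > 0" using assms by simp
  from tendstoD[OF bounded_shock_limit[OF f assms(3)] e2] tendstoD[OF shock_limit(1)[OF f assms(2)] e2]
    eventually_gt_at_top[of "K / \<kappa>"] eventually_gt_at_top[of 0]
  show ?thesis
  proof eventually_elim
    case (elim t)
    have Kt: "K < \<kappa> * t" using elim(3) assms(2) by (simp add: field_simps)
    have i1: "integrable DL (\<lambda>x. ?v t x * indicator {p. pair_norm p \<le> K} (fst x))"
      by (rule DL.integrable_indicator_bound[where c=c]) (use c(1,2) nn in auto)
    have i2: "integrable DL (\<lambda>x. ?v t x * ramp \<kappa> (2 * \<kappa>) (pair_norm (fst x) / t))"
      by (rule DL.integrable_const_bound[where B=c]) (use c nn mult_mono[OF c(2), of _ 1] in auto)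
    have i3: "integrable DL (?v t)"
      by (rule DL.integrable_const_bound[where B=c]) (use c nn in auto)
    have "(\<integral>x. ?v t x * indicator {p. pair_norm p \<le> K} (fst x) \<partial>DL) + (\<integral>x. ?v t x * ramp \<kappa> (2 * \<kappa>) (pair_norm (fst x) / t) \<partial>DL)
      = (\<integral>x. ?v t x * indicator {p. pair_norm p \<le> K} (fst x) + ?v t x * ramp \<kappa> (2 * \<kappa>) (pair_norm (fst x) / t) \<partial>DL)"
      by (rule Bochner_Integration.integral_add[symmetric, OF i1 i2])
    also have "\<dots> \<le> (\<integral>x. ?v t x \<partial>DL)"
    proof (intro integral_mono Bochner_Integration.integrable_add i1 i2 i3)
      fix x :: "((real^'d^'d) \<times> (real^'d)) \<times> (real^'d)"
      show "?v t x * indicator {p. pair_norm p \<le> K} (fst x) + ?v t x * ramp \<kappa> (2 * \<kappa>) (pair_norm (fst x) / t) \<le> ?v t x"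
      proof (cases "pair_norm (fst x) \<le> K")
        case True
        then have "pair_norm (fst x) / t \<le> \<kappa>" using Kt elim(4) by (simp add: divide_le_eq)
        then show ?thesis using assms(2) by (simp add: ramp_eq_0 indicator_def nn)
      qed (simp add: nn mult_left_le)
    qed
    finally have "(\<integral>x. ?v t x * indicator {p. pair_norm p \<le> K} (fst x) \<partial>DL) / F t +
      (\<integral>x. ?v t x * ramp \<kappa> (2 * \<kappa>) (pair_norm (fst x) / t) \<partial>DL) / F t \<le> tail_mean t f"
      unfolding tail_mean_fixed_point[OF f] add_divide_distrib[symmetric]
      using F_pos[of t] by (intro divide_right_mono) auto
    then show ?case using elim(1,2) unfolding dist_real_def by linarith
  qed
qed

lemma tail_mean_upper_step:
  assumes f: "tail_test f" and "e > 0"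
  shows "\<exists>m>0. \<exists>\<kappa>>0. eventually (\<lambda>t. tail_mean t f \<le> shock_part \<kappa> f + tail_mean t (trunc_op m f) + e) at_top"
proof -
  interpret L: prob_space L by (rule prob_space_L)
  interpret DL: pair_prob_space D L ..
  obtain c where c: "0 < c" "\<And>x. f x \<le> c" using tail_test_bound[OF f] by blast
  note [measurable] = tail_test_measurable[OF f]
  note nn = tail_test_nonneg[OF f]
  let ?v = "\<lambda>t x. f (affine x /\<^sub>R t)"
  have e3: "e / 3 > 0" using assms by simp
  from middle_shock[OF f e3] obtain m \<kappa> where m: "m > 0" and \<kappa>: "\<kappa> > 0" and mid: "eventually (\<lambda>t.
    (\<integral>x. ?v t x * indicator {p. m < pair_norm p \<and> pair_norm p \<le> 2 * \<kappa> * t} (fst x) \<partial>DL) \<le> e / 3 * F t) at_top"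
    by blast
  from tendstoD[OF bounded_shock_limit[OF f m] e3] tendstoD[OF shock_limit(1)[OF f \<kappa>] e3] mid eventually_gt_at_top[of 0]
  have "eventually (\<lambda>t. tail_mean t f \<le> shock_part \<kappa> f + tail_mean t (trunc_op m f) + e) at_top"
  proof eventually_elim
    case (elim t)
    have i1: "integrable DL (\<lambda>x. ?v t x * indicator {p. pair_norm p \<le> m} (fst x))"
      by (rule DL.integrable_indicator_bound[where c=c]) (use c(1,2) nn in auto)
    have i2: "integrable DL (\<lambda>x. ?v t x * ramp \<kappa> (2 * \<kappa>) (pair_norm (fst x) / t))"
      by (rule DL.integrable_const_bound[where B=c]) (use c nn mult_mono[OF c(2), of _ 1] in auto)
    have i3: "integrable DL (?v t)"
      by (rule DL.integrable_const_bound[where B=c]) (use c nn in auto)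
    have i4: "integrable DL (\<lambda>x. ?v t x * indicator {p. m < pair_norm p \<and> pair_norm p \<le> 2 * \<kappa> * t} (fst x))"
      by (rule DL.integrable_indicator_bound[where c=c]) (use c(1,2) nn in auto)
    have "(\<integral>x. ?v t x \<partial>DL) \<le> (\<integral>x. ?v t x * indicator {p. pair_norm p \<le> m} (fst x) +
        ?v t x * ramp \<kappa> (2 * \<kappa>) (pair_norm (fst x) / t) +
        ?v t x * indicator {p. m < pair_norm p \<and> pair_norm p \<le> 2 * \<kappa> * t} (fst x) \<partial>DL)"
    proof (intro integral_mono Bochner_Integration.integrable_add i1 i2 i3 i4)
      fix x :: "((real^'d^'d) \<times> (real^'d)) \<times> (real^'d)"
      consider "pair_norm (fst x) \<le> m" | "m < pair_norm (fst x)" "pair_norm (fst x) \<le> 2 * \<kappa> * t" | "2 * \<kappa> * t < pair_norm (fst x)"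
        by linarith
      then show "?v t x \<le> ?v t x * indicator {p. pair_norm p \<le> m} (fst x) +
        ?v t x * ramp \<kappa> (2 * \<kappa>) (pair_norm (fst x) / t) +
        ?v t x * indicator {p. m < pair_norm p \<and> pair_norm p \<le> 2 * \<kappa> * t} (fst x)"
      proof cases
        case 3
        then have "2 * \<kappa> \<le> pair_norm (fst x) / t" using elim(4) by (simp add: le_divide_eq)
        then have "ramp \<kappa> (2 * \<kappa>) (pair_norm (fst x) / t) = 1" using \<kappa> by (simp add: ramp_eq_1)
        then show ?thesis using nn by (simp add: indicator_def)
      qed (auto simp: nn)
    qed
    also have "\<dots> = (\<integral>x. ?v t x * indicator {p. pair_norm p \<le> m} (fst x) \<partial>DL) +
        (\<integral>x. ?v t x * ramp \<kappa> (2 * \<kappa>) (pair_norm (fst x) / t) \<partial>DL) +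
        (\<integral>x. ?v t x * indicator {p. m < pair_norm p \<and> pair_norm p \<le> 2 * \<kappa> * t} (fst x) \<partial>DL)"
      using i1 i2 i4 by (simp add: Bochner_Integration.integral_add)
    finally have "tail_mean t f \<le> (\<integral>x. ?v t x * indicator {p. pair_norm p \<le> m} (fst x) \<partial>DL) / F t +
        (\<integral>x. ?v t x * ramp \<kappa> (2 * \<kappa>) (pair_norm (fst x) / t) \<partial>DL) / F t +
        (\<integral>x. ?v t x * indicator {p. m < pair_norm p \<and> pair_norm p \<le> 2 * \<kappa> * t} (fst x) \<partial>DL) / F t"
      unfolding tail_mean_fixed_point[OF f] add_divide_distrib[symmetric]
      using F_pos[of t] by (intro divide_right_mono) auto
    moreover have "(\<integral>x. ?v t x * indicator {p. m < pair_norm p \<and> pair_norm p \<le> 2 * \<kappa> * t} (fst x) \<partial>DL) / F t \<le> e / 3"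
      using elim(3) F_pos[of t] by (simp add: pos_divide_le_eq)
    ultimately show ?case using elim(1,2) unfolding dist_real_def by linarith
  qed
  then show ?thesis using m \<kappa> by blast
qed

end

section \<open>Iterating the step\<close>

context affine_recursion
begin

definition shock :: "(real^'d) \<times> ((real^'d^'d) \<times> (real^'d)) \<Rightarrow> real^'d" where
  "shock z = fst (snd z) *v fst z + snd (snd z)"

text \<open>
  The mass that the \<open>n\<close>-th summand of the limit measure gives to \<open>f\<close>:
  a large shock that hits an independent copy of the solution and is then carried on by
  \<open>n\<close> further matrices.
\<close>

definition contrib :: "nat \<Rightarrow> (real^'d \<Rightarrow> real) \<Rightarrow> ennreal" where
  "contrib n f = (\<integral>\<^sup>+P. \<integral>\<^sup>+z. ennreal (f (P *v shock z)) \<partial>LM \<partial>prod_law n)"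

lemma shock_measurable [measurable]: "shock \<in> borel_measurable LM"
  unfolding shock_def by measurable

lemma sigma_finite_LM: "sigma_finite_measure LM"
  using prob_space_L prob_space_imp_sigma_finite sigma_finite_mu0 by (intro sigma_finite_pair_measure)

lemma contrib_integrand_measurable [measurable]:
  assumes "tail_test f" and [measurable]: "g \<in> borel_measurable K"
  shows "(\<lambda>P. \<integral>\<^sup>+z. ennreal (f (g P *v shock z)) \<partial>LM) \<in> borel_measurable K"
proof -
  interpret LM: sigma_finite_measure LM by (rule sigma_finite_LM)
  note [measurable] = tail_test_measurable[OF assms(1)]
  show ?thesis by measurable
qed

lemma contrib_Suc:
  assumes f: "tail_test f"
  shows "contrib (Suc n) f =
    (\<integral>\<^sup>+p. \<integral>\<^sup>+P. \<integral>\<^sup>+z. ennreal (f ((fst p ** P) *v shock z)) \<partial>LM \<partial>prod_law n \<partial>D)"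
  unfolding contrib_def
  by (rule nn_integral_prod_law_Suc) (rule contrib_integrand_measurable[OF f], simp)

text \<open>
  Averaging \<open>f\<close> over one more matrix prolongs the product, except that the new
  matrix is truncated. In the limit \<open>K \<rightarrow> \<infinity>\<close> this becomes the
  next summand.
\<close>

lemma contrib_trunc_op:
  assumes f: "tail_test f" and K: "K > 0"
  shows "contrib n (trunc_op K f) =
    (\<integral>\<^sup>+p. indicator {p. pair_norm p \<le> K} p *
      (\<integral>\<^sup>+P. \<integral>\<^sup>+z. ennreal (f ((fst p ** P) *v shock z)) \<partial>LM \<partial>prod_law n) \<partial>D)"
proof -
  interpret LM: sigma_finite_measure LM by (rule sigma_finite_LM)
  interpret PL: prob_space "prod_law n" by (rule prob_space_prod_law)
  interpret DLM: pair_sigma_finite D LM ..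
  interpret DP: pair_sigma_finite D "prod_law n" ..
  obtain c where c: "0 < c" "\<And>x. f x \<le> c" using tail_test_bound[OF f] by blast
  note [measurable] = tail_test_measurable[OF f]
  note nn = tail_test_nonneg[OF f]
  let ?I = "\<lambda>p. indicator {p. pair_norm p \<le> K} p :: ennreal"
  have tr: "ennreal (trunc_op K f x) = (\<integral>\<^sup>+p. ?I p * ennreal (f (fst p *v x)) \<partial>D)" for x
  proof -
    have "integrable D (\<lambda>p. f (fst p *v x) * indicator {p. pair_norm p \<le> K} p)"
      by (rule integrable_indicator_bound[where c=c]) (use c(1,2) nn in auto)
    then have "ennreal (trunc_op K f x) = (\<integral>\<^sup>+p. ennreal (f (fst p *v x) * indicator {p. pair_norm p \<le> K} p) \<partial>D)"
      unfolding trunc_op_def by (intro nn_integral_eq_integral[symmetric]) (auto simp: nn)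
    also have "\<dots> = (\<integral>\<^sup>+p. ?I p * ennreal (f (fst p *v x)) \<partial>D)"
      by (intro nn_integral_cong) (auto simp: indicator_def)
    finally show ?thesis .
  qed
  have "contrib n (trunc_op K f) =
    (\<integral>\<^sup>+P. \<integral>\<^sup>+z. \<integral>\<^sup>+p. ?I p * ennreal (f (fst p *v (P *v shock z))) \<partial>D \<partial>LM \<partial>prod_law n)"
    unfolding contrib_def tr ..
  also have "\<dots> = (\<integral>\<^sup>+P. \<integral>\<^sup>+p. \<integral>\<^sup>+z. ?I p * ennreal (f ((fst p ** P) *v shock z)) \<partial>LM \<partial>D \<partial>prod_law n)"
    unfolding matrix_vector_mul_assoc by (intro nn_integral_cong DLM.Fubini') measurable
  also have "\<dots> = (\<integral>\<^sup>+P. \<integral>\<^sup>+p. ?I p * (\<integral>\<^sup>+z. ennreal (f ((fst p ** P) *v shock z)) \<partial>LM) \<partial>D \<partial>prod_law n)"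
    by (intro nn_integral_cong nn_integral_cmult) measurable
  also have "\<dots> = (\<integral>\<^sup>+p. \<integral>\<^sup>+P. ?I p * (\<integral>\<^sup>+z. ennreal (f ((fst p ** P) *v shock z)) \<partial>LM) \<partial>prod_law n \<partial>D)"
    by (intro DP.Fubini') measurable
  also have "\<dots> = (\<integral>\<^sup>+p. ?I p * (\<integral>\<^sup>+P. \<integral>\<^sup>+z. ennreal (f ((fst p ** P) *v shock z)) \<partial>LM \<partial>prod_law n) \<partial>D)"
    by (intro nn_integral_cong nn_integral_cmult contrib_integrand_measurable f) measurable
  finally show ?thesis .
qed

lemma contrib_trunc_op_le:
  assumes "tail_test f" "K > 0"
  shows "contrib n (trunc_op K f) \<le> contrib (Suc n) f"
  unfolding contrib_trunc_op[OF assms] contrib_Suc[OF assms(1)]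
  by (intro nn_integral_mono) (auto simp: indicator_def)

lemma contrib_trunc_op_limit:
  assumes f: "tail_test f"
  shows "(\<lambda>j. contrib n (trunc_op (real (Suc j)) f)) \<longlonglongrightarrow> contrib (Suc n) f"
proof -
  interpret PL: prob_space "prod_law n" by (rule prob_space_prod_law)
  interpret LM: sigma_finite_measure LM by (rule sigma_finite_LM)
  note [measurable] = tail_test_measurable[OF f]
  define H where "H p = (\<integral>\<^sup>+P. \<integral>\<^sup>+z. ennreal (f ((fst p ** P) *v shock z)) \<partial>LM \<partial>prod_law n)"
    for p :: "(real^'d^'d) \<times> (real^'d)"
  have [measurable]: "H \<in> borel_measurable D" unfolding H_def by measurable
  have "(\<lambda>j. \<integral>\<^sup>+p. indicator {p. pair_norm p \<le> real (Suc j)} p * H p \<partial>D) \<longlonglongrightarrow> (\<integral>\<^sup>+p. H p \<partial>D)"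
  proof (rule nn_integral_LIMSEQ)
    show "incseq (\<lambda>j p. indicator {p. pair_norm p \<le> real (Suc j)} p * H p)"
      by (auto simp: incseq_def le_fun_def indicator_def)
    show "(\<lambda>j. indicator {p. pair_norm p \<le> real (Suc j)} p * H p) \<longlonglongrightarrow> H p" for p
    proof (rule tendsto_eventually)
      obtain j0 :: nat where j0: "pair_norm p \<le> real j0" using real_arch_simple by blast
      show "eventually (\<lambda>j. indicator {p. pair_norm p \<le> real (Suc j)} p * H p = H p) sequentially"
        using eventually_ge_at_top[of j0] by eventually_elim (use j0 in \<open>auto simp: indicator_def\<close>)
    qed
  qed measurable
  then show ?thesis unfolding contrib_trunc_op[OF f of_nat_0_less_iff[THEN iffD2, OF zero_less_Suc]] contrib_Suc[OF f] H_def .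
qed

lemma contrib_0:
  assumes f: "tail_test f"
  shows "contrib 0 f = (\<integral>\<^sup>+r. \<integral>\<^sup>+p. ennreal (f (fst p *v r + snd p)) \<partial>\<mu>0 \<partial>L)"
proof -
  interpret M0: sigma_finite_measure \<mu>0 by (rule sigma_finite_mu0)
  note [measurable] = tail_test_measurable[OF f]
  have "contrib 0 f = (\<integral>\<^sup>+z. ennreal (f (mat 1 *v shock z)) \<partial>LM)"
    unfolding contrib_def
    by (rule nn_integral_prod_law_0) (rule contrib_integrand_measurable[OF f], simp)
  also have "\<dots> = (\<integral>\<^sup>+z. ennreal (f (shock z)) \<partial>LM)" by simp
  also have "\<dots> = (\<integral>\<^sup>+r. \<integral>\<^sup>+p. ennreal (f (shock (r, p))) \<partial>\<mu>0 \<partial>L)"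
    by (rule M0.nn_integral_fst[symmetric]) measurable
  finally show ?thesis by (simp add: shock_def)
qed

lemma shock_part_le_contrib:
  assumes f: "tail_test f" and "\<kappa> > 0"
  shows "ennreal (shock_part \<kappa> f) \<le> contrib 0 f"
  unfolding shock_limit(2)[OF assms] contrib_0[OF f]
  by (intro nn_integral_mono ennreal_leI) (auto simp: tail_test_nonneg[OF f] mult_left_le)

text \<open>
  The cutoffs increase to 1 off the origin; at the origin the shock is zero and so is
  \<open>f\<close>.
\<close>

lemma shock_part_limit:
  assumes f: "tail_test f"
  shows "(\<lambda>j. ennreal (shock_part (1 / real (Suc j)) f)) \<longlonglongrightarrow> contrib 0 f"
proof -
  interpret M0: sigma_finite_measure \<mu>0 by (rule sigma_finite_mu0)
  interpret LM: sigma_finite_measure LM by (rule sigma_finite_LM)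
  note [measurable] = tail_test_measurable[OF f]
  note nn = tail_test_nonneg[OF f]
  have f0: "f 0 = 0" using f unfolding tail_test_def by auto
  define k where "k j = 1 / real (Suc j)" for j
  have k: "0 < k j" for j by (simp add: k_def)
  let ?R = "\<lambda>j z. ennreal (f (shock z) * ramp (k j) (2 * k j) (pair_norm (snd z)))"
  have ramp_eq: "ramp (k j) (2 * k j) s = max 0 (min 1 (s * real (Suc j) - 1))" for s j
  proof -
    have "(s - k j) / (2 * k j - k j) = s / k j - 1" using k[of j] by (simp add: diff_divide_distrib)
    also have "s / k j = s * real (Suc j)" by (simp add: k_def)
    finally show ?thesis by (simp add: ramp_def)
  qed
  have "(\<lambda>j. \<integral>\<^sup>+z. ?R j z \<partial>LM) \<longlonglongrightarrow> (\<integral>\<^sup>+z. ennreal (f (shock z)) \<partial>LM)"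
  proof (rule nn_integral_LIMSEQ)
    show "incseq ?R"
    proof (intro incseq_SucI le_funI ennreal_leI mult_left_mono nn)
      fix j and z :: "(real^'d) \<times> ((real^'d^'d) \<times> (real^'d))"
      have "pair_norm (snd z) * real (Suc j) \<le> pair_norm (snd z) * real (Suc (Suc j))"
        by (intro mult_left_mono) auto
      then show "ramp (k j) (2 * k j) (pair_norm (snd z)) \<le> ramp (k (Suc j)) (2 * k (Suc j)) (pair_norm (snd z))"
        unfolding ramp_eq by linarith
    qed
    show "(\<lambda>j. ?R j z) \<longlonglongrightarrow> ennreal (f (shock z))" for z
    proof (rule tendsto_eventually)
      show "eventually (\<lambda>j. ?R j z = ennreal (f (shock z))) sequentially"
      proof (cases "snd z = 0")
        case True
        then show ?thesis by (simp add: shock_def f0)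
      next
        case False
        then have pos: "0 < pair_norm (snd z)" by (rule N_pos)
        obtain j0 :: nat where "2 / pair_norm (snd z) \<le> real j0" using real_arch_simple by blast
        then have j0: "2 \<le> pair_norm (snd z) * real j0" using pos by (simp add: field_simps)
        show ?thesis using eventually_ge_at_top[of j0]
        proof eventually_elim
          case (elim j)
          have "pair_norm (snd z) * real j0 \<le> pair_norm (snd z) * real (Suc j)"
            using elim by (intro mult_left_mono) auto
          then show ?case using j0 unfolding ramp_eq by simp
        qed
      qed
    qed
  qed measurable
  moreover have "(\<integral>\<^sup>+z. ?R j z \<partial>LM) = ennreal (shock_part (k j) f)" for j
    unfolding shock_limit(2)[OF f k]
    by (subst M0.nn_integral_fst[symmetric]) (auto simp: shock_def)
  moreover have "(\<integral>\<^sup>+z. ennreal (f (shock z)) \<partial>LM) = contrib 0 f"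
    unfolding contrib_0[OF f]
    by (subst M0.nn_integral_fst[symmetric]) (auto simp: shock_def)
  ultimately show ?thesis by (simp add: k_def)
qed

text \<open>
  A real number \<open>y\<close> below the partial sum replaces the partial sum itself, which is
  not yet known to be finite. In the induction step the cutoff of the shocks and the truncation
  of the matrices are chosen so that the truncated sum exceeds \<open>y\<close> up to a third of
  \<open>e\<close>; the remaining two thirds pay for \<open>tail_mean_lower_step\<close> and for
  the induction hypothesis.
\<close>

lemma tail_mean_lower_bound:
  assumes "tail_test f" "ennreal y \<le> (\<Sum>n<N. contrib n f)" "e > 0"
  shows "eventually (\<lambda>t. y \<le> tail_mean t f + e) at_top"
  using assms
proof (induction N arbitrary: f y e)
  case 0
  then have "y \<le> 0" by (simp add: ennreal_eq_0_iff)
  moreover have "0 \<le> tail_mean t f + e" for t using tail_mean_nonneg[OF 0(1), of t] 0(3) by simp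
  ultimately show ?case using order_trans by (intro always_eventually allI) blast
next
  case (Suc N)
  define d where "d = e / 3"
  have d: "d > 0" using Suc.prems by (simp add: d_def)
  show ?case
  proof (cases "y \<le> d")
    case True
    show ?thesis
    proof (intro always_eventually allI)
      show "y \<le> tail_mean t f + e" for t
        using tail_mean_nonneg[OF Suc.prems(1), of t] True d unfolding d_def by linarith
    qed
  next
    case False
    have "(\<lambda>j. ennreal (shock_part (1 / real (Suc j)) f) + (\<Sum>n<N. contrib n (trunc_op (real (Suc j)) f)))
      \<longlonglongrightarrow> contrib 0 f + (\<Sum>n<N. contrib (Suc n) f)"
      by (intro tendsto_add tendsto_sum shock_part_limit contrib_trunc_op_limit Suc.prems)
    also have "contrib 0 f + (\<Sum>n<N. contrib (Suc n) f) = (\<Sum>n<Suc N. contrib n f)"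
      by (simp only: sum.lessThan_Suc_shift)
    finally have lim: "(\<lambda>j. ennreal (shock_part (1 / real (Suc j)) f) + (\<Sum>n<N. contrib n (trunc_op (real (Suc j)) f)))
      \<longlonglongrightarrow> (\<Sum>n<Suc N. contrib n f)" .
    have "ennreal (y - d) < ennreal y" using False d by (simp add: ennreal_less_iff)
    also note Suc.prems(2)
    finally obtain j where j: "ennreal (y - d) < ennreal (shock_part (1 / real (Suc j)) f) + (\<Sum>n<N. contrib n (trunc_op (real (Suc j)) f))"
      using order_tendstoD(1)[OF lim] eventually_happens'[OF sequentially_bot] by blast
    define g where "g = shock_part (1 / real (Suc j)) f"
    define h where "h = trunc_op (real (Suc j)) f"
    have h: "tail_test h" unfolding h_def by (intro trunc_op_tail_test Suc.prems) simp
    have g: "0 \<le> g" unfolding g_def by (rule shock_part_nonneg[OF Suc.prems(1)])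
    have "ennreal (y - d - g) \<le> (\<Sum>n<N. contrib n h)"
    proof (cases "(\<Sum>n<N. contrib n h)")
      case (real s)
      have "ennreal (y - d) < ennreal (g + s)"
        using j real g unfolding g_def[symmetric] h_def[symmetric] by simp
      then have "y - d < g + s" using False by (simp add: ennreal_less_iff)
      then show ?thesis using real by (intro order_trans[OF ennreal_leI[of "y - d - g" s]]) auto
    next
      case top
      show ?thesis unfolding top by simp
    qed
    note IH = Suc.IH[OF h this d]
    have "eventually (\<lambda>t. g + tail_mean t h - d \<le> tail_mean t f) at_top"
      unfolding g_def h_def by (rule tail_mean_lower_step[OF Suc.prems(1) _ _ d]) auto
    with IH show ?thesis by eventually_elim (simp add: d_def)
  qed
qed

lemma integral_S_iter:
  fixes h :: "(nat \<Rightarrow> (real^'d^'d) \<times> (real^'d)) \<Rightarrow> real"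
  assumes [measurable]: "h \<in> borel_measurable \<S>" and h: "\<And>\<omega>. \<bar>h \<omega>\<bar> \<le> c"
  shows "(\<integral>\<omega>. h \<omega> \<partial>\<S>) = (\<integral>p. \<integral>\<omega>. h (case_nat p \<omega>) \<partial>\<S> \<partial>D)"
proof -
  interpret S: prob_space \<S> by (rule prob_space_S)
  interpret DS: pair_prob_space D \<S> ..
  have m: "(\<lambda>x. h (case_nat (fst x) (snd x))) \<in> borel_measurable (D \<Otimes>\<^sub>M \<S>)"
    using measurable_comp[OF iter_measurable assms(1)] by (simp add: comp_def case_prod_beta')
  have "(\<integral>\<omega>. h \<omega> \<partial>\<S>) = (\<integral>\<omega>. h \<omega> \<partial>distr (D \<Otimes>\<^sub>M \<S>) \<S> (\<lambda>(p, \<omega>). case_nat p \<omega>))"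
    unfolding S_iter ..
  also have "\<dots> = (\<integral>x. h (case_nat (fst x) (snd x)) \<partial>(D \<Otimes>\<^sub>M \<S>))"
    by (subst integral_distr) (auto simp: case_prod_beta')
  also have "\<dots> = (\<integral>p. \<integral>\<omega>. h (case_nat p \<omega>) \<partial>\<S> \<partial>D)"
    using DS.integral_fst'[of "\<lambda>x. h (case_nat (fst x) (snd x))"] DS.integrable_const_bound[OF _ m, of c] h by simp
  finally show ?thesis .
qed

text \<open>
  The function \<open>f\<close> lies below the average of the indicators of \<open>|r| > 1 /
  Z\<close> over a bounded random scale \<open>Z\<close>, and \<open>w\<close> bounds the
  corresponding moment. Realising \<open>Z\<close> as a function of the sequence of pairs lets
  an independent matrix norm be multiplied to it by prepending a pair.
\<close>

definition dominated :: "(real^'d \<Rightarrow> real) \<Rightarrow> real \<Rightarrow> bool" where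
  "dominated f w \<longleftrightarrow> (\<exists>c Z k. 0 \<le> c \<and> Z \<in> borel_measurable \<S> \<and> (\<forall>\<omega>. 0 \<le> Z \<omega> \<and> Z \<omega> \<le> k) \<and>
     (\<forall>r. f r \<le> c * measure \<S> {\<omega>. Z \<omega> * norm r > 1}) \<and> c * (\<integral>\<omega>. Z \<omega> powr \<alpha> \<partial>\<S>) \<le> w)"

lemma dominated_exists:
  assumes f: "tail_test f"
  shows "\<exists>w. dominated f w"
proof -
  interpret S: prob_space \<S> by (rule prob_space_S)
  obtain c \<delta> where c: "0 < c" "\<And>x. f x \<le> c" "0 < \<delta>" "\<And>x. norm x < \<delta> \<Longrightarrow> f x = 0"
    using tail_testD[OF f] by blast
  have "f r \<le> c * measure \<S> {\<omega>. 2 / \<delta> * norm r > 1}" for r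
  proof (cases "norm r < \<delta>")
    case True
    then show ?thesis using c by simp
  next
    case False
    then have "2 / \<delta> * norm r > 1" using c(3) by (simp add: field_simps)
    then show ?thesis using c(2)[of r] S.prob_space by simp
  qed
  then show ?thesis
    unfolding dominated_def using c
    by (intro exI[of _ "c * (\<integral>\<omega>. (2 / \<delta>) powr \<alpha> \<partial>\<S>)"] exI[of _ c] exI[of _ "\<lambda>_. 2 / \<delta>"] exI[of _ "2 / \<delta>"]) auto
qed

text \<open>
  By the tail bound, \<open>P(Z |R| > t)\<close> is at most \<open>C P(Z N > t)\<close> with
  \<open>Z\<close> and \<open>N\<close> independent, and Breiman's lemma gives the limit of this
  probability divided by \<open>F t\<close>.
\<close>

lemma dominated_upper:
  assumes f: "tail_test f" and dom: "dominated f w" and e: "e > 0"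
    and C: "C > 0" "\<And>t. t \<ge> 0 \<Longrightarrow> measure L {r. norm r > t} \<le> C * F t"
  shows "eventually (\<lambda>t. tail_mean t f \<le> C * w + e) at_top"
proof -
  interpret S: prob_space \<S> by (rule prob_space_S)
  interpret L: prob_space L by (rule prob_space_L)
  obtain c Z k where c: "0 \<le> c" and Z [measurable]: "Z \<in> borel_measurable \<S>" and Zk: "\<forall>\<omega>. 0 \<le> Z \<omega> \<and> Z \<omega> \<le> k"
    and fZ: "\<forall>r. f r \<le> c * measure \<S> {\<omega>. Z \<omega> * norm r > 1}" and w: "c * (\<integral>\<omega>. Z \<omega> powr \<alpha> \<partial>\<S>) \<le> w"
    using dom unfolding dominated_def by blast
  note [measurable] = tail_test_measurable[OF f]
  obtain c' where c': "0 < c'" "\<And>x. f x \<le> c'" using tail_test_bound[OF f] by blast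
  have lim: "((\<lambda>t. (\<integral>\<omega>. measure D {p. Z \<omega> * pair_norm p > t} \<partial>\<S>) / F t) \<longlongrightarrow> (\<integral>\<omega>. Z \<omega> powr \<alpha> \<partial>\<S>)) at_top"
    by (rule F_mixture[where k=k]) (use Zk S.finite_measure_axioms in auto)
  have "((\<lambda>t. c * (C * ((\<integral>\<omega>. measure D {p. Z \<omega> * pair_norm p > t} \<partial>\<S>) / F t))) \<longlongrightarrow> c * (C * (\<integral>\<omega>. Z \<omega> powr \<alpha> \<partial>\<S>))) at_top"
    by (intro tendsto_intros lim)
  moreover have "c * (C * (\<integral>\<omega>. Z \<omega> powr \<alpha> \<partial>\<S>)) < C * w + e"
  proof -
    have "C * (c * (\<integral>\<omega>. Z \<omega> powr \<alpha> \<partial>\<S>)) \<le> C * w" using w C(1) by (intro mult_left_mono) auto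
    then have "c * (C * (\<integral>\<omega>. Z \<omega> powr \<alpha> \<partial>\<S>)) \<le> C * w" by (simp only: mult.left_commute)
    then show ?thesis using e by linarith
  qed
  ultimately have "eventually (\<lambda>t. c * (C * ((\<integral>\<omega>. measure D {p. Z \<omega> * pair_norm p > t} \<partial>\<S>) / F t)) < C * w + e) at_top"
    by (rule order_tendstoD)
  then show ?thesis using eventually_gt_at_top[of 0]
  proof eventually_elim
    case (elim t)
    have mL [measurable]: "(\<lambda>\<omega>. measure L {r. Z \<omega> * norm r > t}) \<in> borel_measurable \<S>"
      using L.measurable_measure_Collect[where K=\<S> and P="\<lambda>\<omega> r. Z \<omega> * norm r > t"] by simp
    have mD [measurable]: "(\<lambda>\<omega>. measure D {r. Z \<omega> * pair_norm r > t}) \<in> borel_measurable \<S>"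
      by (rule cut_measurable) measurable
    have mS [measurable]: "(\<lambda>r. measure \<S> {\<omega>. Z \<omega> * norm r > t}) \<in> borel_measurable L"
      using S.measurable_measure_Collect[where K=L and P="\<lambda>r \<omega>. Z \<omega> * norm r > t"] by simp
    have nr: "{\<omega>. Z \<omega> * norm (r /\<^sub>R t) > 1} = {\<omega>. Z \<omega> * norm r > t}" for r :: "real^'d"
      using elim(2) by (auto simp: field_simps)
    have "(\<integral>r. f (r /\<^sub>R t) \<partial>L) \<le> (\<integral>r. c * measure \<S> {\<omega>. Z \<omega> * norm r > t} \<partial>L)"
    proof (rule integral_mono)
      show "integrable L (\<lambda>r. f (r /\<^sub>R t))"
        by (rule L.integrable_const_bound[where B=c']) (use c' tail_test_nonneg[OF f] in auto)
      show "integrable L (\<lambda>r. c * measure \<S> {\<omega>. Z \<omega> * norm r > t})"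
        by (intro integrable_mult_right L.integrable_const_bound[where B=1]) auto
      show "f (r /\<^sub>R t) \<le> c * measure \<S> {\<omega>. Z \<omega> * norm r > t}" for r
        using fZ[rule_format, of "r /\<^sub>R t"] unfolding nr .
    qed
    also have "\<dots> = c * (\<integral>r. measure \<S> {\<omega>. Z \<omega> * norm r > t} \<partial>L)" by simp
    also have "(\<integral>r. measure \<S> {\<omega>. Z \<omega> * norm r > t} \<partial>L) = (\<integral>\<omega>. measure L {r. Z \<omega> * norm r > t} \<partial>\<S>)"
      using measure_cut_swap[OF prob_space_L prob_space_S, of "\<lambda>r \<omega>. Z \<omega> * norm r > t"] by simp
    also have "\<dots> \<le> (\<integral>\<omega>. C * measure D {r. Z \<omega> * pair_norm r > t} \<partial>\<S>)"
    proof (rule integral_mono)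
      show "integrable \<S> (\<lambda>\<omega>. measure L {r. Z \<omega> * norm r > t})"
        by (rule S.integrable_const_bound[where B=1]) auto
      show "integrable \<S> (\<lambda>\<omega>. C * measure D {r. Z \<omega> * pair_norm r > t})"
        by (intro integrable_mult_right S.integrable_const_bound[where B=1]) auto
      show "measure L {r. Z \<omega> * norm r > t} \<le> C * measure D {r. Z \<omega> * pair_norm r > t}" for \<omega>
        using Zk elim(2) by (intro L_scaled_tail C) auto
    qed
    finally have "(\<integral>r. f (r /\<^sub>R t) \<partial>L) \<le> c * (C * (\<integral>\<omega>. measure D {r. Z \<omega> * pair_norm r > t} \<partial>\<S>))"
      using c by (simp add: mult_left_mono)
    then have "tail_mean t f \<le> c * (C * (\<integral>\<omega>. measure D {r. Z \<omega> * pair_norm r > t} \<partial>\<S>)) / F t"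
      unfolding tail_mean_def using F_pos[of t] by (intro divide_right_mono) auto
    then show ?case using elim(1) by simp
  qed
qed

text \<open>
  The contraction behind the geometric decay: \<open>|a r| \<le> |a| |r|\<close>, so the scale
  is multiplied by an independent factor that is at most \<open>|a|\<close>, and its moment of
  order \<open>\<alpha>\<close> by at most \<open>\<rho>\<close>.
\<close>

lemma dominated_trunc_op:
  assumes f: "tail_test f" and dom: "dominated f w" and K: "K > 0"
  shows "dominated (trunc_op K f) (\<rho> * w)"
proof -
  interpret S: prob_space \<S> by (rule prob_space_S)
  obtain c Z k where c: "0 \<le> c" and Z [measurable]: "Z \<in> borel_measurable \<S>" and Zk: "\<forall>\<omega>. 0 \<le> Z \<omega> \<and> Z \<omega> \<le> k"
    and fZ: "\<forall>r. f r \<le> c * measure \<S> {\<omega>. Z \<omega> * norm r > 1}" and w: "c * (\<integral>\<omega>. Z \<omega> powr \<alpha> \<partial>\<S>) \<le> w"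
    using dom unfolding dominated_def by blast
  note [measurable] = tail_test_measurable[OF f]
  obtain c' where c': "0 < c'" "\<And>x. f x \<le> c'" using tail_test_bound[OF f] by blast
  note nn = tail_test_nonneg[OF f]
  have k: "0 \<le> k" using Zk order_trans by blast
  define z where "z p = op_norm (fst p) * indicator {p. pair_norm p \<le> K} p" for p :: "(real^'d^'d) \<times> (real^'d)"
  have zm [measurable]: "z \<in> borel_measurable borel" unfolding z_def by measurable
  have z: "0 \<le> z p" "z p \<le> K" "z p \<le> op_norm (fst p)" for p
    using op_le_pair[of p] K by (auto simp: z_def indicator_def)
  define Z' where "Z' \<omega> = z (\<omega> 0) * Z (\<lambda>i. \<omega> (Suc i))" for \<omega>
  have Z'm [measurable]: "Z' \<in> borel_measurable \<S>" unfolding Z'_def using proj_measurable by measurable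
  have Z'_case: "Z' (case_nat p \<omega>) = z p * Z \<omega>" for p \<omega> by (simp add: Z'_def)
  have Z'b: "0 \<le> Z' \<omega>" "Z' \<omega> \<le> K * k" for \<omega>
    unfolding Z'_def using z(1)[of "\<omega> 0"] z(2)[of "\<omega> 0"] Zk K
    by (auto intro!: mult_mono mult_nonneg_nonneg simp del: split_paired_All)
  have meas: "measure \<S> {\<omega>. Z' \<omega> * norm r > 1} = (\<integral>p. measure \<S> {\<omega>. z p * Z \<omega> * norm r > 1} \<partial>D)" for r :: "real^'d"
  proof -
    have m: "{\<omega>. Z' \<omega> * norm r > 1} \<in> sets \<S>"
    proof -
      have "{\<omega> \<in> space \<S>. Z' \<omega> * norm r > 1} \<in> sets \<S>" by measurable
      then show ?thesis by simp
    qed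
    have "measure \<S> {\<omega>. Z' \<omega> * norm r > 1} = (\<integral>\<omega>. indicator {\<omega>. Z' \<omega> * norm r > 1} \<omega> \<partial>\<S>)" by simp
    also have "\<dots> = (\<integral>p. \<integral>\<omega>. indicator {\<omega>. Z' \<omega> * norm r > 1} (case_nat p \<omega>) \<partial>\<S> \<partial>D)"
      by (rule integral_S_iter[where c=1]) (use m in \<open>auto simp: indicator_def\<close>)
    also have "\<dots> = (\<integral>p. \<integral>\<omega>. indicator {\<omega>. z p * Z \<omega> * norm r > 1} \<omega> \<partial>\<S> \<partial>D)"
      by (simp add: indicator_def Z'_case)
    finally show ?thesis by simp
  qed
  have "trunc_op K f r \<le> c * measure \<S> {\<omega>. Z' \<omega> * norm r > 1}" for r
  proof -
    have [measurable]: "(\<lambda>p. measure \<S> {\<omega>. z p * Z \<omega> * norm r > 1}) \<in> borel_measurable D"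
      using S.measurable_measure_Collect[where K=D and P="\<lambda>p \<omega>. z p * Z \<omega> * norm r > 1"] by simp
    have "trunc_op K f r \<le> (\<integral>p. c * measure \<S> {\<omega>. z p * Z \<omega> * norm r > 1} \<partial>D)"
      unfolding trunc_op_def
    proof (rule integral_mono)
      show "integrable D (\<lambda>p. f (fst p *v r) * indicator {p. pair_norm p \<le> K} p)"
        by (rule integrable_indicator_bound[where c=c']) (use c' nn in auto)
      show "integrable D (\<lambda>p. c * measure \<S> {\<omega>. z p * Z \<omega> * norm r > 1})"
        by (intro integrable_mult_right integrable_const_bound[where B=1]) auto
      fix p
      show "f (fst p *v r) * indicator {p. pair_norm p \<le> K} p \<le> c * measure \<S> {\<omega>. z p * Z \<omega> * norm r > 1}"
      proof (cases "pair_norm p \<le> K")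
        case True
        have "f (fst p *v r) \<le> c * measure \<S> {\<omega>. Z \<omega> * norm (fst p *v r) > 1}" using fZ by blast
        also have "\<dots> \<le> c * measure \<S> {\<omega>. z p * Z \<omega> * norm r > 1}"
        proof (intro mult_left_mono S.finite_measure_mono Collect_mono impI c)
          fix \<omega> assume "1 < Z \<omega> * norm (fst p *v r)"
          also have "\<dots> \<le> Z \<omega> * (op_norm (fst p) * norm r)"
            using Zk by (intro mult_left_mono norm_mult_le_op_norm) auto
          finally show "1 < z p * Z \<omega> * norm r" using True by (simp add: z_def mult_ac)
        next
          have "{\<omega> \<in> space \<S>. z p * Z \<omega> * norm r > 1} \<in> sets \<S>" by measurable
          then show "{\<omega>. z p * Z \<omega> * norm r > 1} \<in> sets \<S>" by simp
        qed
        finally show ?thesis using True by simp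
      next
        case False
        then show ?thesis using c by simp
      qed
    qed
    then show ?thesis by (simp add: meas)
  qed
  moreover have "c * (\<integral>\<omega>. Z' \<omega> powr \<alpha> \<partial>\<S>) \<le> \<rho> * w"
  proof -
    have "(\<integral>\<omega>. Z' \<omega> powr \<alpha> \<partial>\<S>) = (\<integral>p. \<integral>\<omega>. (z p * Z \<omega>) powr \<alpha> \<partial>\<S> \<partial>D)"
      using Z'b alpha_pos powr_mono2[of \<alpha> _ "K * k"]
      by (subst integral_S_iter[where c="(K * k) powr \<alpha>"]) (auto simp: Z'_case)
    also have "\<dots> = (\<integral>p. z p powr \<alpha> \<partial>D) * (\<integral>\<omega>. Z \<omega> powr \<alpha> \<partial>\<S>)"
      using z Zk by (simp add: powr_mult)
    also have "\<dots> \<le> \<rho> * (\<integral>\<omega>. Z \<omega> powr \<alpha> \<partial>\<S>)"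
      unfolding \<rho>_def using z alpha_pos
      by (intro mult_right_mono integral_mono' integrable_moment) (auto intro!: powr_mono2 integral_nonneg_AE)
    finally have "c * (\<integral>\<omega>. Z' \<omega> powr \<alpha> \<partial>\<S>) \<le> c * (\<rho> * (\<integral>\<omega>. Z \<omega> powr \<alpha> \<partial>\<S>))" using c by (rule mult_left_mono)
    also have "\<dots> = \<rho> * (c * (\<integral>\<omega>. Z \<omega> powr \<alpha> \<partial>\<S>))" by simp
    also have "\<dots> \<le> \<rho> * w" using w rho by (intro mult_left_mono)
    finally show ?thesis .
  qed
  ultimately show ?thesis
    unfolding dominated_def using c Z'm Z'b
    by (intro exI[of _ c] exI[of _ Z'] exI[of _ "K * k"]) auto
qed

text \<open>
  Each application of \<open>tail_mean_upper_step\<close> brings out one summand and passes to a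
  truncated average of the test function, which is dominated with a weight smaller by the factor
  \<open>\<rho>\<close>. The truncations differ from step to step and may stay, since they only
  decrease the summands.
\<close>

lemma tail_mean_upper_bound:
  assumes C: "C > 0" "\<And>t. t \<ge> 0 \<Longrightarrow> measure L {r. norm r > t} \<le> C * F t"
    and "tail_test f" "dominated f w" "e > 0"
  shows "eventually (\<lambda>t. ennreal (tail_mean t f) \<le> (\<Sum>n<N. contrib n f) + ennreal (C * (w * \<rho> ^ N) + e)) at_top"
  using assms(3-)
proof (induction N arbitrary: f w e)
  case 0
  have "eventually (\<lambda>t. tail_mean t f \<le> C * w + e) at_top"
    by (rule dominated_upper[OF 0]) (use C in auto)
  then show ?case by eventually_elim (auto intro: ennreal_leI)
next
  case (Suc N)
  have e2: "e / 2 > 0" using Suc.prems by simp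
  obtain m \<kappa> where m: "m > 0" and \<kappa>: "\<kappa> > 0"
    and step: "eventually (\<lambda>t. tail_mean t f \<le> shock_part \<kappa> f + tail_mean t (trunc_op m f) + e / 2) at_top"
    using tail_mean_upper_step[OF Suc.prems(1) e2] by blast
  note h = trunc_op_tail_test[OF Suc.prems(1) m]
  from step Suc.IH[OF h dominated_trunc_op[OF Suc.prems(1,2) m] e2]
  show ?case
  proof eventually_elim
    case (elim t)
    define W where "W = C * (w * \<rho> ^ Suc N)"
    have "ennreal (tail_mean t f) \<le> ennreal (shock_part \<kappa> f + tail_mean t (trunc_op m f) + e / 2)"
      using elim(1) by (rule ennreal_leI)
    also have "\<dots> = ennreal (shock_part \<kappa> f) + ennreal (tail_mean t (trunc_op m f)) + ennreal (e / 2)"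
      using shock_part_nonneg[OF Suc.prems(1)] tail_mean_nonneg[OF h] e2 by simp
    also have "\<dots> \<le> contrib 0 f + ((\<Sum>n<N. contrib (Suc n) f) + ennreal (W + e / 2)) + ennreal (e / 2)"
    proof (intro add_mono order_refl shock_part_le_contrib Suc.prems \<kappa>)
      have "ennreal (tail_mean t (trunc_op m f)) \<le> (\<Sum>n<N. contrib n (trunc_op m f)) + ennreal (W + e / 2)"
        using elim(2) by (simp add: W_def mult_ac)
      also have "\<dots> \<le> (\<Sum>n<N. contrib (Suc n) f) + ennreal (W + e / 2)"
        by (intro add_mono sum_mono order_refl contrib_trunc_op_le Suc.prems m)
      finally show "ennreal (tail_mean t (trunc_op m f)) \<le> (\<Sum>n<N. contrib (Suc n) f) + ennreal (W + e / 2)" .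
    qed
    also have "\<dots> = (\<Sum>n<Suc N. contrib n f) + (ennreal (W + e / 2) + ennreal (e / 2))"
      by (simp only: sum.lessThan_Suc_shift add.assoc)
    also have "ennreal (W + e / 2) + ennreal (e / 2) = ennreal (W + e)"
    proof -
      have "0 \<le> w"
      proof -
        obtain c Z k where "0 \<le> c" and w: "c * (\<integral>\<omega>. Z \<omega> powr \<alpha> \<partial>\<S>) \<le> w"
          using Suc.prems(2) unfolding dominated_def by blast
        then have "0 \<le> c * (\<integral>\<omega>. Z \<omega> powr \<alpha> \<partial>\<S>)" by (intro mult_nonneg_nonneg integral_nonneg_AE) auto
        then show ?thesis using w by linarith
      qed
      then have "0 \<le> W" using C(1) rho by (simp add: W_def)
      then show ?thesis using e2 by (simp add: ennreal_plus[symmetric] del: ennreal_plus)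
    qed
    finally show ?case by (simp add: W_def)
  qed
qed

text \<open>
  The lower bounds exhaust the series and the upper bounds exceed its partial sums by a
  remainder of order \<open>\<rho> ^ N\<close>. The series is finite because the means
  themselves stay bounded.
\<close>

theorem tail_mean_limit:
  assumes f: "tail_test f"
  shows "(\<Sum>n. contrib n f) < \<infinity>"
    and "((\<lambda>t. ennreal (tail_mean t f)) \<longlongrightarrow> (\<Sum>n. contrib n f)) at_top"
proof -
  obtain C where C: "C > 0" "\<And>t. t \<ge> 0 \<Longrightarrow> measure L {r. norm r > t} \<le> C * F t" using L_tail by blast
  obtain w where w: "dominated f w" using dominated_exists[OF f] by blast
  have bound: "(\<Sum>n<N. contrib n f) \<le> ennreal (C * w + 2)" for N
  proof (rule ccontr)
    assume "\<not> ?thesis"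
    then have gt: "ennreal (C * w + 2) < (\<Sum>n<N. contrib n f)" by simp
    obtain y where y: "C * w + 2 < y" "ennreal y \<le> (\<Sum>n<N. contrib n f)"
    proof (cases "(\<Sum>n<N. contrib n f)")
      case (real s)
      then have "C * w + 2 < s" using gt by (metis ennreal_leI not_less)
      then show ?thesis using that[of s] real by simp
    next
      case top
      show ?thesis using that[of "C * w + 3"] unfolding top by simp
    qed
    have "eventually (\<lambda>t. y \<le> tail_mean t f + 1 \<and> tail_mean t f \<le> C * w + 1) at_top"
      by (intro eventually_conj tail_mean_lower_bound[OF f y(2)] dominated_upper[OF f w _ C]) auto
    then obtain t where "y \<le> tail_mean t f + 1" "tail_mean t f \<le> C * w + 1"
      by (auto simp: eventually_at_top_linorder)
    then show False using y(1) by simp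
  qed
  have lim: "(\<lambda>N. \<Sum>n<N. contrib n f) \<longlonglongrightarrow> (\<Sum>n. contrib n f)"
    by (rule summable_LIMSEQ) simp
  have "(\<Sum>n. contrib n f) \<le> ennreal (C * w + 2)"
    using bound by (intro LIMSEQ_le_const2[OF lim]) auto
  then show fin: "(\<Sum>n. contrib n f) < \<infinity>" by (simp add: le_less_trans)
  obtain s where s: "0 \<le> s" "(\<Sum>n. contrib n f) = ennreal s"
    using fin by (cases "\<Sum>n. contrib n f") auto
  have part: "(\<Sum>n<N. contrib n f) \<le> ennreal s" for N
    unfolding s(2)[symmetric] by (rule sum_le_suminf) auto
  have "((\<lambda>t. tail_mean t f) \<longlongrightarrow> s) at_top"
  proof (rule tendstoI)
    fix e :: real assume e: "e > 0"
    define d where "d = e / 3"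
    have d: "d > 0" using e by (simp add: d_def)
    have low: "eventually (\<lambda>t. s - d \<le> tail_mean t f + d) at_top"
    proof (cases "s \<le> d")
      case True
      show ?thesis
      proof (intro always_eventually allI)
        show "s - d \<le> tail_mean t f + d" for t
          using tail_mean_nonneg[OF f, of t] True d by linarith
      qed
    next
      case False
      then have "ennreal (s - d) < ennreal s" using d by (simp add: ennreal_less_iff)
      then obtain N where "ennreal (s - d) < (\<Sum>n<N. contrib n f)"
        using order_tendstoD(1)[OF lim] eventually_happens'[OF sequentially_bot] unfolding s(2) by blast
      then show ?thesis by (intro tail_mean_lower_bound[OF f _ d, of _ N]) (rule less_imp_le)
    qed
    have "(\<lambda>N. C * (w * \<rho> ^ N)) \<longlonglongrightarrow> C * (w * 0)"
      using rho by (intro tendsto_intros LIMSEQ_realpow_zero) auto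
    then obtain N where N: "C * (w * \<rho> ^ N) < d"
      using order_tendstoD(2)[of _ "C * (w * 0)" sequentially d] d eventually_happens'[OF sequentially_bot] by fastforce
    have "eventually (\<lambda>t. ennreal (tail_mean t f) \<le> (\<Sum>n<N. contrib n f) + ennreal (C * (w * \<rho> ^ N) + d)) at_top"
      by (rule tail_mean_upper_bound[OF _ _ f w d]) (use C in auto)
    then have up: "eventually (\<lambda>t. tail_mean t f \<le> s + 2 * d) at_top"
    proof eventually_elim
      case (elim t)
      also have "(\<Sum>n<N. contrib n f) + ennreal (C * (w * \<rho> ^ N) + d) \<le> ennreal s + ennreal (2 * d)"
        using N by (intro add_mono part ennreal_leI) auto
      also have "\<dots> = ennreal (s + 2 * d)" using s d by simp
      finally show ?case using s d by (subst (asm) ennreal_le_iff) auto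
    qed
    from low up show "eventually (\<lambda>t. dist (tail_mean t f) s < e) at_top"
      by eventually_elim (use e in \<open>simp add: d_def dist_real_def\<close>)
  qed
  then show "((\<lambda>t. ennreal (tail_mean t f)) \<longlongrightarrow> (\<Sum>n. contrib n f)) at_top"
    unfolding s(2) by (rule tendsto_ennrealI)
qed

end

section \<open>From convergence of the tail to regular variation\<close>

text \<open>
  The test functions include ramps of the norm, which by homogeneity of \<open>\<nu>\<close>
  squeeze \<open>P(|R| > t) / G t\<close> to the \<open>\<nu>\<close>-mass \<open>c\<close> of
  \<open>|r| > 1\<close>. Dividing by this limit changes the normalisation from \<open>G
  t\<close> to \<open>P(|R| > t)\<close>. The mass \<open>c\<close> is positive since otherwise
  homogeneity would make \<open>\<nu>\<close> null, and finite since it is bounded by the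
  integral of a ramp.
\<close>

lemma regularly_varying_of_tail_limit:
  fixes R :: "'w \<Rightarrow> 'a::euclidean_space" and G :: "real \<Rightarrow> real"
  assumes "prob_space M" and R [measurable]: "R \<in> borel_measurable M" and alpha: "\<alpha> > 0"
    and sets: "sets \<nu> = sets borel_punctured" and G: "\<And>t. G t > 0"
    and fin: "\<And>f. tail_test f \<Longrightarrow> (\<integral>\<^sup>+x. ennreal (f x) \<partial>\<nu>) < \<infinity>"
    and lim: "\<And>f. tail_test f \<Longrightarrow>
      ((\<lambda>t. ennreal (1 / G t) * (\<integral>\<^sup>+\<omega>. ennreal (f (R \<omega> /\<^sub>R t)) \<partial>M)) \<longlongrightarrow> (\<integral>\<^sup>+x. ennreal (f x) \<partial>\<nu>)) at_top"
    and scale: "\<And>t S. t > 0 \<Longrightarrow> S \<in> sets \<nu> \<Longrightarrow> emeasure \<nu> ((\<lambda>x. t *\<^sub>R x) ` S) = ennreal (t powr - \<alpha>) * emeasure \<nu> S"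
    and nonnull: "emeasure \<nu> (- {0}) \<noteq> 0"
  shows "regularly_varying norm M R \<alpha> (scale_measure (1 / emeasure \<nu> {r. norm r > 1}) \<nu>)"
proof -
  interpret prob_space M by fact
  have space: "space \<nu> = - {0}" by (rule space_punctured[OF sets])
  have gt_sets: "{x::'a. norm x > s} \<in> sets \<nu>" if "s \<ge> 0" for s
    unfolding sets using that by (intro sets_puncturedI) auto
  have tt: "tail_test (\<lambda>x::'a. ramp a b (norm x))" if ab: "0 < a" "a < b" for a b
  proof -
    have "uniformly_continuous_on UNIV (\<lambda>x::'a. ramp a b (norm x))"
    proof -
      have "(1 / (b - a))-lipschitz_on UNIV (\<lambda>x::'a. ramp a b (norm x))"
      proof (rule lipschitz_onI)
        fix x y :: 'a
        have "\<bar>ramp a b (norm x) - ramp a b (norm y)\<bar> \<le> \<bar>(norm x - a) / (b - a) - (norm y - a) / (b - a)\<bar>"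
          unfolding ramp_def by linarith
        also have "\<dots> = \<bar>norm x - norm y\<bar> / (b - a)"
          using ab by (simp add: diff_divide_distrib[symmetric])
        also have "\<dots> \<le> norm (x - y) / (b - a)"
          using ab norm_triangle_ineq3 by (intro divide_right_mono) auto
        finally show "dist (ramp a b (norm x)) (ramp a b (norm y)) \<le> 1 / (b - a) * dist x y"
          by (simp add: dist_real_def dist_norm)
      qed (use ab in auto)
      then show ?thesis by (rule lipschitz_on_uniformly_continuous)
    qed
    moreover have "\<exists>c. \<forall>x::'a. ramp a b (norm x) \<le> c" by (rule exI[of _ 1]) simp
    moreover have "\<exists>\<delta>>0. \<forall>x::'a. norm x < \<delta> \<longrightarrow> ramp a b (norm x) = 0"
      using ab by (intro exI[of _ a]) (simp add: ramp_eq_0)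
    ultimately show ?thesis by (simp add: tail_test_def)
  qed
  have ind_le: "indicator {x. norm x > b} x \<le> ennreal (ramp a b (norm x))" if "a < b" for a b and x :: 'a
    using that by (auto simp: indicator_def ramp_eq_1)
  have le_ind: "ennreal (ramp a b (norm x)) \<le> indicator {x. norm x > a} x" if "a < b" for a b and x :: 'a
    using that by (auto simp: indicator_def ramp_eq_0)
  have upper: "emeasure \<nu> {x. norm x > b} \<le> (\<integral>\<^sup>+x. ennreal (ramp a b (norm x)) \<partial>\<nu>)" if "0 < a" "a < b" for a b
  proof -
    have "emeasure \<nu> {x. norm x > b} = (\<integral>\<^sup>+x. indicator {x. norm x > b} x \<partial>\<nu>)"
      using that gt_sets[of b] by simp
    also have "\<dots> \<le> (\<integral>\<^sup>+x. ennreal (ramp a b (norm x)) \<partial>\<nu>)" by (intro nn_integral_mono ind_le that)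
    finally show ?thesis .
  qed
  have lower: "(\<integral>\<^sup>+x. ennreal (ramp a b (norm x)) \<partial>\<nu>) \<le> emeasure \<nu> {x. norm x > a}" if "0 < a" "a < b" for a b
  proof -
    have "(\<integral>\<^sup>+x. ennreal (ramp a b (norm x)) \<partial>\<nu>) \<le> (\<integral>\<^sup>+x. indicator {x. norm x > a} x \<partial>\<nu>)"
      by (intro nn_integral_mono le_ind that)
    also have "\<dots> = emeasure \<nu> {x. norm x > a}" using that gt_sets[of a] by simp
    finally show ?thesis .
  qed
  define c where "c = measure \<nu> {x. norm x > 1}"
  have tail: "emeasure \<nu> {x. norm x > s} = ennreal (s powr - \<alpha>) * emeasure \<nu> {x. norm x > 1}" if s: "s > 0" for s
  proof -
    have "{x::'a. norm x > s} = (\<lambda>x. s *\<^sub>R x) ` {x. norm x > 1}"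
    proof (intro set_eqI iffI)
      fix x :: 'a assume "x \<in> {x. norm x > s}"
      then show "x \<in> (\<lambda>x. s *\<^sub>R x) ` {x. norm x > 1}"
        using s by (intro image_eqI[of _ _ "x /\<^sub>R s"]) (auto simp: field_simps)
    qed (use s in \<open>auto simp: field_simps\<close>)
    then show ?thesis using scale[OF s gt_sets[of 1]] by simp
  qed
  have fin1: "emeasure \<nu> {x. norm x > 1} < \<infinity>"
    using upper[of "1/2" 1] fin[OF tt[of "1/2" 1]] by (simp add: le_less_trans)
  then have c_eq: "emeasure \<nu> {x. norm x > 1} = ennreal c"
    by (simp add: c_def emeasure_eq_ennreal_measure)
  have c: "c > 0"
  proof (rule ccontr)
    assume "\<not> c > 0"
    then have null: "emeasure \<nu> {x. norm x > 1} = 0" using c_eq by (simp add: ennreal_eq_0_iff)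
    have "{x. norm x > 1 / Suc n} \<in> null_sets \<nu>" for n
      using tail[of "1 / Suc n"] gt_sets[of "1 / Suc n"] null by (simp add: null_sets_def)
    then have "(\<Union>n::nat. {x. norm x > 1 / Suc n}) \<in> null_sets \<nu>" by (rule null_sets_UN)
    moreover have "(\<Union>n::nat. {x::'a. norm x > 1 / Suc n}) = - {0}"
    proof (intro set_eqI iffI)
      fix x :: 'a assume "x \<in> - {0}"
      then obtain n where "inverse (real (Suc n)) < norm x" using reals_Archimedean[of "norm x"] by auto
      then show "x \<in> (\<Union>n::nat. {x::'a. norm x > 1 / Suc n})" by (auto simp: inverse_eq_divide)
    next
      fix x :: 'a assume "x \<in> (\<Union>n::nat. {x::'a. norm x > 1 / Suc n})"
      then obtain n :: nat where "norm x > 1 / Suc n" by blast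
      moreover have "0 < 1 / real (Suc n)" by simp
      ultimately show "x \<in> - {0}" by auto
    qed
    ultimately show False using nonnull by (simp add: null_sets_def)
  qed
  have tail': "emeasure \<nu> {x. norm x > s} = ennreal (s powr - \<alpha> * c)" if "s > 0" for s
    using tail[OF that] c_eq by (simp add: ennreal_mult')
  define q where "q t = measure M {\<omega> \<in> space M. norm (R \<omega>) > t} / G t" for t
  have q_nonneg: "0 \<le> q t" for t using G[of t] by (simp add: q_def less_imp_le)
  have q_int: "ennreal (q t) = ennreal (1 / G t) * (\<integral>\<^sup>+\<omega>. indicator {x. norm x > 1} (R \<omega> /\<^sub>R t) \<partial>M)" if t: "t > 0" for t
  proof -
    have "(\<integral>\<^sup>+\<omega>. indicator {x. norm x > 1} (R \<omega> /\<^sub>R t) \<partial>M) = (\<integral>\<^sup>+\<omega>. indicator {\<omega> \<in> space M. norm (R \<omega>) > t} \<omega> \<partial>M)"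
      using t by (intro nn_integral_cong) (auto simp: indicator_def field_simps)
    also have "\<dots> = ennreal (measure M {\<omega> \<in> space M. norm (R \<omega>) > t})"
      by (simp add: emeasure_eq_measure)
    finally show ?thesis using G[of t] by (simp add: q_def ennreal_mult'[symmetric])
  qed
  have qlim: "(q \<longlongrightarrow> c) at_top"
  proof (rule order_tendstoI)
    fix y assume y: "y < c"
    show "eventually (\<lambda>t. y < q t) at_top"
    proof (cases "y < 0")
      case True
      then show ?thesis using q_nonneg less_le_trans by (intro always_eventually) blast
    next
      case False
      have lim0: "((\<lambda>e. (1 + e) powr - \<alpha> * c) \<longlongrightarrow> (1 + 0) powr - \<alpha> * c) (at_right 0)"
        by (intro tendsto_intros) auto
      have "eventually (\<lambda>e. y < (1 + e) powr - \<alpha> * c \<and> 0 < e) (at_right 0)"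
        using order_tendstoD(1)[OF lim0, of y] y by (intro eventually_conj eventually_at_right_less) simp
      then obtain e where e: "y < (1 + e) powr - \<alpha> * c" "0 < e"
        using eventually_happens[of _ "at_right (0::real)"] by auto
      have ord: "0 < (1::real)" "1 < 1 + e" using e by auto
      have "ennreal y < emeasure \<nu> {x. norm x > 1 + e}"
        using e False by (simp add: tail' ennreal_less_iff)
      then have "ennreal y < (\<integral>\<^sup>+x. ennreal (ramp 1 (1 + e) (norm x)) \<partial>\<nu>)"
        using upper[OF ord] by (rule less_le_trans)
      from order_tendstoD(1)[OF lim[OF tt[OF ord]] this] eventually_gt_at_top[of 0]
      show ?thesis
      proof eventually_elim
        case (elim t)
        note elim(1)
        also have "ennreal (1 / G t) * (\<integral>\<^sup>+\<omega>. ennreal (ramp 1 (1 + e) (norm (R \<omega> /\<^sub>R t))) \<partial>M) \<le> ennreal (q t)"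
          unfolding q_int[OF elim(2)] by (intro mult_left_mono nn_integral_mono le_ind ord) auto
        finally show ?case using False by (simp add: ennreal_less_iff)
      qed
    qed
  next
    fix y assume y: "c < y"
    have lim0: "((\<lambda>e. (1 - e) powr - \<alpha> * c) \<longlongrightarrow> (1 - 0) powr - \<alpha> * c) (at_right 0)"
      by (intro tendsto_intros) auto
    have "eventually (\<lambda>e. (1 - e) powr - \<alpha> * c < y \<and> 0 < e \<and> e < 1) (at_right (0::real))"
      using order_tendstoD(2)[OF lim0, of y] y order_tendstoD(2)[OF tendsto_ident_at[of "0::real" "{0<..}"], of 1]
      by (intro eventually_conj eventually_at_right_less) auto
    then obtain e where e: "(1 - e) powr - \<alpha> * c < y" "0 < e" "e < 1"
      using eventually_happens[of _ "at_right (0::real)"] by auto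
    have ord: "0 < 1 - e" "1 - e < 1" using e by auto
    have "emeasure \<nu> {x. norm x > 1 - e} < ennreal y"
      using e c y by (simp add: tail' ennreal_less_iff)
    then have "(\<integral>\<^sup>+x. ennreal (ramp (1 - e) 1 (norm x)) \<partial>\<nu>) < ennreal y"
      using lower[OF ord] by (rule le_less_trans[rotated])
    from order_tendstoD(2)[OF lim[OF tt[OF ord]] this] eventually_gt_at_top[of 0]
    show "eventually (\<lambda>t. q t < y) at_top"
    proof eventually_elim
      case (elim t)
      have "ennreal (q t) \<le> ennreal (1 / G t) * (\<integral>\<^sup>+\<omega>. ennreal (ramp (1 - e) 1 (norm (R \<omega> /\<^sub>R t))) \<partial>M)"
        unfolding q_int[OF elim(2)] by (intro mult_left_mono nn_integral_mono ind_le ord) auto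
      also note elim(1)
      finally show ?case using q_nonneg[of t] by (simp add: ennreal_less_iff)
    qed
  qed
  have r: "1 / emeasure \<nu> {r. norm r > 1} = ennreal (1 / c)"
    using c by (simp add: c_eq divide_ennreal[symmetric])
  let ?\<nu>' = "scale_measure (ennreal (1 / c)) \<nu>"
  have "regularly_varying norm M R \<alpha> ?\<nu>'"
    unfolding regularly_varying_def
  proof (intro conjI alpha R allI impI ballI)
    show "radon_punctured ?\<nu>'"
      unfolding radon_punctured_def
    proof (intro conjI allI impI)
      show "sets ?\<nu>' = sets borel_punctured" by (simp add: sets)
      fix K :: "'a set" assume K: "compact K \<and> 0 \<notin> K"
      then obtain d where d: "d > 0" "\<forall>x\<in>K. d \<le> dist 0 x"
        using separate_point_closed[OF compact_imp_closed, of K 0] by auto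
      have "K \<subseteq> {x. norm x > d / 2}"
      proof
        fix x assume "x \<in> K"
        then have "d \<le> norm x" using d(2) by auto
        then show "x \<in> {x. norm x > d / 2}" using d(1) by simp
      qed
      then have "emeasure \<nu> K \<le> emeasure \<nu> {x. norm x > d / 2}"
        using d(1) by (intro emeasure_mono gt_sets) simp_all
      also have "\<dots> < \<infinity>" using d(1) by (subst tail') auto
      finally show "emeasure ?\<nu>' K < \<infinity>" by (simp add: ennreal_mult_less_top)
    qed
    show "emeasure ?\<nu>' (- {0}) \<noteq> 0" using nonnull c by simp
    show "vague_limit (scaled_law M R (\<lambda>\<omega>. norm (R \<omega>))) ?\<nu>'"
      unfolding vague_limit_def
    proof (intro allI impI)
      fix f :: "'a \<Rightarrow> real" assume f: "punctured_test_function f"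
      define g where "g x = (if x = 0 then 0 else f x)" for x
      have gt: "tail_test g" using tail_test_punctured_test[OF f] by (simp add: g_def[abs_def])
      have [measurable]: "g \<in> borel_measurable borel"
        using gt by (auto simp: tail_test_def intro!: borel_measurable_continuous_onI uniformly_continuous_imp_continuous)
      have I: "(\<integral>\<^sup>+x. ennreal (f x) \<partial>scaled_law M R (\<lambda>\<omega>. norm (R \<omega>)) t) =
         ennreal (1 / measure M {\<omega> \<in> space M. norm (R \<omega>) > t}) * (\<integral>\<^sup>+\<omega>. ennreal (g (R \<omega> /\<^sub>R t)) \<partial>M)" for t
        unfolding g_def by (rule nn_integral_scaled_law_punctured[OF f R])
      have J: "(\<integral>\<^sup>+x. ennreal (f x) \<partial>?\<nu>') = ennreal (1 / c) * (\<integral>\<^sup>+x. ennreal (g x) \<partial>\<nu>)"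
      proof -
        have "g \<in> borel_measurable \<nu>"
          using measurable_compose[OF measurable_ident_punctured[OF sets] \<open>g \<in> borel_measurable borel\<close>] by simp
        moreover have "(\<integral>\<^sup>+x. ennreal (f x) \<partial>?\<nu>') = (\<integral>\<^sup>+x. ennreal (g x) \<partial>?\<nu>')"
          unfolding g_def by (rule nn_integral_punctured_cong) (simp add: sets)
        ultimately show ?thesis by (simp add: nn_integral_scale_measure)
      qed
      have "((\<lambda>t. ennreal (1 / q t) * (ennreal (1 / G t) * (\<integral>\<^sup>+\<omega>. ennreal (g (R \<omega> /\<^sub>R t)) \<partial>M))) \<longlongrightarrow>
        ennreal (1 / c) * (\<integral>\<^sup>+x. ennreal (g x) \<partial>\<nu>)) at_top"
      proof (rule tendsto_mult_ennreal)
        show "((\<lambda>t. ennreal (1 / q t)) \<longlongrightarrow> ennreal (1 / c)) at_top"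
          using c by (intro tendsto_ennrealI tendsto_divide tendsto_const qlim) auto
        show "\<not> (ennreal (1 / c) = 0 \<and> (\<integral>\<^sup>+x. ennreal (g x) \<partial>\<nu>) = \<infinity> \<or> ennreal (1 / c) = \<infinity> \<and> (\<integral>\<^sup>+x. ennreal (g x) \<partial>\<nu>) = 0)"
          using fin[OF gt] by auto
      qed (rule lim[OF gt])
      moreover have "eventually (\<lambda>t. ennreal (1 / q t) * (ennreal (1 / G t) * (\<integral>\<^sup>+\<omega>. ennreal (g (R \<omega> /\<^sub>R t)) \<partial>M)) =
        ennreal (1 / measure M {\<omega> \<in> space M. norm (R \<omega>) > t}) * (\<integral>\<^sup>+\<omega>. ennreal (g (R \<omega> /\<^sub>R t)) \<partial>M)) at_top"
        using order_tendstoD(1)[OF qlim c]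
      proof eventually_elim
        case (elim t)
        have "ennreal (1 / q t) * ennreal (1 / G t) = ennreal (1 / q t * (1 / G t))"
          using elim G[of t] by (intro ennreal_mult[symmetric]) auto
        also have "1 / q t * (1 / G t) = 1 / measure M {\<omega> \<in> space M. norm (R \<omega>) > t}"
          using elim G[of t] by (simp add: q_def)
        finally show ?case by (simp add: mult.assoc[symmetric])
      qed
      ultimately show "((\<lambda>t. \<integral>\<^sup>+x. ennreal (f x) \<partial>scaled_law M R (\<lambda>\<omega>. norm (R \<omega>)) t) \<longlongrightarrow> (\<integral>\<^sup>+x. ennreal (f x) \<partial>?\<nu>')) at_top"
        unfolding I J by (rule Lim_transform_eventually)
    qed
    fix t :: real and S assume "t > 0" "S \<in> sets ?\<nu>'"
    then show "emeasure ?\<nu>' ((\<lambda>x. t *\<^sub>R x) ` S) = ennreal (t powr - \<alpha>) * emeasure ?\<nu>' S"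
      using scale[of t S] by (simp add: mult_ac)
  qed
  then show ?thesis unfolding r .
qed


section \<open>Independent sequences\<close>

lemma iid_sequence_law:
  fixes X :: "nat \<Rightarrow> 'w \<Rightarrow> 'b::topological_space"
  assumes "prob_space M" and indep: "prob_space.indep_vars M (\<lambda>_. borel) X {1..}"
    and ident: "\<And>i. i \<ge> 1 \<Longrightarrow> distr M borel (X i) = D"
  shows "distr M (PiM UNIV (\<lambda>_. D)) (\<lambda>\<omega> n. X (Suc n) \<omega>) = PiM UNIV (\<lambda>_. D)"
    and "(\<lambda>\<omega> n. X (Suc n) \<omega>) \<in> measurable M (PiM UNIV (\<lambda>_. D))"
proof -
  interpret prob_space M by fact
  have rv: "X i \<in> measurable M borel" if "i \<ge> 1" for i
    using indep that unfolding indep_vars_def by auto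
  have sD: "sets D = sets borel" using ident[of 1] by (metis order_refl sets_distr)
  have pD: "prob_space D" using ident[of 1] prob_space_distr[OF rv[of 1]] by simp
  have rvD: "X i \<in> measurable M D" if "i \<ge> 1" for i
    using rv[OF that] by (simp add: measurable_cong_sets[OF refl sD])
  have "distr M (PiM {1..} (\<lambda>_. borel)) (\<lambda>x. \<lambda>i\<in>{1..}. X i x) = PiM {1..} (\<lambda>i. distr M borel (X i))"
    using indep by (subst indep_vars_iff_distr_eq_PiM'[symmetric]) (auto intro: rv)
  also have "\<dots> = PiM {1..} (\<lambda>_. D)" by (intro PiM_cong) (auto simp: ident)
  finally have 1: "distr M (PiM {1..} (\<lambda>_. D)) (\<lambda>x. \<lambda>i\<in>{1..}. X i x) = PiM {1..} (\<lambda>_. D)"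
    by (subst distr_cong[OF refl sets_PiM_cong[OF refl sD] refl]) auto
  have 2: "distr (PiM {1..} (\<lambda>_. D)) (PiM UNIV (\<lambda>_. D)) (\<lambda>\<omega>. \<lambda>n\<in>UNIV. \<omega> (Suc n)) = PiM UNIV (\<lambda>_. D)"
    using distr_PiM_reindex[of "{1..}" "\<lambda>_. D" Suc UNIV] pD by auto
  have m1: "(\<lambda>x. \<lambda>i\<in>{1..}. X i x) \<in> measurable M (PiM {1..} (\<lambda>_. D))"
    by (rule measurable_restrict) (auto intro: rvD)
  have m2: "(\<lambda>\<omega>. \<lambda>n\<in>UNIV. \<omega> (Suc n)) \<in> measurable (PiM {1..} (\<lambda>_. D)) (PiM UNIV (\<lambda>_. D))"
    by (rule measurable_restrict) (auto intro: measurable_component_singleton)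
  have "PiM UNIV (\<lambda>_. D) = distr (distr M (PiM {1..} (\<lambda>_. D)) (\<lambda>x. \<lambda>i\<in>{1..}. X i x)) (PiM UNIV (\<lambda>_. D)) (\<lambda>\<omega>. \<lambda>n\<in>UNIV. \<omega> (Suc n))"
    unfolding 1 2 ..
  also have "\<dots> = distr M (PiM UNIV (\<lambda>_. D)) (\<lambda>\<omega> n. X (Suc n) \<omega>)"
    by (subst distr_distr[OF m2 m1]) (simp add: comp_def restrict_def)
  finally show "distr M (PiM UNIV (\<lambda>_. D)) (\<lambda>\<omega> n. X (Suc n) \<omega>) = PiM UNIV (\<lambda>_. D)" ..
  show "(\<lambda>\<omega> n. X (Suc n) \<omega>) \<in> measurable M (PiM UNIV (\<lambda>_. D))"
    using measurable_comp[OF m1 m2] by (simp add: comp_def restrict_def)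
qed

lemma iid_first_two:
  fixes D :: "'b::{second_countable_topology} measure"
  assumes D: "prob_space D" and sD: "sets D = sets borel"
    and predP: "Measurable.pred (D \<Otimes>\<^sub>M D) (\<lambda>x. P (fst x) (snd x))"
  shows "measure (PiM (UNIV::nat set) (\<lambda>_. D)) {\<omega>. P (\<omega> 0) (\<omega> 1)} = (\<integral>p. measure D {q. P p q} \<partial>D)"
proof -
  interpret D: prob_space D by fact
  interpret sequence_space D by unfold_locales
  have spD: "space D = UNIV" using sets_eq_imp_space_eq[OF sD] by simp
  have spS: "space S = UNIV" by (simp add: space_PiM spD)
  have S: "prob_space S" by (intro prob_space_PiM D)
  have c: "(\<lambda>\<omega>. \<omega> i) \<in> measurable S D" for i by (rule measurable_component_singleton) auto
  have m: "{\<omega>. P (\<omega> 0) (\<omega> 1)} \<in> sets S"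
  proof -
    have "(\<lambda>\<omega>. (\<omega> 0, \<omega> 1)) \<in> measurable S (D \<Otimes>\<^sub>M D)" by (intro measurable_Pair c)
    from measurable_compose[OF this predP] show ?thesis by (simp add: pred_def spS)
  qed
  have m2: "{x. P (fst x) (snd x 0)} \<in> sets (D \<Otimes>\<^sub>M S)"
  proof -
    have "(\<lambda>x. (fst x, snd x 0)) \<in> measurable (D \<Otimes>\<^sub>M S) (D \<Otimes>\<^sub>M D)"
      by (intro measurable_Pair measurable_fst measurable_compose[OF measurable_snd c])
    from measurable_compose[OF this predP] show ?thesis by (simp add: pred_def spS spD space_pair_measure)
  qed
  have cm: "(\<lambda>(s, \<omega>). case_nat s \<omega>) \<in> measurable (D \<Otimes>\<^sub>M S) S" by measurable
  have "measure S {\<omega>. P (\<omega> 0) (\<omega> 1)} = measure (distr (D \<Otimes>\<^sub>M S) S (\<lambda>(s, \<omega>). case_nat s \<omega>)) {\<omega>. P (\<omega> 0) (\<omega> 1)}"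
    unfolding PiM_iter ..
  also have "\<dots> = measure (D \<Otimes>\<^sub>M S) {x. P (fst x) (snd x 0)}"
    by (subst measure_distr[OF cm m]) (auto simp: space_pair_measure spS spD intro!: arg_cong[where f="measure _"])
  also have "\<dots> = (\<integral>p. measure S (Pair p -` {x. P (fst x) (snd x 0)}) \<partial>D)"
    by (rule measure_pair_cut(1)[OF D S m2])
  also have "\<dots> = (\<integral>p. measure D {q. P p q} \<partial>D)"
  proof (intro Bochner_Integration.integral_cong refl)
    fix p
    have "{q. P p q} \<in> sets D"
      using measurable_compose[OF measurable_Pair1'[of p D D] predP] by (simp add: pred_def spD)
    then have "measure (distr S D (\<lambda>\<omega>. \<omega> 0)) {q. P p q} = measure S {\<omega>. P p (\<omega> 0)}"
      by (subst measure_distr[OF c]) (auto simp: spS intro!: arg_cong[where f="measure _"])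
    moreover have "distr S D (\<lambda>\<omega>. \<omega> 0) = D" by (rule distr_PiM_component) (auto intro: D)
    ultimately show "measure S (Pair p -` {x. P (fst x) (snd x 0)}) = measure D {q. P p q}" by simp
  qed
  finally show ?thesis .
qed

section \<open>Tail asymptotics of the series\<close>

theorem theorem4p4:
  fixes M :: "'w measure"
    and A :: "nat \<Rightarrow> 'w \<Rightarrow> real^'d^'d"
    and B :: "nat \<Rightarrow> 'w \<Rightarrow> real^'d"
    and R R0 :: "'w \<Rightarrow> real^'d"
    and \<alpha> :: real
    and \<mu> :: "((real^'d^'d) \<times> (real^'d)) measure"
    and X Y :: "'w \<Rightarrow> real"
    and P :: "nat \<Rightarrow> 'w \<Rightarrow> real^'d^'d"
    and law_R :: "(real^'d) measure"
  assumes prob: "prob_space M"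
    and indep: "prob_space.indep_vars M (\<lambda>_. borel) (\<lambda>i \<omega>. (A i \<omega>, B i \<omega>)) {1..}"
    and ident: "\<And>i. i \<ge> 1 \<Longrightarrow>
      distr M borel (\<lambda>\<omega>. (A i \<omega>, B i \<omega>)) = distr M borel (\<lambda>\<omega>. (A 1 \<omega>, B 1 \<omega>))"
    and alpha: "\<alpha> > 0"
    and C1: "regularly_varying pair_norm M (\<lambda>\<omega>. (A 1 \<omega>, B 1 \<omega>)) \<alpha> \<mu>"
    and X: "X = (\<lambda>\<omega>. pair_norm (A 1 \<omega>, B 1 \<omega>))"
    and Y: "Y = (\<lambda>\<omega>. pair_norm (A 2 \<omega>, B 2 \<omega>))"
    and C2: "((\<lambda>m::real. Limsup at_top (\<lambda>x::real. ereal
        (measure M {\<omega> \<in> space M. X \<omega> * Y \<omega> > x \<and> m < X \<omega> \<and> X \<omega> \<le> x / m}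
          / measure M {\<omega> \<in> space M. X \<omega> > x}))) \<longlongrightarrow> 0) at_top"
    and C3_moment: "(\<integral>\<^sup>+\<omega>. ennreal (op_norm (A 1 \<omega>) powr \<alpha>) \<partial>M) < 1"
    and C3_mass: "emeasure \<mu> {(a, b). op_norm a > 1} > 0"
    and P: "P = (\<lambda>k \<omega>. matrix_prod (\<lambda>i. A i \<omega>) k)"
    and law_R: "law_R = distr M borel (\<lambda>\<omega>. \<Sum>k. P k \<omega> *v B (k + 1) \<omega>)"
    and R: "R \<in> borel_measurable M" "distr M borel R = law_R"
    and R0: "R0 \<in> borel_measurable M" "distr M borel R0 = law_R"
    and R0_indep: "independent_rvs M borel R0 (PiM UNIV (\<lambda>_. borel)) (\<lambda>\<omega> n. P n \<omega>)"
  shows "\<exists>\<nu> :: (real^'d) measure.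
    sets \<nu> = sets borel_punctured \<and>
    (\<forall>C\<in>sets borel_punctured. emeasure \<nu> C =
       (\<Sum>n. \<integral>\<^sup>+\<omega>. emeasure \<mu> {(a, b). P n \<omega> *v (a *v R0 \<omega> + b) \<in> C} \<partial>M)) \<and>
    vague_limit (scaled_law M R (\<lambda>\<omega>. pair_norm (A 1 \<omega>, B 1 \<omega>))) \<nu> \<and>
    (emeasure \<nu> (- {0}) \<noteq> 0 \<longrightarrow>
       regularly_varying norm M R \<alpha> (scale_measure (1 / emeasure \<nu> {r. norm r > 1}) \<nu>))"
proof -
  note One_nat_def [simp del]
  interpret prob_space M by (fact prob)
  define XB where "XB i \<omega> = (A i \<omega>, B i \<omega>)" for i \<omega>
  define D where "D = distr M borel (XB 1)"
  have indep': "indep_vars (\<lambda>_. borel) XB {1..}" using indep by (simp add: XB_def[abs_def])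
  have rv: "XB i \<in> borel_measurable M" if "i \<ge> 1" for i
    using indep' that unfolding indep_vars_def by auto
  have law: "distr M borel (XB i) = D" if "i \<ge> 1" for i
    using ident[OF that] by (simp add: D_def XB_def[abs_def])
  have rv1 [measurable]: "XB 1 \<in> borel_measurable M" by (rule rv) simp
  have pD: "prob_space D" unfolding D_def by (rule prob_space_distr[OF rv1])
  have sD [measurable_cong]: "sets D = sets borel" by (simp add: D_def)
  have spD: "space D = UNIV" by (simp add: D_def)
  have C1': "regularly_varying pair_norm M (XB 1) \<alpha> \<mu>" using C1 by (simp add: XB_def[abs_def])
  have pn_meas [measurable]: "pair_norm \<in> borel_measurable (borel :: ((real^'d^'d) \<times> (real^'d)) measure)"
    by (rule borel_measurable_continuous_onI[OF continuous_on_pair_norm])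
  have D_tail: "measure D {p. pair_norm p > t} = measure M {\<omega> \<in> space M. pair_norm (XB 1 \<omega>) > t}" for t
    unfolding D_def by (subst measure_distr[OF rv1]) (auto intro!: arg_cong[where f="measure M"])
  have "scaled_law D (\<lambda>x. x) pair_norm t = scaled_law M (XB 1) (\<lambda>\<omega>. pair_norm (XB 1 \<omega>)) t" for t
  proof -
    have "distr D borel (\<lambda>x. x /\<^sub>R t) = distr M borel (\<lambda>\<omega>. XB 1 \<omega> /\<^sub>R t)"
      unfolding D_def by (subst distr_distr) (auto simp: comp_def)
    then show ?thesis unfolding scaled_law_def using D_tail[of t] by (simp add: spD)
  qed
  then have rvD: "regularly_varying pair_norm D (\<lambda>x. x) \<alpha> \<mu>"
    using C1' unfolding regularly_varying_def vague_limit_def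
    by (simp add: measurable_ident_sets[OF sD, unfolded id_def])
  interpret D: prob_space D by (fact pD)
  interpret RV: regvar D pair_norm \<alpha> \<mu>
    by unfold_locales (rule sD continuous_on_pair_norm pair_norm_scale pair_norm_pos rvD | assumption)+
  note seq_law = iid_sequence_law[OF prob indep' law]
  define seq where "seq \<omega> n = XB (Suc n) \<omega>" for \<omega> n
  have seq: "distr M (PiM UNIV (\<lambda>_. D)) seq = PiM UNIV (\<lambda>_. D)" "seq \<in> measurable M (PiM UNIV (\<lambda>_. D))"
    using seq_law by (simp_all add: seq_def[abs_def])
  have F_M: "RV.F t = measure M {\<omega> \<in> space M. pair_norm (A 1 \<omega>, B 1 \<omega>) > t}" for t
    using D_tail[of t] by (simp add: RV.F_def XB_def)
  have two: "measure M {\<omega> \<in> space M. Q (A 1 \<omega>, B 1 \<omega>) (A 2 \<omega>, B 2 \<omega>)} = (\<integral>p. measure D {q. Q p q} \<partial>D)"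
    if Q: "Measurable.pred (D \<Otimes>\<^sub>M D) (\<lambda>x. Q (fst x) (snd x))" for Q
  proof -
    let ?S = "PiM (UNIV :: nat set) (\<lambda>_. D)"
    have "(\<lambda>\<omega>. (\<omega> 0, \<omega> 1)) \<in> measurable ?S (D \<Otimes>\<^sub>M D)"
      by (intro measurable_Pair measurable_component_singleton) auto
    from measurable_compose[OF this Q] have m: "{\<omega>. Q (\<omega> 0) (\<omega> 1)} \<in> sets ?S"
      by (simp add: pred_def space_PiM spD)
    have "measure (distr M ?S seq) {\<omega>. Q (\<omega> 0) (\<omega> 1)} = measure M {\<omega> \<in> space M. Q (seq \<omega> 0) (seq \<omega> 1)}"
      by (subst measure_distr[OF seq(2) m]) (auto intro!: arg_cong[where f="measure M"])
    then show ?thesis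
      using iid_first_two[OF pD sD Q] by (simp add: seq(1)) (simp add: seq_def XB_def numeral_2_eq_2 One_nat_def)
  qed
  \<comment> \<open>The first two pairs are independent with law \<open>D\<close>, which turns \<open>C2\<close> into the integrated form.\<close>
  interpret AR: affine_recursion D \<alpha> \<mu>
  proof unfold_locales
    fix e :: real assume e: "e > 0"
    then have "eventually (\<lambda>m::real. Limsup at_top (\<lambda>x::real. ereal
        (measure M {\<omega> \<in> space M. X \<omega> * Y \<omega> > x \<and> m < X \<omega> \<and> X \<omega> \<le> x / m}
          / measure M {\<omega> \<in> space M. X \<omega> > x})) < ereal e) at_top"
      by (intro order_tendstoD(2)[OF C2]) auto
    then show "eventually (\<lambda>m. eventually (\<lambda>x.
      (\<integral>p. indicator {p. m < pair_norm p \<and> pair_norm p \<le> x / m} p *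
         measure D {q. pair_norm p * pair_norm q > x} \<partial>D) \<le> e * RV.F x) at_top) at_top"
    proof eventually_elim
      case (elim m)
      from Limsup_lessD[OF elim]
      show ?case
      proof eventually_elim
        case (elim x)
        have "measure M {\<omega> \<in> space M. X \<omega> * Y \<omega> > x \<and> m < X \<omega> \<and> X \<omega> \<le> x / m} =
          (\<integral>p. measure D {q. pair_norm p * pair_norm q > x \<and> m < pair_norm p \<and> pair_norm p \<le> x / m} \<partial>D)"
          unfolding X Y
          by (rule two[of "\<lambda>p q. pair_norm p * pair_norm q > x \<and> m < pair_norm p \<and> pair_norm p \<le> x / m"]) measurable
        also have "\<dots> = (\<integral>p. indicator {p. m < pair_norm p \<and> pair_norm p \<le> x / m} p *
         measure D {q. pair_norm p * pair_norm q > x} \<partial>D)"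
          by (intro Bochner_Integration.integral_cong refl) (auto simp: indicator_def)
        finally show ?case
          using elim RV.F_pos[of x] unfolding X F_M[symmetric] by (simp add: pos_divide_less_eq less_imp_le)
      qed
    qed
  next
    have "(\<integral>\<^sup>+p. ennreal (op_norm (fst p) powr \<alpha>) \<partial>D) = (\<integral>\<^sup>+\<omega>. ennreal (op_norm (A 1 \<omega>) powr \<alpha>) \<partial>M)"
      unfolding D_def by (subst nn_integral_distr[OF rv1]) (auto simp: XB_def)
    then show "(\<integral>\<^sup>+p. ennreal (op_norm (fst p) powr \<alpha>) \<partial>D) < 1" using C3_moment by simp
  qed
  have S: "AR.\<S> = PiM UNIV (\<lambda>_. D)" by (rule AR.\<S>_def)
  have seqS: "distr M AR.\<S> seq = AR.\<S>" and seq_meas [measurable]: "seq \<in> measurable M AR.\<S>" using seq by (simp_all add: S)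
  have prefix: "prefix_prod (seq \<omega>) k = P k \<omega>" for \<omega> k
    unfolding prefix_prod_def P by (rule matrix_prod_cong) (auto simp: seq_def XB_def)
  have L: "AR.L = law_R"
  proof -
    have "AR.L = distr (distr M AR.\<S> seq) borel perpetuity" unfolding seqS AR.L_def ..
    also have "\<dots> = distr M borel (\<lambda>\<omega>. perpetuity (seq \<omega>))"
      by (subst distr_distr) (auto simp: comp_def)
    also have "(\<lambda>\<omega>. perpetuity (seq \<omega>)) = (\<lambda>\<omega>. \<Sum>k. P k \<omega> *v B (k + 1) \<omega>)"
      by (simp add: perpetuity_def prefix) (simp add: seq_def XB_def One_nat_def)
    finally show ?thesis by (simp add: law_R)
  qed
  have P_meas [measurable]: "P n \<in> borel_measurable M" for n
    using measurable_compose[OF seq_meas AR.prefix_prod_measurable[of n]] by (simp add: prefix)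
  have prod_law: "distr M borel (P n) = AR.prod_law n" for n
  proof -
    have "AR.prod_law n = distr (distr M AR.\<S> seq) borel (\<lambda>\<omega>. prefix_prod \<omega> n)" unfolding seqS AR.prod_law_def ..
    also have "\<dots> = distr M borel (P n)"
      by (subst distr_distr) (auto simp: comp_def prefix)
    finally show ?thesis ..
  qed
  note R_meas [measurable] = R(1) and R0_meas [measurable] = R0(1)
  interpret L: prob_space AR.L by (rule AR.prob_space_L)
  interpret M0: sigma_finite_measure "extend0 \<mu>" by (rule RV.sigma_finite_mu0)
  have joint: "AR.prod_law n \<Otimes>\<^sub>M AR.L = distr M (borel \<Otimes>\<^sub>M borel) (\<lambda>\<omega>. (P n \<omega>, R0 \<omega>))" for n
  proof (rule pair_measure_eqI)
    show "sigma_finite_measure (AR.prod_law n)" by (intro prob_space_imp_sigma_finite AR.prob_space_prod_law)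
    show "sigma_finite_measure AR.L" by (rule L.sigma_finite_measure_axioms)
    show "sets (AR.prod_law n \<Otimes>\<^sub>M AR.L) = sets (distr M (borel \<Otimes>\<^sub>M borel) (\<lambda>\<omega>. (P n \<omega>, R0 \<omega>)))"
      by (simp cong: sets_pair_measure_cong)
    fix U V assume "U \<in> sets (AR.prod_law n)" "V \<in> sets AR.L"
    then have U [measurable]: "U \<in> sets borel" and V [measurable]: "V \<in> sets borel" by simp_all
    have U': "{p. p n \<in> U} \<in> sets (PiM (UNIV :: nat set) (\<lambda>_. borel :: (real^'d^'d) measure))"
    proof -
      have comp: "(\<lambda>p. p n) \<in> measurable (PiM (UNIV :: nat set) (\<lambda>_. borel :: (real^'d^'d) measure)) borel"
        by (rule measurable_component_singleton) simp
      have "(\<lambda>p. p n) -` U \<inter> space (PiM (UNIV :: nat set) (\<lambda>_. borel)) \<in> sets (PiM (UNIV :: nat set) (\<lambda>_. borel :: (real^'d^'d) measure))"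
        by (rule measurable_sets[OF comp U])
      then show ?thesis by (simp add: space_PiM vimage_def)
    qed
    have "measure M {\<omega> \<in> space M. R0 \<omega> \<in> V \<and> P n \<omega> \<in> U} =
       measure M {\<omega> \<in> space M. R0 \<omega> \<in> V} * measure M {\<omega> \<in> space M. P n \<omega> \<in> U}"
      using R0_indep V U' unfolding independent_rvs_def by fastforce
    moreover have "emeasure (AR.prod_law n) U = measure M {\<omega> \<in> space M. P n \<omega> \<in> U}"
      unfolding prod_law[symmetric] by (subst emeasure_distr) (auto simp: emeasure_eq_measure intro!: arg_cong[where f="measure M"])
    moreover have "emeasure AR.L V = measure M {\<omega> \<in> space M. R0 \<omega> \<in> V}"
      unfolding L R0(2)[symmetric] by (subst emeasure_distr) (auto simp: emeasure_eq_measure intro!: arg_cong[where f="measure M"])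
    moreover have "emeasure (distr M (borel \<Otimes>\<^sub>M borel) (\<lambda>\<omega>. (P n \<omega>, R0 \<omega>))) (U \<times> V) = measure M {\<omega> \<in> space M. R0 \<omega> \<in> V \<and> P n \<omega> \<in> U}"
      by (subst emeasure_distr) (auto simp: emeasure_eq_measure intro!: arg_cong[where f="measure M"])
    ultimately show "emeasure (AR.prod_law n) U * emeasure AR.L V =
      emeasure (distr M (borel \<Otimes>\<^sub>M borel) (\<lambda>\<omega>. (P n \<omega>, R0 \<omega>))) (U \<times> V)"
      by (simp add: ennreal_mult' mult.commute)
  qed
  define G where "G n \<omega> p = P n \<omega> *v (fst p *v R0 \<omega> + snd p)" for n \<omega> and p :: "(real^'d^'d) \<times> (real^'d)"
  have kernel: "(\<integral>\<^sup>+\<omega>. \<integral>\<^sup>+p. g (G n \<omega> p) \<partial>extend0 \<mu> \<partial>M) =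
     (\<integral>\<^sup>+Q. \<integral>\<^sup>+z. g (Q *v AR.shock z) \<partial>(AR.L \<Otimes>\<^sub>M extend0 \<mu>) \<partial>AR.prod_law n)"
    if [measurable]: "g \<in> borel_measurable borel" for g :: "real^'d \<Rightarrow> ennreal" and n
  proof -
    define h where "h x = (\<integral>\<^sup>+p. g (fst x *v (fst p *v snd x + snd p)) \<partial>extend0 \<mu>)" for x :: "(real^'d^'d) \<times> (real^'d)"
    have h [measurable]: "h \<in> borel_measurable (borel \<Otimes>\<^sub>M borel)" unfolding h_def by measurable
    have "(\<integral>\<^sup>+\<omega>. \<integral>\<^sup>+p. g (G n \<omega> p) \<partial>extend0 \<mu> \<partial>M) = (\<integral>\<^sup>+\<omega>. h (P n \<omega>, R0 \<omega>) \<partial>M)"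
      by (simp add: h_def G_def)
    also have "\<dots> = (\<integral>\<^sup>+x. h x \<partial>distr M (borel \<Otimes>\<^sub>M borel) (\<lambda>\<omega>. (P n \<omega>, R0 \<omega>)))"
      by (rule nn_integral_distr[symmetric]) auto
    also have "\<dots> = (\<integral>\<^sup>+x. h x \<partial>(AR.prod_law n \<Otimes>\<^sub>M AR.L))" unfolding joint ..
    also have "\<dots> = (\<integral>\<^sup>+Q. \<integral>\<^sup>+r. h (Q, r) \<partial>AR.L \<partial>AR.prod_law n)"
      by (rule L.nn_integral_fst[symmetric]) measurable
    also have "\<dots> = (\<integral>\<^sup>+Q. \<integral>\<^sup>+z. g (Q *v AR.shock z) \<partial>(AR.L \<Otimes>\<^sub>M extend0 \<mu>) \<partial>AR.prod_law n)"
      by (intro nn_integral_cong, subst M0.nn_integral_fst[symmetric]) (auto simp: h_def AR.shock_def)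
    finally show ?thesis .
  qed
  have MM: "sigma_finite_measure (M \<Otimes>\<^sub>M extend0 \<mu>)"
    by (intro sigma_finite_pair_measure sigma_finite_measure_axioms M0.sigma_finite_measure_axioms)
  \<comment> \<open>The limit measure is the image of the product of the counting measure on the indices, the
    probability space and \<open>\<mu>\<close> under \<open>(n, \<omega>, p) \<mapsto> P n \<omega> (a R0 \<omega> + b)\<close>, without the origin.\<close>
  define KK where "KK = count_space (UNIV :: nat set) \<Otimes>\<^sub>M (M \<Otimes>\<^sub>M extend0 \<mu>)"
  define GG where "GG x = G (fst x) (fst (snd x)) (snd (snd x))" for x
  have GG [measurable]: "GG \<in> borel_measurable KK"
    unfolding KK_def
    by (rule measurable_pair_measure_countable1) (auto simp: GG_def G_def)
  define \<nu> where "\<nu> = restrict_space (distr KK borel GG) (- {0})"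
  have sets_nu: "sets \<nu> = sets borel_punctured" unfolding \<nu>_def by (auto simp: sets_restrict_space)
  have nu_int: "(\<integral>\<^sup>+x. g x \<partial>\<nu>) = (\<Sum>n. \<integral>\<^sup>+\<omega>. \<integral>\<^sup>+p. g (G n \<omega> p) \<partial>extend0 \<mu> \<partial>M)"
    if [measurable]: "g \<in> borel_measurable borel" and g0: "g 0 = 0" for g :: "real^'d \<Rightarrow> ennreal"
  proof -
    have "(\<integral>\<^sup>+x. g x \<partial>\<nu>) = (\<integral>\<^sup>+x. g x * indicator (- {0}) x \<partial>distr KK borel GG)"
      unfolding \<nu>_def by (subst nn_integral_restrict_space) auto
    also have "\<dots> = (\<integral>\<^sup>+x. g x \<partial>distr KK borel GG)"
      by (intro nn_integral_cong) (auto simp: indicator_def g0)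
    also have "\<dots> = (\<integral>\<^sup>+x. g (GG x) \<partial>KK)" by (rule nn_integral_distr) auto
    also have "\<dots> = (\<integral>\<^sup>+n. \<integral>\<^sup>+z. g (GG (n, z)) \<partial>(M \<Otimes>\<^sub>M extend0 \<mu>) \<partial>count_space UNIV)"
      unfolding KK_def by (rule sigma_finite_measure.nn_integral_fst[OF MM, symmetric]) (use GG in \<open>simp add: KK_def\<close>)
    also have "\<dots> = (\<Sum>n. \<integral>\<^sup>+z. g (GG (n, z)) \<partial>(M \<Otimes>\<^sub>M extend0 \<mu>))" by (rule nn_integral_count_space_nat)
    also have "\<dots> = (\<Sum>n. \<integral>\<^sup>+\<omega>. \<integral>\<^sup>+p. g (G n \<omega> p) \<partial>extend0 \<mu> \<partial>M)"
      by (intro suminf_cong, subst M0.nn_integral_fst[symmetric]) (auto simp: GG_def G_def)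
    finally show ?thesis .
  qed
  have nu_emeasure0: "emeasure \<nu> C = (\<Sum>n. \<integral>\<^sup>+\<omega>. emeasure (extend0 \<mu>) {p. G n \<omega> p \<in> C} \<partial>M)"
    if "C \<in> sets borel_punctured" for C
  proof -
    have C [measurable]: "C \<in> sets borel" "0 \<notin> C" using sets_puncturedD[OF that] by auto
    have m: "{p. G n \<omega> p \<in> C} \<in> sets (extend0 \<mu>)" for n \<omega>
    proof -
      have "{p \<in> space (extend0 \<mu>). G n \<omega> p \<in> C} \<in> sets (extend0 \<mu>)" unfolding G_def by measurable
      then show ?thesis by simp
    qed
    have "emeasure \<nu> C = (\<integral>\<^sup>+x. indicator C x \<partial>\<nu>)" using that by (simp add: sets_nu)
    also have "\<dots> = (\<Sum>n. \<integral>\<^sup>+\<omega>. \<integral>\<^sup>+p. indicator C (G n \<omega> p) \<partial>extend0 \<mu> \<partial>M)"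
      by (rule nu_int) (use C in auto)
    also have "\<dots> = (\<Sum>n. \<integral>\<^sup>+\<omega>. \<integral>\<^sup>+p. indicator {p. G n \<omega> p \<in> C} p \<partial>extend0 \<mu> \<partial>M)"
      by (simp add: indicator_def)
    also have "\<dots> = (\<Sum>n. \<integral>\<^sup>+\<omega>. emeasure (extend0 \<mu>) {p. G n \<omega> p \<in> C} \<partial>M)"
      by (subst nn_integral_indicator[OF m]) (rule refl)
    finally show ?thesis .
  qed
  have nu_emeasure: "emeasure \<nu> C = (\<Sum>n. \<integral>\<^sup>+\<omega>. emeasure \<mu> {(a, b). P n \<omega> *v (a *v R0 \<omega> + b) \<in> C} \<partial>M)"
    if C: "C \<in> sets borel_punctured" for C
  proof -
    have "emeasure (extend0 \<mu>) {p. G n \<omega> p \<in> C} = emeasure \<mu> {(a, b). P n \<omega> *v (a *v R0 \<omega> + b) \<in> C}" for n \<omega>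
    proof -
      have Cb [measurable]: "C \<in> sets borel" using sets_puncturedD[OF C] by simp
      have "{p \<in> space borel. G n \<omega> p \<in> C} \<in> sets borel" unfolding G_def by measurable
      moreover have "{p. G n \<omega> p \<in> C} - {0} = {(a, b). P n \<omega> *v (a *v R0 \<omega> + b) \<in> C}"
        using sets_puncturedD[OF C] by (auto simp: G_def zero_prod_def)
      ultimately show ?thesis by (simp add: emeasure_extend0 RV.sets_mu)
    qed
    then show ?thesis using nu_emeasure0[OF C] by simp
  qed
  have nu_contrib: "(\<integral>\<^sup>+x. ennreal (f x) \<partial>\<nu>) = (\<Sum>n. AR.contrib n f)" if f: "tail_test f" for f
  proof -
    have [measurable]: "f \<in> borel_measurable borel" by (rule tail_test_measurable[OF f])
    have "f 0 = 0" using f unfolding tail_test_def by auto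
    then have "(\<integral>\<^sup>+x. ennreal (f x) \<partial>\<nu>) = (\<Sum>n. \<integral>\<^sup>+\<omega>. \<integral>\<^sup>+p. ennreal (f (G n \<omega> p)) \<partial>extend0 \<mu> \<partial>M)"
      by (intro nu_int) auto
    also have "\<dots> = (\<Sum>n. AR.contrib n f)"
      unfolding AR.contrib_def by (intro suminf_cong kernel) measurable
    finally show ?thesis .
  qed
  have lim: "((\<lambda>t. ennreal (1 / RV.F t) * (\<integral>\<^sup>+\<omega>. ennreal (f (R \<omega> /\<^sub>R t)) \<partial>M)) \<longlongrightarrow> (\<integral>\<^sup>+x. ennreal (f x) \<partial>\<nu>)) at_top"
    if f: "tail_test f" for f
  proof -
    have [measurable]: "f \<in> borel_measurable borel" by (rule tail_test_measurable[OF f])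
    obtain c where c: "0 < c" "\<And>x. f x \<le> c" using tail_test_bound[OF f] by blast
    have "ennreal (1 / RV.F t) * (\<integral>\<^sup>+\<omega>. ennreal (f (R \<omega> /\<^sub>R t)) \<partial>M) = ennreal (AR.tail_mean t f)" for t
    proof -
      have "(\<integral>\<^sup>+\<omega>. ennreal (f (R \<omega> /\<^sub>R t)) \<partial>M) = (\<integral>\<^sup>+r. ennreal (f (r /\<^sub>R t)) \<partial>AR.L)"
        unfolding L R(2)[symmetric] by (rule nn_integral_distr[symmetric]) auto
      also have "\<dots> = ennreal (\<integral>r. f (r /\<^sub>R t) \<partial>AR.L)"
        by (intro nn_integral_eq_integral L.integrable_const_bound[where B=c]) (auto simp: tail_test_nonneg[OF f] c)
      finally show ?thesis unfolding AR.tail_mean_def by (simp add: ennreal_mult'[symmetric])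
    qed
    then show ?thesis using AR.tail_mean_limit(2)[OF f] by (simp add: nu_contrib[OF f])
  qed
  have vague: "vague_limit (scaled_law M R (\<lambda>\<omega>. pair_norm (A 1 \<omega>, B 1 \<omega>))) \<nu>"
    unfolding vague_limit_def
  proof (intro allI impI)
    fix f :: "real^'d \<Rightarrow> real" assume f: "punctured_test_function f"
    show "((\<lambda>t. \<integral>\<^sup>+x. ennreal (f x) \<partial>scaled_law M R (\<lambda>\<omega>. pair_norm (A 1 \<omega>, B 1 \<omega>)) t) \<longlongrightarrow> (\<integral>\<^sup>+x. ennreal (f x) \<partial>\<nu>)) at_top"
      unfolding nn_integral_scaled_law_punctured[OF f R(1)] F_M[symmetric]
      using lim[OF tail_test_punctured_test[OF f]] nn_integral_punctured_cong[OF sets_nu, where f=f] by simp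
  qed
  have scale: "emeasure \<nu> ((\<lambda>x. t *\<^sub>R x) ` C) = ennreal (t powr - \<alpha>) * emeasure \<nu> C"
    if t: "t > 0" and C: "C \<in> sets \<nu>" for t C
  proof -
    have C': "C \<in> sets borel_punctured" using C by (simp add: sets_nu)
    then have Cb [measurable]: "C \<in> sets borel" "0 \<notin> C" using sets_puncturedD by auto
    have img: "x \<in> (\<lambda>x. t *\<^sub>R x) ` C \<longleftrightarrow> x /\<^sub>R t \<in> C" for x
      using t by (auto intro!: image_eqI[of _ _ "x /\<^sub>R t"])
    have "(\<lambda>x. t *\<^sub>R x) ` C = {x \<in> space borel. x /\<^sub>R t \<in> C}" using img by auto
    also have "\<dots> \<in> sets borel" by measurable
    finally have tC: "(\<lambda>x. t *\<^sub>R x) ` C \<in> sets borel_punctured" using Cb t by (intro sets_puncturedI) auto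
    have "emeasure (extend0 \<mu>) {p. G n \<omega> p \<in> (\<lambda>x. t *\<^sub>R x) ` C} = ennreal (t powr - \<alpha>) * emeasure (extend0 \<mu>) {p. G n \<omega> p \<in> C}" for n \<omega>
    proof -
      have "G n \<omega> p /\<^sub>R t = G n \<omega> (p /\<^sub>R t)" for p
        by (simp add: G_def scaleR_matrix_vector_assoc[symmetric] matrix_vector_mult_scaleR
            matrix_vector_right_distrib scaleR_add_right)
      then have "{p. G n \<omega> p \<in> (\<lambda>x. t *\<^sub>R x) ` C} = {p. p /\<^sub>R t \<in> {p. G n \<omega> p \<in> C}}" by (simp add: img)
      moreover have "{p \<in> space borel. G n \<omega> p \<in> C} \<in> sets borel" unfolding G_def by measurable
      ultimately show ?thesis using RV.mu0_scale[OF t, of "{p. G n \<omega> p \<in> C}"] by simp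
    qed
    moreover have "(\<lambda>\<omega>. emeasure (extend0 \<mu>) {p. G n \<omega> p \<in> C}) \<in> borel_measurable M" for n
    proof -
      have "{x \<in> space (M \<Otimes>\<^sub>M extend0 \<mu>). G n (fst x) (snd x) \<in> C} \<in> sets (M \<Otimes>\<^sub>M extend0 \<mu>)"
        unfolding G_def by measurable
      from M0.measurable_emeasure_Pair[OF this] show ?thesis
        by (rule measurable_cong[THEN iffD1, rotated]) (auto simp: space_pair_measure intro!: arg_cong[where f="emeasure _"])
    qed
    ultimately show ?thesis
      unfolding nu_emeasure0[OF tC] nu_emeasure0[OF C'] by (simp add: nn_integral_cmult)
  qed
  have fin: "(\<integral>\<^sup>+x. ennreal (f x) \<partial>\<nu>) < \<infinity>" if "tail_test f" for f
    unfolding nu_contrib[OF that] by (rule AR.tail_mean_limit(1)[OF that])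
  show ?thesis
  proof (intro exI[of _ \<nu>] conjI ballI impI sets_nu nu_emeasure vague)
    assume nonnull: "emeasure \<nu> (- {0}) \<noteq> 0"
    show "regularly_varying norm M R \<alpha> (scale_measure (1 / emeasure \<nu> {r. norm r > 1}) \<nu>)"
      by (rule regularly_varying_of_tail_limit[OF prob R(1) alpha sets_nu RV.F_pos fin lim scale nonnull])
  qed
qed

end
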